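(* Let $V,\Psi:[1,\infty)\to[1,\infty)$ be doubling homeomorphisms and let $C_0\in(1,\infty)$ be such that $$C_0^{-1}\frac{R^2}{r^2}\le\frac{\Psi(R)}{\Psi(r)}\le C_0\frac{R\,V(R)}{r\,V(r)}\qquad\text{for all }1<r\le R.$$ Then there exist an infinite graph $\mathbb{G}=(X,E)$ and a point $p\in X$ such that the following hold. (a) The simple random walk on $\mathbb{G}$ satisfies the full sub-Gaussian heat kernel estimate $\mathrm{HKE}_{d,f}(\Psi)$, and there exists $C_1\in(1,\infty)$ such that $$C_1^{-1}V(r)\le m_{\mathbb{G}}(B_{d_{\mathbb{G}}}(x,r))\le C_1V(r)\qquad\text{for all }x\in X,\ r\ge1.$$ (b) If, for $n\in\mathbb{N}$, $\mathbb{G}_n=(X_n,E_n)$ denotes the subgraph of $\mathbb{G}$ induced by the closed ball $\{x\in X: d_{\mathbb{G}}(p,x)\le 2^n\}$, then the graphs $\mathbb{G}_n$ satisfy $\mathrm{HKE}_{d,f}(\Psi)$ uniformly (with constants independent of $n$), and there exists $C_2\in(1,\infty)$ such that $$C_2^{-1}V(r)\le m_{\mathbb{G}_n}(B_{d_{\mathbb{G}_n}}(x,r))\le C_2V(r)\qquad\text{for all }n\in\mathbb{N},\ x\in X_n,\ 1\le r\le\operatorname{diam}(\mathbb{G}_n).$$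
   Context: A homeomorphism $V:[1,\infty)\to[1,\infty)$ is doubling if there is $C>1$ with $V(2r)\le CV(r)$ for all $r\ge1$. $\mathbb{N}=\{1,2,\dots\}$. Graphs are connected and undirected. For a graph $\mathbb{G}=(X,E)$ with vertex set $X$ and edge set $E$, $d_{\mathbb{G}}$ is the combinatorial graph distance, $B_{d_{\mathbb{G}}}(x,r)$ is the open ball, and $m_{\mathbb{G}}$ is the measure on $X$ with $m_{\mathbb{G}}(\{x\})=\deg(x)$, the number of neighbours of $x$. If $(Y_n)$ is the simple random walk on $\mathbb{G}$, the discrete time heat kernel is $p_n(x,y)=\mathbb{P}_x[Y_n=y]/m_{\mathbb{G}}(\{y\})$. Let $\Psi:[1,\infty)\to[1,\infty)$ be a homeomorphism for which there are $C,\beta_1,\beta_2\in(1,\infty)$ with $C^{-1}(R/r)^{\beta_1}\le\Psi(R)/\Psi(r)\le C(R/r)^{\beta_2}$ for all $1\le r<R<\operatorname{diam}(X,d_{\mathbb{G}})$, and let $\Phi^{(d)}(s)=\sup_{r\ge1}\left(\frac{s}{r}-\frac{1}{\Psi(r)}\right)$ for $s>0$ (and, by the same formula, $\Phi^{(d)}(0)=0$). The simple random walk on $\mathbb{G}$ satisfies the full sub-Gaussian heat kernel estimate $\mathrm{HKE}_{d,f}(\Psi)$ if there exist $C_1,c_1,c_2,c_3,C_4,C_5>0$ such that for every $n\in\mathbb{N}$ and all $x,y\in X$, $$p_n(x,y)\le\frac{C_1}{m_{\mathbb{G}}(B_{d_{\mathbb{G}}}(x,\Psi^{-1}(n)))}\exp\left(-c_1n\,\Phi^{(d)}\left(c_2\tfrac{d_{\mathbb{G}}(x,y)}{n}\right)\right),$$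 $$p_n(x,y)+p_{n+1}(x,y)\ge\frac{c_3}{m_{\mathbb{G}}(B_{d_{\mathbb{G}}}(x,\Psi^{-1}(n)))}\exp\left(-C_4n\,\Phi^{(d)}\left(C_5\tfrac{d_{\mathbb{G}}(x,y)}{n}\right)\right).$$
   Formalization: The lower heat kernel bound is required only for d(x,y) ≤ n+1; for d(x,y) > n+1 one has p_n(x,y)+p_{n+1}(x,y)=0 while the right-hand side is positive, so the bound as stated for all x,y fails on every infinite graph. *)

theory Defs
  imports "HOL-Probability.Probability"
begin

definition homeo_ge1 :: "(real \<Rightarrow> real) \<Rightarrow> bool" where
  "homeo_ge1 f \<longleftrightarrow> (\<exists>g. homeomorphism {1..} {1..} f g)"

definition doubling :: "(real \<Rightarrow> real) \<Rightarrow> bool" where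
  "doubling V \<longleftrightarrow> (\<exists>C>1. \<forall>r\<ge>1. V (2 * r) \<le> C * V r)"

text \<open>
  A graph is a vertex set \<open>X\<close> together with its adjacency relation \<open>E\<close>. Graphs are simple and
  locally finite; without local finiteness neither the degree measure nor the simple random
  walk would make sense.
\<close>

definition connected_graph :: "'a set \<Rightarrow> ('a \<times> 'a) set \<Rightarrow> bool" where
  "connected_graph X E \<longleftrightarrow>
     X \<noteq> {} \<and> E \<subseteq> X \<times> X \<and> sym E \<and> irrefl E \<and>
     (\<forall>x\<in>X. finite (E `` {x})) \<and>
     (\<forall>x\<in>X. \<forall>y\<in>X. (x, y) \<in> E\<^sup>*)"

definition graph_dist :: "('a \<times> 'a) set \<Rightarrow> 'a \<Rightarrow> 'a \<Rightarrow> nat" where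
  "graph_dist E x y = (LEAST n. (x, y) \<in> E ^^ n)"

definition graph_ball :: "'a set \<Rightarrow> ('a \<times> 'a) set \<Rightarrow> 'a \<Rightarrow> real \<Rightarrow> 'a set" where
  "graph_ball X E x r = {y \<in> X. real (graph_dist E x y) < r}"

definition graph_diam :: "'a set \<Rightarrow> ('a \<times> 'a) set \<Rightarrow> ereal" where
  "graph_diam X E = (SUP x\<in>X. SUP y\<in>X. ereal (real (graph_dist E x y)))"

definition deg :: "('a \<times> 'a) set \<Rightarrow> 'a \<Rightarrow> nat" where
  "deg E x = card (E `` {x})"

definition graph_measure :: "'a set \<Rightarrow> ('a \<times> 'a) set \<Rightarrow> 'a measure" where
  "graph_measure X E = point_measure X (\<lambda>x. of_nat (deg E x))"

text \<open>
  \<open>srw E n x\<close> is the law of \<open>Y\<^sub>n\<close> under \<open>P\<^sub>x\<close>, where \<open>(Y\<^sub>n)\<close> is the simple random walk.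
  It is meaningful when every vertex has at least one and at most finitely many neighbours
  (\<open>pmf_of_set\<close> is unspecified otherwise), hence on every connected, locally finite graph with
  at least two vertices.
\<close>

primrec srw :: "('a \<times> 'a) set \<Rightarrow> nat \<Rightarrow> 'a \<Rightarrow> 'a pmf" where
  "srw E 0 x = return_pmf x"
| "srw E (Suc n) x = bind_pmf (srw E n x) (\<lambda>z. pmf_of_set (E `` {z}))"

definition heat_kernel :: "'a set \<Rightarrow> ('a \<times> 'a) set \<Rightarrow> nat \<Rightarrow> 'a \<Rightarrow> 'a \<Rightarrow> real" where
  "heat_kernel X E n x y = pmf (srw E n x) y / measure (graph_measure X E) {y}"

definition Phi_d :: "(real \<Rightarrow> real) \<Rightarrow> real \<Rightarrow> real" where
  "Phi_d \<Psi> s = (SUP r\<in>{1..}. s / r - 1 / \<Psi> r)"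

text \<open>
  The standing assumption on the scale function \<open>\<Psi>\<close> relative to a graph, with explicit constants.
\<close>

definition scale_function_with ::
  "real \<Rightarrow> real \<Rightarrow> real \<Rightarrow> (real \<Rightarrow> real) \<Rightarrow> 'a set \<Rightarrow> ('a \<times> 'a) set \<Rightarrow> bool" where
  "scale_function_with C \<beta>1 \<beta>2 \<Psi> X E \<longleftrightarrow>
     homeo_ge1 \<Psi> \<and>
     (\<forall>r R. 1 \<le> r \<and> r < R \<and> ereal R < graph_diam X E \<longrightarrow>
        inverse C * (R / r) powr \<beta>1 \<le> \<Psi> R / \<Psi> r \<and>
        \<Psi> R / \<Psi> r \<le> C * (R / r) powr \<beta>2)"

text \<open>
  The two heat kernel bounds, with explicit constants. If \<open>d(x,y) > n + 1\<close>, then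
  \<open>p\<^sub>n(x,y) + p\<^sub>n\<^sub>+\<^sub>1(x,y) = 0\<close>, while the right-hand side of the lower bound is positive. The
  lower bound is therefore required exactly for those \<open>x, y, n\<close> for which \<open>y\<close> can be reached from
  \<open>x\<close> in at most \<open>n + 1\<close> steps.
\<close>

definition HKE_bounds_with ::
  "real \<Rightarrow> real \<Rightarrow> real \<Rightarrow> real \<Rightarrow> real \<Rightarrow> real \<Rightarrow>
   (real \<Rightarrow> real) \<Rightarrow> 'a set \<Rightarrow> ('a \<times> 'a) set \<Rightarrow> bool" where
  "HKE_bounds_with C1 c1 c2 c3 C4 C5 \<Psi> X E \<longleftrightarrow>
     (\<forall>n\<ge>1. \<forall>x\<in>X. \<forall>y\<in>X.
        heat_kernel X E n x y
          \<le> C1 / measure (graph_measure X E) (graph_ball X E x (inv_into {1..} \<Psi> (real n)))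
             * exp (- c1 * real n * Phi_d \<Psi> (c2 * (real (graph_dist E x y) / real n)))) \<and>
     (\<forall>n\<ge>1. \<forall>x\<in>X. \<forall>y\<in>X. graph_dist E x y \<le> n + 1 \<longrightarrow>
        heat_kernel X E n x y + heat_kernel X E (n + 1) x y
          \<ge> c3 / measure (graph_measure X E) (graph_ball X E x (inv_into {1..} \<Psi> (real n)))
             * exp (- C4 * real n * Phi_d \<Psi> (C5 * (real (graph_dist E x y) / real n))))"

text \<open>
  Full sub-Gaussian heat kernel estimates, for a family of graphs with constants that do not
  depend on the member of the family, and for a single graph.
\<close>

definition HKE_df_uniform ::
  "(real \<Rightarrow> real) \<Rightarrow> 'i set \<Rightarrow> ('i \<Rightarrow> 'a set) \<Rightarrow> ('i \<Rightarrow> ('a \<times> 'a) set) \<Rightarrow> bool" where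
  "HKE_df_uniform \<Psi> I X E \<longleftrightarrow>
     (\<exists>C>1. \<exists>\<beta>1>1. \<exists>\<beta>2>1. \<forall>i\<in>I. scale_function_with C \<beta>1 \<beta>2 \<Psi> (X i) (E i)) \<and>
     (\<exists>C1>0. \<exists>c1>0. \<exists>c2>0. \<exists>c3>0. \<exists>C4>0. \<exists>C5>0.
        \<forall>i\<in>I. HKE_bounds_with C1 c1 c2 c3 C4 C5 \<Psi> (X i) (E i))"

definition HKE_df :: "(real \<Rightarrow> real) \<Rightarrow> 'a set \<Rightarrow> ('a \<times> 'a) set \<Rightarrow> bool" where
  "HKE_df \<Psi> X E \<longleftrightarrow>
     (\<exists>C>1. \<exists>\<beta>1>1. \<exists>\<beta>2>1. scale_function_with C \<beta>1 \<beta>2 \<Psi> X E) \<and>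
     (\<exists>C1>0. \<exists>c1>0. \<exists>c2>0. \<exists>c3>0. \<exists>C4>0. \<exists>C5>0.
        HKE_bounds_with C1 c1 c2 c3 C4 C5 \<Psi> X E)"

text \<open>
  Closed ball of radius \<open>2 ^ n\<close> around \<open>p\<close> and the edges of the subgraph it induces.
\<close>

definition sub_verts :: "'a set \<Rightarrow> ('a \<times> 'a) set \<Rightarrow> 'a \<Rightarrow> nat \<Rightarrow> 'a set" where
  "sub_verts X E p n = {x \<in> X. graph_dist E p x \<le> 2 ^ n}"

definition sub_edges :: "'a set \<Rightarrow> ('a \<times> 'a) set \<Rightarrow> 'a \<Rightarrow> nat \<Rightarrow> ('a \<times> 'a) set" where
  "sub_edges X E p n = Restr E (sub_verts X E p n)"

end

(* Copies of a block are glued recursively along end fibres: the block of level k + 1 consists of a k arms,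
   each of f k copies of the block of level k. The block of level k has diameter about 2^k, volume
   m k = (product of a i * f i, i < k) and traversal time t k = 2^k * (product of a i, i < k), and by the
   hypotheses on V and Psi the bounded integers a k >= 2 and f k >= 1 can be chosen such that m k ~ V(2^k) and
   t k ~ Psi(2^k). A Poincare inequality on blocks, proved by induction on the level, shows that the walk on a
   block of level k mixes within time of order t k. Folding a larger block onto a block of level k does not
   decrease the heat kernel, whence the on-diagonal upper bound. Superharmonic interpolation between the ends
   of blocks bounds the probability of crossing many blocks, and mixing within single blocks along a chain of
   glued blocks gives the lower bound. The blocks are the closed balls of radius 2^n about one end, so
   the bounds pass to the infinite graph. *)
theory Submission
  imports Defs
begin

section \<open>Mixed-radix blocks and their gluing\<close>

text \<open>Volume and time have to be tuned independently while lengths double at every level. Arms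
  multiply both volume and time. Copies within an arm must multiply the volume only, so their free
  ends are not joined: an end of a block is a fibre of \<open>W k\<close> vertices, and the copies
  act as resistors in parallel. The resistance between the ends is then of order
  \<open>2 ^ k / W k\<close>; times the volume \<open>A k * W k\<close> this gives
  \<open>t k\<close>, whatever \<open>f\<close> is. So \<open>A k\<close> has to follow \<Psi>(2^k)
  / 2^k, which at least doubles per level up to a constant, and \<open>W k\<close> has to follow
  V(2^k) 2^k / \<Psi>(2^k), which is nondecreasing up to a constant: these are the two hypotheses.
  Gluing fibres point by point makes reduction modulo \<open>m l\<close> compatible with the walk:
  the walk is a reflected walk on one block, together with a random choice among the glued blocks at
  each visit to an end. The obstacle is that the position in the folded block and the identity of
  the block are dependent. A label that counts alternations between the two ends separates them:
  walk and label live on a single block, and the label controls the block up to powers of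
  \<open>D\<close>.\<close>

text \<open>The edges of the block of level \<open>k\<close> are the numbers below \<open>m k\<close>, written in mixed radix with digits
  below \<open>a j * f j\<close>. Digit \<open>d\<close> at position \<open>k\<close> selects copy \<open>d\<close> of the level \<open>k\<close> block, in arm \<open>d mod a k\<close>.
  The pair \<open>(e, b)\<close> is the half-edge at one end of the edge \<open>e\<close>. To build level \<open>k + 1\<close>, the Q-ends of all
  copies are glued together digitwise; the P-ends in arms \<open>0\<close> and \<open>1\<close> become the new P-end and Q-end.
  \<open>Cl M e b\<close> is the set of edges that share the vertex of \<open>(e, b)\<close> in the block of level \<open>M\<close>.\<close>

locale glued_blocks =
  fixes a f :: "nat \<Rightarrow> nat" and D :: nat
  assumes a_ge2: "2 \<le> a k" and f_ge1: "1 \<le> f k" and af_le: "a k * f k \<le> D"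
begin

definition N :: "nat \<Rightarrow> nat" where "N k = a k * f k"
definition m :: "nat \<Rightarrow> nat" where "m k = (\<Prod>i<k. N i)"
definition A :: "nat \<Rightarrow> nat" where "A k = (\<Prod>i<k. a i)"
definition W :: "nat \<Rightarrow> nat" where "W k = (\<Prod>i<k. f i)"
definition t :: "nat \<Rightarrow> nat" where "t k = 2 ^ k * A k"

definition digit :: "nat \<Rightarrow> nat \<Rightarrow> nat" where "digit k e = (e div m k) mod N k"
definition arm :: "nat \<Rightarrow> nat \<Rightarrow> nat" where "arm k e = digit k e mod a k"
definition upd :: "nat \<Rightarrow> nat \<Rightarrow> nat \<Rightarrow> nat" where
  "upd k d e = e mod m k + m k * (d + N k * (e div m (Suc k)))"

text \<open>Only the arm part of a digit is prescribed. The copy part is free, so an end of a block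
  of level \<open>k\<close> consists of \<open>W k\<close> half-edges, which are different vertices
  of that block.\<close>

definition isP :: "nat \<Rightarrow> nat \<Rightarrow> bool \<Rightarrow> bool" where
  "isP k e b \<longleftrightarrow> \<not> b \<and> (\<forall>j<k. arm j e = 0)"
text \<open>At positive levels a Q-end is a former P-end and lies on side \<open>False\<close>.
  Hence side \<open>True\<close> is glued at level 0 only, and the two half-edges of an edge are
  never glued at the same level.\<close>

fun isQ :: "nat \<Rightarrow> nat \<Rightarrow> bool \<Rightarrow> bool" where
  "isQ 0 e b = b"
| "isQ (Suc k) e b = (isP k e b \<and> arm k e = 1)"

definition Cl :: "nat \<Rightarrow> nat \<Rightarrow> bool \<Rightarrow> nat set" where
  "Cl M e b = {e'. e' = e \<or> (\<exists>k<M. isQ k e b \<and> (\<exists>d<N k. e' = upd k d e))}"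

lemma a_pos: "a k > 0" using a_ge2[of k] by linarith
lemma f_pos: "f k > 0" using f_ge1[of k] by linarith
lemma N_ge2: "N k \<ge> 2" unfolding N_def using mult_le_mono[OF a_ge2[of k] f_ge1[of k]] by simp
lemma N_pos: "N k > 0" using N_ge2[of k] by linarith
lemma N_le: "N k \<le> D" using af_le by (simp add: N_def)
lemma D_ge2: "D \<ge> 2" using N_le[of 0] N_ge2[of 0] by linarith
lemma m_0[simp]: "m 0 = 1" by (simp add: m_def)
lemma m_Suc: "m (Suc k) = m k * N k" by (simp add: m_def)
lemma A_0[simp]: "A 0 = 1" by (simp add: A_def)
lemma A_Suc: "A (Suc k) = A k * a k" by (simp add: A_def)
lemma W_0[simp]: "W 0 = 1" by (simp add: W_def)
lemma W_Suc: "W (Suc k) = W k * f k" by (simp add: W_def)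
lemma t_0[simp]: "t 0 = 1" by (simp add: t_def)
lemma t_Suc: "t (Suc k) = 2 * a k * t k" by (simp add: t_def A_Suc)
lemma m_pos: "m k > 0" by (simp add: m_def N_pos)
lemma A_pos: "A k > 0" by (simp add: A_def a_pos)
lemma W_pos: "W k > 0" by (simp add: W_def f_pos)
lemma t_pos: "t k > 0" by (simp add: t_def A_pos)
lemma m_eq: "m k = A k * W k" by (induction k) (auto simp: m_Suc A_Suc W_Suc N_def)
lemma t_Suc_ge: "t (Suc k) \<ge> 4 * t k"
  using a_ge2[of k] by (simp add: t_Suc)

lemma m_ge: "m k \<ge> 2 ^ k"
proof (induction k)
  case (Suc k)
  have "2 ^ k * 2 \<le> m k * N k" by (intro mult_le_mono Suc N_ge2)
  then show ?case by (simp add: m_Suc)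
qed simp

lemma lt_m: "e < m e"
  using m_ge[of e] less_exp[of e] by linarith

lemma m_dvd: "k \<le> l \<Longrightarrow> m k dvd m l"
  unfolding m_def by (rule prod_dvd_prod_subset) auto

lemma m_mono: "k \<le> l \<Longrightarrow> m k \<le> m l"
  using m_dvd m_pos dvd_imp_le by blast

section \<open>Arithmetic of mixed-radix digits\<close>

lemma digit_lt: "digit k e < N k" unfolding digit_def by (simp add: N_pos)

lemma digit_mod: "digit j (e mod m l) = (if j < l then digit j e else 0)"
proof (cases "j < l")
  case True
  have "(e mod m l) div m j mod N j = (e mod m l) mod m (Suc j) div m j"
    by (simp add: m_Suc mod_mult2_eq m_pos)
  also have "(e mod m l) mod m (Suc j) = e mod m (Suc j)"
    by (rule mod_mod_cancel) (use True m_dvd[of "Suc j" l] in simp)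
  also have "\<dots> div m j = e div m j mod N j"
    by (simp add: m_Suc mod_mult2_eq m_pos)
  finally show ?thesis using True by (simp add: digit_def)
next
  case False
  have "e mod m l < m l" using m_pos by simp
  also have "\<dots> \<le> m j" using False by (intro m_mono) auto
  finally show ?thesis using False by (simp add: digit_def)
qed

lemma digit_glue_low: "j < l \<Longrightarrow> digit j (z + m l * B) = digit j z"
  using digit_mod[of j "z + m l * B" l] digit_mod[of j z l] by simp

lemma digit_glue_high: "z < m l \<Longrightarrow> l \<le> j \<Longrightarrow> digit j (z + m l * B) = digit j (m l * B)"
proof -
  assume z: "z < m l" and lj: "l \<le> j"
  obtain q where q: "m j = m l * q" using m_dvd[OF lj] by (auto simp: dvd_def)
  show ?thesis using z m_pos[of l] by (simp add: digit_def q div_mult2_eq)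
qed

lemma digits_sum: "e < m M \<Longrightarrow> e = (\<Sum>j<M. digit j e * m j)"
proof (induction M arbitrary: e)
  case (Suc M)
  have "e = e mod m M + m M * (e div m M)" by simp
  moreover have "e mod m M = (\<Sum>j<M. digit j e * m j)"
    using Suc.IH[of "e mod m M"] m_pos by (simp add: digit_mod)
  moreover have "e div m M = digit M e" using Suc.prems
    by (simp add: digit_def m_Suc m_pos less_mult_imp_div_less mult.commute)
  ultimately show ?case by (simp add: mult.commute)
qed simp

lemma digits_ext: assumes "\<And>j. digit j e = digit j e'" shows "e = e'"
proof -
  let ?M = "max e e'"
  have "e < m ?M" "e' < m ?M" using lt_m[of e] lt_m[of e'] m_mono[of e ?M] m_mono[of e' ?M] by auto
  then show ?thesis using digits_sum[of e ?M] digits_sum[of e' ?M] assms by simp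
qed

lemma digit_ge: "e < m M \<Longrightarrow> M \<le> j \<Longrightarrow> digit j e = 0"
  using m_mono[of M j] by (simp add: digit_def)

lemma lt_m_iff: "e < m M \<longleftrightarrow> (\<forall>j\<ge>M. digit j e = 0)"
proof
  assume *: "\<forall>j\<ge>M. digit j e = 0"
  have "e mod m M = e" by (rule digits_ext) (use * in \<open>auto simp: digit_mod\<close>)
  then show "e < m M" by (metis m_pos mod_less_divisor)
qed (use digit_ge in blast)

lemma digit_upd: "d < N k \<Longrightarrow> digit j (upd k d e) = (if j = k then d else digit j e)"
proof -
  assume d: "d < N k"
  have low: "e mod m k < m k" using m_pos by simp
  have lt: "e mod m k + m k * d < m (Suc k)"
  proof -
    have "m k * (d + 1) \<le> m k * N k" using d by (intro mult_le_mono) auto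
    then show ?thesis using low by (simp add: m_Suc)
  qed
  have u: "upd k d e = (e mod m k + m k * d) + m (Suc k) * (e div m (Suc k))"
    by (simp add: upd_def m_Suc algebra_simps)
  consider "j < k" | "j = k" | "j > k" by linarith
  then show ?thesis
  proof cases
    case 1 then show ?thesis unfolding upd_def by (simp add: digit_glue_low digit_mod)
  next
    case 2
    have "digit k (upd k d e) = digit k (e mod m k + m k * d)" unfolding u by (rule digit_glue_low) simp
    also have "\<dots> = d" using low d m_pos[of k] by (simp add: digit_def)
    finally show ?thesis using 2 by simp
  next
    case 3
    have "digit j (upd k d e) = digit j (m (Suc k) * (e div m (Suc k)))"
      unfolding u by (rule digit_glue_high) (use 3 lt in auto)
    also have "\<dots> = digit j (e mod m (Suc k) + m (Suc k) * (e div m (Suc k)))"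
      by (rule digit_glue_high[symmetric]) (use 3 m_pos in auto)
    finally show ?thesis using 3 by simp
  qed
qed

lemma arm_upd: "d < N k \<Longrightarrow> arm j (upd k d e) = (if j = k then d mod a k else arm j e)"
  by (simp add: arm_def digit_upd)
lemma arm_mod: "arm j (e mod m l) = (if j < l then arm j e else 0)"
  by (simp add: arm_def digit_mod)
lemma arm_glue_low: "j < l \<Longrightarrow> arm j (z + m l * B) = arm j z"
  by (simp add: arm_def digit_glue_low)
lemma arm_glue_high: "z < m l \<Longrightarrow> l \<le> j \<Longrightarrow> arm j (z + m l * B) = arm j (m l * B)"
  by (simp add: arm_def digit_glue_high)

lemma upd_same: "upd k (digit k e) e = e"
  by (rule digits_ext) (simp add: digit_upd digit_lt)
lemma upd_upd: "d < N k \<Longrightarrow> d' < N k \<Longrightarrow> upd k d (upd k d' e) = upd k d e"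
  by (rule digits_ext) (simp add: digit_upd)
lemma upd_inj: "d < N k \<Longrightarrow> d' < N k \<Longrightarrow> upd k d e = upd k d' e \<Longrightarrow> d = d'"
  by (metis digit_upd)
lemma upd_lt: "e < m M \<Longrightarrow> k < M \<Longrightarrow> d < N k \<Longrightarrow> upd k d e < m M"
  unfolding lt_m_iff by (auto simp: digit_upd)

section \<open>End half-edges and gluing classes\<close>

lemma isP_cong: "(\<And>j. j < k \<Longrightarrow> arm j e = arm j e') \<Longrightarrow> isP k e b = isP k e' b"
  by (auto simp: isP_def)
lemma isQ_cong: "(\<And>j. j < k \<Longrightarrow> arm j e = arm j e') \<Longrightarrow> isQ k e b = isQ k e' b"
  by (cases k) (use isP_cong[of "k - 1" e e' b] in auto)

lemma isP_0[simp]: "isP 0 e b = (\<not> b)" by (simp add: isP_def)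
lemma isP_Suc: "isP (Suc k) e b \<longleftrightarrow> isP k e b \<and> arm k e = 0"
  by (auto simp: isP_def less_Suc_eq)
lemma isP_antimono: "isP l e b \<Longrightarrow> k \<le> l \<Longrightarrow> isP k e b" by (auto simp: isP_def)
lemma isP_not_isQ: "isP k e b \<Longrightarrow> \<not> isQ k e b"
  by (cases k) (auto simp: isP_def)
lemma isQ_isP: "isQ l e b \<Longrightarrow> k < l \<Longrightarrow> isP k e b"
  by (cases l) (auto intro: isP_antimono)
text \<open>A Q-end of level \<open>l\<close> is a P-end of every lower level, and a P-end is never
  a Q-end of the same level. So a half-edge is glued at one level at most, and a class varies in a
  single digit.\<close>

lemma isQ_unique: "isQ k e b \<Longrightarrow> isQ l e b \<Longrightarrow> k = l"
  by (metis isP_not_isQ isQ_isP linorder_neqE_nat)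
lemma isQ_upd: "d < N k \<Longrightarrow> isQ k (upd k d e) b = isQ k e b"
  by (rule isQ_cong) (simp add: arm_upd)

lemma Cl_isQ: "isQ k e b \<Longrightarrow> k < M \<Longrightarrow> Cl M e b = (\<lambda>d. upd k d e) ` {..<N k}"
proof (intro set_eqI iffI)
  fix e' assume *: "isQ k e b" "k < M" "e' \<in> Cl M e b"
  from *(3) consider "e' = e" | j d where "j < M" "isQ j e b" "d < N j" "e' = upd j d e"
    by (auto simp: Cl_def)
  then show "e' \<in> (\<lambda>d. upd k d e) ` {..<N k}"
  proof cases
    case 1 then show ?thesis using upd_same[of k e] digit_lt[of k e] by (metis imageI lessThan_iff)
  next
    case 2 then show ?thesis using isQ_unique[OF *(1), of j] by auto
  qed
qed (auto simp: Cl_def)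

lemma Cl_triv: "(\<And>k. k < M \<Longrightarrow> \<not> isQ k e b) \<Longrightarrow> Cl M e b = {e}"
  by (auto simp: Cl_def)

lemma Cl_cases:
  obtains k where "k < M" "isQ k e b" "Cl M e b = (\<lambda>d. upd k d e) ` {..<N k}"
  | "\<And>k. k < M \<Longrightarrow> \<not> isQ k e b" "Cl M e b = {e}"
  using Cl_isQ Cl_triv by metis

lemma Cl_refl[simp]: "e \<in> Cl M e b" by (simp add: Cl_def)
lemma Cl_finite[simp]: "finite (Cl M e b)" by (cases rule: Cl_cases[of M e b]) auto

lemma card_Cl_isQ: "isQ k e b \<Longrightarrow> k < M \<Longrightarrow> card (Cl M e b) = N k"
  unfolding Cl_isQ using upd_inj by (subst card_image) (auto simp: inj_on_def)

lemma card_Cl_pos: "card (Cl M e b) > 0"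
  by (metis Cl_finite Cl_refl card_gt_0_iff empty_iff)

lemma card_Cl_le: "card (Cl M e b) \<le> D"
proof (cases rule: Cl_cases[of M e b])
  case (1 k) then show ?thesis using card_Cl_isQ[of k e b M] N_le[of k] by simp
next
  case 2 then show ?thesis using D_ge2 by simp
qed

lemma Cl_eq: assumes "e' \<in> Cl M e b" shows "Cl M e' b = Cl M e b"
proof (cases rule: Cl_cases[of M e b])
  case (1 k)
  then obtain d where d: "d < N k" "e' = upd k d e" using assms by auto
  have "Cl M e' b = (\<lambda>d'. upd k d' e') ` {..<N k}"
    by (rule Cl_isQ) (use 1 d in \<open>auto simp: isQ_upd\<close>)
  also have "\<dots> = (\<lambda>d'. upd k d' e) ` {..<N k}" using d by (intro image_cong) (auto simp: upd_upd)
  finally show ?thesis using 1 by simp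
next
  case 2 then show ?thesis using assms by simp
qed

lemma Cl_sym: "e' \<in> Cl M e b \<longleftrightarrow> e \<in> Cl M e' b"
  using Cl_eq Cl_refl by blast

lemma Cl_lt: "e < m M \<Longrightarrow> e' \<in> Cl M e b \<Longrightarrow> e' < m M"
  by (auto simp: Cl_def upd_lt)

text \<open>A half-edge that is an end of its block of level \<open>l\<close> can only be glued at
  level \<open>l\<close> or above, which leaves the digits below \<open>l\<close> unchanged.\<close>

lemma Cl_mod_high: assumes "isP l (e mod m l) b \<or> isQ l (e mod m l) b" "e' \<in> Cl M e b"
  shows "e' mod m l = e mod m l"
proof (rule digits_ext)
  have c: "isP l (e mod m l) b = isP l e b" "isQ l (e mod m l) b = isQ l e b"
    by (auto intro!: isP_cong isQ_cong simp: arm_mod)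
  have nk: "isQ k e b \<Longrightarrow> k \<ge> l" for k
    using assms(1) c isP_not_isQ isQ_isP isQ_unique isP_antimono
    by (metis linorder_not_le nat_less_le)
  fix j show "digit j (e' mod m l) = digit j (e mod m l)"
    using assms(2) nk by (fastforce simp: Cl_def digit_mod digit_upd)
qed

text \<open>A Q-end of a level above \<open>l\<close> would be a P-end of level \<open>l\<close>. So
  a half-edge that is no end of its block of level \<open>l\<close> is glued below \<open>l\<close>
  only, and its class stays inside the block.\<close>

lemma Cl_low: assumes "\<not> isP l (e mod m l) b" "\<not> isQ l (e mod m l) b" "l \<le> M"
  shows "Cl M e b = (\<lambda>z. z + m l * (e div m l)) ` Cl l (e mod m l) b"
proof -
  let ?z = "e mod m l" and ?B = "e div m l"
  have c: "k \<le> l \<Longrightarrow> isQ k ?z b = isQ k e b" for k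
    by (auto intro!: isQ_cong simp: arm_mod)
  have cP: "isP l ?z b = isP l e b" by (auto intro!: isP_cong simp: arm_mod)
  have kl: "k < l" if "isQ k e b" for k
  proof (rule ccontr)
    assume "\<not> k < l"
    then consider "k = l" | "l < k" by linarith
    then show False
    proof cases
      case 1 then show ?thesis using that assms c[of l] by simp
    next
      case 2 then show ?thesis using isQ_isP[OF that 2] cP assms by simp
    qed
  qed
  have u: "upd k d e = upd k d ?z + m l * ?B" if "k < l" "d < N k" for k d
  proof (rule digits_ext)
    fix j
    have lt: "upd k d ?z < m l" by (rule upd_lt) (use that m_pos in auto)
    show "digit j (upd k d e) = digit j (upd k d ?z + m l * ?B)"
    proof (cases "j < l")
      case True then show ?thesis using that by (simp add: digit_upd digit_glue_low digit_mod)
    next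
      case False
      then have "digit j (upd k d ?z + m l * ?B) = digit j (m l * ?B)"
        by (intro digit_glue_high lt) auto
      also have "\<dots> = digit j (?z + m l * ?B)" using False m_pos by (intro digit_glue_high[symmetric]) auto
      finally show ?thesis using that False by (simp add: digit_upd)
    qed
  qed
  show ?thesis
  proof (cases rule: Cl_cases[of M e b])
    case (1 k)
    have k: "k < l" using kl 1 by blast
    then have "Cl l ?z b = (\<lambda>d. upd k d ?z) ` {..<N k}"
      using 1 c[of k] by (intro Cl_isQ) auto
    then show ?thesis using 1 k u by (auto simp: image_image intro!: image_cong)
  next
    case 2
    have "Cl l ?z b = {?z}" by (rule Cl_triv) (use 2 c assms(3) in auto)
    then show ?thesis using 2 by simp
  qed
qed

text \<open>End vertices of blocks of level \<open>l\<close> are represented by \<open>(zr l c, bz l c)\<close>, where \<open>c\<close>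
  selects the Q-end; \<open>CB\<close> is the set of blocks glued to the block \<open>B\<close> at that end.\<close>

definition zr :: "nat \<Rightarrow> bool \<Rightarrow> nat" where "zr l c = (if c \<and> l > 0 then m (l - 1) else 0)"
definition bz :: "nat \<Rightarrow> bool \<Rightarrow> bool" where "bz l c = (c \<and> l = 0)"
definition isE :: "nat \<Rightarrow> bool \<Rightarrow> nat \<Rightarrow> bool \<Rightarrow> bool" where
  "isE l c e b = (if c then isQ l e b else isP l e b)"
definition CB :: "nat \<Rightarrow> nat \<Rightarrow> bool \<Rightarrow> nat \<Rightarrow> nat set" where
  "CB M l c B = (\<lambda>e'. e' div m l) ` Cl M (zr l c + m l * B) (bz l c)"

lemma zr_lt: "zr l c < m l"
  using m_pos[of l] N_ge2[of "l - 1"] m_pos[of "l - 1"] m_Suc[of "l - 1"]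
  by (auto simp: zr_def)

lemma digit_zr: "digit j (zr l c) = (if c \<and> l > 0 \<and> j = l - 1 then 1 else 0)"
proof -
  have "upd k 1 0 = m k" for k by (simp add: upd_def)
  moreover have "1 < N k" for k using N_ge2[of k] by linarith
  moreover have "digit j 0 = 0" for j by (simp add: digit_def)
  ultimately show ?thesis unfolding zr_def using digit_upd[of 1 "l - 1" j 0] by auto
qed

lemma isE_zr: "isE l c (zr l c) (bz l c)"
proof -
  have "1 mod a j = 1" for j using a_ge2[of j] by simp
  then have "arm j (zr l c) = (if c \<and> l > 0 \<and> j = l - 1 then 1 else 0)" for j
    by (auto simp: arm_def digit_zr)
  then show ?thesis by (cases l) (auto simp: isE_def isP_def bz_def)
qed

lemma isE_glue: "isE l c (z + m l * B) b = isE l c z b"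
  using isP_cong[of l "z + m l * B" z b] isQ_cong[of l "z + m l * B" z b]
  by (simp add: isE_def arm_glue_low)

text \<open>The level of gluing is determined by the type of the end and the digits from
  \<open>l\<close> on, not by the position in the fibre. Hence one set \<open>CB\<close> of
  neighbouring blocks serves the whole fibre, which is what makes folding possible.\<close>

lemma Cl_end: assumes "isE l c z b" "z < m l"
  shows "Cl M (z + m l * B) b = (\<lambda>B'. z + m l * B') ` CB M l c B"
proof -
  let ?y = "zr l c" and ?b = "bz l c"
  have lo: "isE l c (z + m l * B) b" "isE l c (?y + m l * B) ?b"
    using assms(1) isE_zr[of l c] isE_glue by blast+
  have q: "isQ k (z + m l * B) b \<longleftrightarrow> isQ k (?y + m l * B) ?b" for k
  proof (cases "k \<le> l")
    case True
    have "isE l c e b \<Longrightarrow> isQ k e b \<longleftrightarrow> k = l \<and> c" for e b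
      unfolding isE_def using True
      by (metis isP_antimono isP_not_isQ isQ_unique)
    then show ?thesis using lo by blast
  next
    case False
    then obtain i where k: "k = Suc i" "l \<le> i" by (cases k) auto
    have h: "j \<ge> l \<Longrightarrow> arm j (z + m l * B) = arm j (?y + m l * B)" for j
      using arm_glue_high[OF assms(2)] arm_glue_high[OF zr_lt] by metis
    have P: "isP i e b \<longleftrightarrow> \<not> c \<and> (\<forall>j. l \<le> j \<longrightarrow> j < i \<longrightarrow> arm j e = 0)" if "isE l c e b" for e b
    proof (cases c)
      case True
      then have "isQ l e b" using that by (simp add: isE_def)
      then have "\<not> isP i e b" using k(2) isP_antimono isP_not_isQ by blast
      then show ?thesis using True by simp
    next
      case False
      then have "isP l e b" using that by (simp add: isE_def)
      then show ?thesis using False by (auto simp: isP_def) (metis linorder_not_le)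
    qed
    show ?thesis using k P[OF lo(1)] P[OF lo(2)] h by auto
  qed
  have ql: "isQ k (z + m l * B) b \<Longrightarrow> l \<le> k" for k
    using lo(1) unfolding isE_def by (metis isP_antimono isP_not_isQ isQ_isP linorder_not_le nat_less_le)
  have u: "upd k d (z + m l * B) = z + m l * (upd k d (?y + m l * B) div m l)"
    if "l \<le> k" "d < N k" for k d
  proof (rule digits_ext)
    fix j
    let ?u = "upd k d (?y + m l * B)"
    show "digit j (upd k d (z + m l * B)) = digit j (z + m l * (?u div m l))"
    proof (cases "j < l")
      case True then show ?thesis using that by (simp add: digit_upd digit_glue_low)
    next
      case False
      then have "digit j (z + m l * (?u div m l)) = digit j (m l * (?u div m l))"
        using assms(2) by (intro digit_glue_high) auto
      also have "\<dots> = digit j (?u mod m l + m l * (?u div m l))"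
        using False m_pos by (intro digit_glue_high[symmetric]) auto
      finally have *: "digit j (z + m l * (?u div m l)) = digit j ?u" by simp
      have "digit j (z + m l * B) = digit j (?y + m l * B)"
        using False digit_glue_high[OF assms(2)] digit_glue_high[OF zr_lt] by (metis linorder_not_le)
      then show ?thesis using * that by (simp add: digit_upd)
    qed
  qed
  show ?thesis
  proof (cases rule: Cl_cases[of M "z + m l * B" b])
    case (1 k)
    then have "Cl M (?y + m l * B) ?b = (\<lambda>d. upd k d (?y + m l * B)) ` {..<N k}"
      using q by (intro Cl_isQ) auto
    then show ?thesis unfolding CB_def using 1 u ql[OF 1(2)] by (auto simp: image_image intro!: image_cong)
  next
    case 2
    have "Cl M (?y + m l * B) ?b = {?y + m l * B}" by (rule Cl_triv) (use 2 q in auto)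
    then show ?thesis unfolding CB_def using 2 zr_lt[of l c] by simp
  qed
qed

lemma CB_refl[simp]: "B \<in> CB M l c B"
  unfolding CB_def using zr_lt[of l c] by (intro image_eqI[of _ _ "zr l c + m l * B"]) auto
lemma CB_finite[simp]: "finite (CB M l c B)" by (simp add: CB_def)
lemma card_CB: assumes "isE l c z b" "z < m l" shows "card (CB M l c B) = card (Cl M (z + m l * B) b)"
  unfolding Cl_end[OF assms] using m_pos[of l] by (subst card_image) (auto simp: inj_on_def)
lemma card_CB_le: "card (CB M l c B) \<le> D"
  using card_CB[OF isE_zr zr_lt] card_Cl_le by simp
lemma card_CB_pos: "card (CB M l c B) > 0"
  using card_CB[OF isE_zr zr_lt] card_Cl_pos by simp
lemma CB_eq: assumes "B' \<in> CB M l c B" shows "CB M l c B' = CB M l c B"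
proof -
  have "zr l c + m l * B' \<in> Cl M (zr l c + m l * B) (bz l c)"
    unfolding Cl_end[OF isE_zr zr_lt] using assms by blast
  from Cl_eq[OF this] show ?thesis
    unfolding CB_def by simp
qed

end

lemma sum_blocks: "(\<Sum>e<k * q. g e) = (\<Sum>B<q. \<Sum>z<k. g (z + k * B))" for g :: "nat \<Rightarrow> 'b::comm_monoid_add"
proof (induction q)
  case (Suc q)
  have "{..<k * Suc q} = {..<k * q} \<union> {k * q..<k * q + k}" by auto
  then have "(\<Sum>e<k * Suc q. g e) = (\<Sum>e<k * q. g e) + (\<Sum>e\<in>{k * q..<k * q + k}. g e)"
    by (subst sum.union_disjoint[symmetric]) (auto simp: ivl_disj_int)
  also have "(\<Sum>e\<in>{k * q..<k * q + k}. g e) = (\<Sum>z<k. g (z + k * q))"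
    by (rule sum.reindex_bij_witness[of _ "\<lambda>z. z + k * q" "\<lambda>e. e - k * q"]) auto
  finally show ?case using Suc by simp
qed simp

section \<open>The walk operator on functions of half-edges\<close>

definition av :: "'b set \<Rightarrow> ('b \<Rightarrow> real) \<Rightarrow> real" where "av S g = (\<Sum>x\<in>S. g x) / card S"

lemma av_const: "finite S \<Longrightarrow> S \<noteq> {} \<Longrightarrow> (\<And>x. x \<in> S \<Longrightarrow> g x = c) \<Longrightarrow> av S g = c"
  by (simp add: av_def)
lemma av_mono: "(\<And>x. x \<in> S \<Longrightarrow> g x \<le> h x) \<Longrightarrow> av S g \<le> av S h"
  by (simp add: av_def divide_right_mono sum_mono)
lemma av_nonneg: "(\<And>x. x \<in> S \<Longrightarrow> 0 \<le> g x) \<Longrightarrow> 0 \<le> av S g"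
  by (simp add: av_def sum_nonneg)
lemma av_add: "av S (\<lambda>x. g x + h x) = av S g + av S h"
  by (simp add: av_def sum.distrib add_divide_distrib)
lemma av_cmult: "av S (\<lambda>x. c * g x) = c * av S g"
  by (simp add: av_def sum_distrib_left[symmetric])
lemma av_sum: "av S (\<lambda>x. \<Sum>i\<in>I. g i x) = (\<Sum>i\<in>I. av S (g i))"
  by (simp add: av_def sum_divide_distrib[symmetric] sum.swap[of _ S])
lemma av_single[simp]: "av {x} g = g x" by (simp add: av_def)
lemma av_le_const: "finite S \<Longrightarrow> S \<noteq> {} \<Longrightarrow> (\<And>x. x \<in> S \<Longrightarrow> g x \<le> c) \<Longrightarrow> av S g \<le> c"
  using av_mono[of S g "\<lambda>_. c"] av_const[of S "\<lambda>_. c" c] by simp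
lemma av_cong: "S = T \<Longrightarrow> (\<And>x. x \<in> T \<Longrightarrow> g x = h x) \<Longrightarrow> av S g = av T h"
  by (simp add: av_def)
lemma av_image: "inj_on h S \<Longrightarrow> av (h ` S) g = av S (\<lambda>x. g (h x))"
  by (simp add: av_def sum.reindex card_image)

lemma av_ge_member: "finite S \<Longrightarrow> x \<in> S \<Longrightarrow> (\<And>y. y \<in> S \<Longrightarrow> 0 \<le> g y) \<Longrightarrow> card S \<le> D \<Longrightarrow> g x / real D \<le> av S g"
proof -
  assume *: "finite S" "x \<in> S" "\<And>y. y \<in> S \<Longrightarrow> 0 \<le> g y" "card S \<le> D"
  have "g x \<le> sum g S" by (rule member_le_sum) (use * in auto)
  moreover have "0 < card S" using * card_gt_0_iff by blast
  ultimately show ?thesis unfolding av_def using * by (intro frac_le sum_nonneg) auto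
qed

text \<open>Double counting: the weight \<open>1 / card (C x)\<close> is symmetric in two members of
  a class and sums to one over the class. This becomes the invariance of the degree measure.\<close>

lemma sum_av_classes:
  fixes g :: "'b \<Rightarrow> real"
  assumes fin: "finite X" and sub: "\<And>x. x \<in> X \<Longrightarrow> C x \<subseteq> X" and self: "\<And>x. x \<in> X \<Longrightarrow> x \<in> C x"
    and eq: "\<And>x y. x \<in> X \<Longrightarrow> y \<in> C x \<Longrightarrow> C y = C x"
  shows "(\<Sum>x\<in>X. av (C x) g) = (\<Sum>x\<in>X. g x)"
proof -
  have "(\<Sum>x\<in>X. av (C x) g) = (\<Sum>x\<in>X. \<Sum>y\<in>X. if y \<in> C x then g y / card (C x) else 0)"
  proof (rule sum.cong[OF refl])
    fix x assume x: "x \<in> X"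
    have "(\<Sum>y\<in>X. if y \<in> C x then g y / card (C x) else 0) = (\<Sum>y\<in>X \<inter> C x. g y / card (C x))"
      by (rule sum.inter_restrict[OF fin, symmetric])
    also have "X \<inter> C x = C x" using sub x by auto
    finally show "av (C x) g = (\<Sum>y\<in>X. if y \<in> C x then g y / card (C x) else 0)"
      by (simp add: av_def sum_divide_distrib)
  qed
  also have "\<dots> = (\<Sum>y\<in>X. \<Sum>x\<in>X. if x \<in> C y then g y / card (C y) else 0)"
  proof (subst sum.swap, rule sum.cong[OF refl], rule sum.cong[OF refl])
    fix y x assume xy: "y \<in> X" "x \<in> X"
    show "(if y \<in> C x then g y / card (C x) else 0) = (if x \<in> C y then g y / card (C y) else 0)"
    proof (cases "y \<in> C x")
      case True
      have e: "C y = C x" by (rule eq) (use xy True in auto)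
      show ?thesis using True self[OF xy(2)] unfolding e by simp
    next
      case False
      have "x \<notin> C y" using False eq[OF xy(1)] self[OF xy(1)] by blast
      then show ?thesis using False by simp
    qed
  qed
  also have "\<dots> = (\<Sum>y\<in>X. g y)"
  proof (rule sum.cong[OF refl])
    fix y assume y: "y \<in> X"
    have "finite (C y)" using sub[OF y] fin finite_subset by blast
    then have "card (C y) > 0" using self[OF y] card_gt_0_iff by blast
    moreover have "(\<Sum>x\<in>X. if x \<in> C y then g y / card (C y) else 0) = (\<Sum>x\<in>X \<inter> C y. g y / card (C y))"
      by (rule sum.inter_restrict[OF fin, symmetric])
    moreover have "X \<inter> C y = C y" using sub y by auto
    ultimately show "(\<Sum>x\<in>X. if x \<in> C y then g y / card (C y) else 0) = g y" by simp
  qed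
  finally show ?thesis .
qed

context glued_blocks begin

text \<open>A vertex has as many half-edges as its degree, so \<open>HS\<close> integrates against the degree measure the
  functions that are constant on vertices (\<open>cons\<close>).\<close>

definition walk :: "nat \<Rightarrow> (nat \<Rightarrow> bool \<Rightarrow> real) \<Rightarrow> nat \<Rightarrow> bool \<Rightarrow> real" where
  "walk M F e b = av (Cl M e b) (\<lambda>e'. F e' (\<not> b))"
definition HS :: "nat \<Rightarrow> (nat \<Rightarrow> bool \<Rightarrow> real) \<Rightarrow> real" where
  "HS M F = (\<Sum>e<m M. F e False + F e True)"
definition IP :: "nat \<Rightarrow> (nat \<Rightarrow> bool \<Rightarrow> real) \<Rightarrow> (nat \<Rightarrow> bool \<Rightarrow> real) \<Rightarrow> real" where
  "IP M F G = HS M (\<lambda>e b. F e b * G e b)"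
definition cons :: "nat \<Rightarrow> (nat \<Rightarrow> bool \<Rightarrow> real) \<Rightarrow> bool" where
  "cons M F \<longleftrightarrow> (\<forall>e<m M. \<forall>b. \<forall>e'\<in>Cl M e b. F e' b = F e b)"

lemma Cl_nonempty[simp]: "Cl M e b \<noteq> {}" using Cl_refl by blast

lemma HS_cong: "(\<And>e b. e < m M \<Longrightarrow> F e b = G e b) \<Longrightarrow> HS M F = HS M G"
  by (simp add: HS_def)
lemma HS_mono: "(\<And>e b. e < m M \<Longrightarrow> F e b \<le> G e b) \<Longrightarrow> HS M F \<le> HS M G"
  unfolding HS_def by (intro sum_mono add_mono) auto
lemma HS_nonneg: "(\<And>e b. e < m M \<Longrightarrow> 0 \<le> F e b) \<Longrightarrow> 0 \<le> HS M F"
  unfolding HS_def by (intro sum_nonneg add_nonneg_nonneg) auto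
lemma HS_add: "HS M (\<lambda>e b. F e b + G e b) = HS M F + HS M G"
  by (simp add: HS_def sum.distrib)
lemma HS_diff: "HS M (\<lambda>e b. F e b - G e b) = HS M F - HS M G"
  by (simp add: HS_def sum.distrib sum_subtractf)
lemma HS_cmult: "HS M (\<lambda>e b. c * F e b) = c * HS M F"
  by (simp add: HS_def sum_distrib_left distrib_left)
lemma HS_sum: "HS M (\<lambda>e b. \<Sum>i\<in>I. F i e b) = (\<Sum>i\<in>I. HS M (F i))"
  unfolding HS_def by (simp add: sum.distrib[symmetric] sum.swap[of _ I])
lemma HS_flip: "HS M (\<lambda>e b. F e (\<not> b)) = HS M F"
  by (simp add: HS_def add.commute)
lemma HS_const: "HS M (\<lambda>e b. c) = 2 * real (m M) * c" by (simp add: HS_def)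

lemma HS_av: "HS M (\<lambda>e b. av (Cl M e b) (\<lambda>e'. F e' b)) = HS M F"
proof -
  have "(\<Sum>e<m M. av (Cl M e b) (\<lambda>e'. F e' b)) = (\<Sum>e<m M. F e b)" for b
    by (rule sum_av_classes) (use Cl_lt Cl_eq in auto)
  then show ?thesis by (simp add: HS_def sum.distrib)
qed

lemma walk_cong: "e < m M \<Longrightarrow> (\<And>e b. e < m M \<Longrightarrow> F e b = G e b) \<Longrightarrow> walk M F e b = walk M G e b"
  unfolding walk_def by (rule av_cong) (use Cl_lt in auto)
lemma walk_mono: "e < m M \<Longrightarrow> (\<And>e b. e < m M \<Longrightarrow> F e b \<le> G e b) \<Longrightarrow> walk M F e b \<le> walk M G e b"
  unfolding walk_def by (rule av_mono) (use Cl_lt in auto)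
lemma walk_nonneg: "e < m M \<Longrightarrow> (\<And>e b. e < m M \<Longrightarrow> 0 \<le> F e b) \<Longrightarrow> 0 \<le> walk M F e b"
  unfolding walk_def by (rule av_nonneg) (use Cl_lt in auto)
lemma walk_add: "walk M (\<lambda>e b. F e b + G e b) e b = walk M F e b + walk M G e b"
  by (simp add: walk_def av_add)
lemma walk_cmult: "walk M (\<lambda>e b. c * F e b) e b = c * walk M F e b"
  by (simp add: walk_def av_cmult)
lemma walk_diff: "walk M (\<lambda>e b. F e b - G e b) e b = walk M F e b - walk M G e b"
  using walk_add[of M F "\<lambda>e b. (-1) * G e b" e b] walk_cmult[of M "-1" G e b] by simp
lemma walk_sum: "walk M (\<lambda>e b. \<Sum>i\<in>I. F i e b) e b = (\<Sum>i\<in>I. walk M (F i) e b)"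
  by (simp add: walk_def av_sum)
lemma walk_const[simp]: "walk M (\<lambda>e b. c) e b = c"
  unfolding walk_def by (rule av_const) auto

lemma cons_walk: "cons M (walk M F)"
  unfolding cons_def walk_def using Cl_eq by metis

lemma consD: "cons M F \<Longrightarrow> e < m M \<Longrightarrow> e' \<in> Cl M e b \<Longrightarrow> F e' b = F e b"
  unfolding cons_def by blast

text \<open>A function that is constant on vertices can be moved into the average, and averaging
  preserves the sum over half-edges. What remains is the flip along edges, whose symmetry makes the
  walk self-adjoint.\<close>

lemma IP_walk: assumes "cons M G" shows "IP M (walk M F) G = HS M (\<lambda>e b. F e (\<not> b) * G e b)"
proof -
  have "IP M (walk M F) G = HS M (\<lambda>e b. av (Cl M e b) (\<lambda>e'. F e' (\<not> b) * G e' b))"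
    unfolding IP_def
  proof (rule HS_cong)
    fix e b assume e: "e < m M"
    have "walk M F e b * G e b = av (Cl M e b) (\<lambda>e'. G e b * F e' (\<not> b))"
      by (simp add: walk_def av_cmult)
    also have "\<dots> = av (Cl M e b) (\<lambda>e'. F e' (\<not> b) * G e' b)"
      by (rule av_cong[OF refl]) (metis consD[OF assms e] mult.commute)
    finally show "walk M F e b * G e b = av (Cl M e b) (\<lambda>e'. F e' (\<not> b) * G e' b)" .
  qed
  also have "\<dots> = HS M (\<lambda>e b. F e (\<not> b) * G e b)" by (rule HS_av)
  finally show ?thesis .
qed

lemma IP_commute: "IP M F G = IP M G F" by (simp add: IP_def mult.commute)

lemma walk_adj: assumes "cons M F" "cons M G" shows "IP M (walk M F) G = IP M F (walk M G)"
proof -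
  have "IP M (walk M F) G = HS M (\<lambda>e b. F e (\<not> b) * G e b)" by (rule IP_walk) fact
  also have "\<dots> = HS M (\<lambda>e b. G e (\<not> b) * F e b)"
    using HS_flip[of M "\<lambda>e b. F e b * G e (\<not> b)"] by (simp add: mult.commute)
  also have "\<dots> = IP M (walk M G) F" by (rule IP_walk[symmetric]) fact
  finally show ?thesis by (simp add: IP_commute)
qed

lemma HS_walk: "HS M (walk M F) = HS M F"
  using IP_walk[of M "\<lambda>_ _. 1" F] HS_flip[of M F] by (simp add: cons_def IP_def)

section \<open>The walk seen from a sub-block\<close>

lemma walk_end: assumes "isE l c z b" "z < m l"
  shows "walk M F (z + m l * B) b = av (CB M l c B) (\<lambda>B'. F (z + m l * B') (\<not> b))"
  unfolding walk_def Cl_end[OF assms] by (rule av_image) (use m_pos[of l] in \<open>auto simp: inj_on_def\<close>)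

lemma walk_low: assumes "\<not> isP l z b" "\<not> isQ l z b" "z < m l" "l \<le> M"
  shows "walk M F (z + m l * B) b = walk l (\<lambda>z. F (z + m l * B)) z b"
proof -
  have "Cl M (z + m l * B) b = (\<lambda>z. z + m l * B) ` Cl l z b"
    using Cl_low[of l "z + m l * B" b M] assms by simp
  then show ?thesis unfolding walk_def by (simp add: av_image inj_on_def)
qed

lemma Cl_own_end: "isE l c z b \<Longrightarrow> Cl l z b = {z}"
  by (rule Cl_triv) (metis isE_def isP_antimono isP_not_isQ isQ_unique nat_less_le)

text \<open>In its own block an end vertex has degree one, so the walk is reflected there.\<close>

lemma walk_own_end: "isE l c z b \<Longrightarrow> walk l F z b = F z (\<not> b)"
  by (simp add: walk_def Cl_own_end)

lemma CB_Suc_Q: assumes "d < N k" shows "CB (Suc k) k True d = {..<N k}"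
proof -
  let ?y = "zr k True"
  have y: "?y < m k" by (rule zr_lt)
  have "?y + m k * d < m k * (d + 1)" using y by simp
  also have "\<dots> \<le> m (Suc k)" unfolding m_Suc using assms by (intro mult_le_mono) auto
  finally have "(?y + m k * d) div m (Suc k) = 0" by simp
  then have "upd k d' (?y + m k * d) = ?y + m k * d'" for d'
    unfolding upd_def using y by simp
  moreover have "isQ k (?y + m k * d) (bz k True)"
    using isE_zr[of k True] isE_glue[of k True ?y d "bz k True"] by (simp add: isE_def)
  ultimately have "Cl (Suc k) (?y + m k * d) (bz k True) = (\<lambda>d'. ?y + m k * d') ` {..<N k}"
    using Cl_isQ[of k "?y + m k * d" "bz k True" "Suc k"] by simp
  then show ?thesis using y by (simp add: CB_def image_image)
qed

lemma CB_Suc_P: "CB (Suc k) k False d = {d}"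
proof -
  have P: "isP k (0 + m k * d) False"
    using isE_glue[of k False 0 d False] by (simp add: isE_def isP_def arm_def digit_def)
  have "\<not> isQ j (0 + m k * d) False" if "j < Suc k" for j
    using P that isP_antimono isP_not_isQ less_Suc_eq_le by blast
  then have "Cl (Suc k) (0 + m k * d) False = {0 + m k * d}" by (intro Cl_triv) auto
  then show ?thesis using m_pos[of k] by (simp add: CB_def zr_def bz_def)
qed

lemma walk_Suc_Q: "isQ k z b \<Longrightarrow> z < m k \<Longrightarrow> d < N k \<Longrightarrow>
    walk (Suc k) F (z + m k * d) b = av {..<N k} (\<lambda>d'. F (z + m k * d') (\<not> b))"
  using walk_end[of k True z b "Suc k" F d] by (simp add: isE_def CB_Suc_Q)
lemma walk_Suc_P: "isP k z b \<Longrightarrow> z < m k \<Longrightarrow> walk (Suc k) F (z + m k * d) b = F (z + m k * d) (\<not> b)"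
  using walk_end[of k False z b "Suc k" F d] by (simp add: isE_def CB_Suc_P)
lemma walk_Suc: assumes "\<not> isQ k z b" "z < m k"
  shows "walk (Suc k) F (z + m k * d) b = walk k (\<lambda>z. F (z + m k * d)) z b"
proof (cases "isP k z b")
  case True
  show ?thesis unfolding walk_Suc_P[OF True assms(2)] using True
    by (subst walk_own_end[of k False]) (auto simp: isE_def)
next
  case False then show ?thesis using assms by (intro walk_low) auto
qed

lemma HS_blocks: "l \<le> M \<Longrightarrow> HS M F = (\<Sum>B<m M div m l. HS l (\<lambda>z. F (z + m l * B)))"
  unfolding HS_def using m_dvd[of l M] sum_blocks[of "\<lambda>e. F e False + F e True" "m l" "m M div m l"] by simp
lemma HS_Suc: "HS (Suc k) F = (\<Sum>d<N k. HS k (\<lambda>z. F (z + m k * d)))"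
  unfolding HS_def m_Suc by (rule sum_blocks)

section \<open>Harmonic height and crossing time of a block\<close>

lemma sum_mod_a: "(\<Sum>d<N k. h (d mod a k)) = real (f k) * (\<Sum>s<a k. h s :: real)"
  unfolding N_def sum_blocks by simp

text \<open>\<open>height\<close> interpolates harmonically between \<open>0\<close> on the P-end and \<open>2 ^ k\<close> on the Q-end, and \<open>timer\<close> grows
  by one in the mean at each step of the walk that is not taken from the Q-end, up to \<open>t k\<close> there.\<close>

fun height :: "nat \<Rightarrow> nat \<Rightarrow> bool \<Rightarrow> real" where
  "height 0 e b = (if b then 1 else 0)"
| "height (Suc k) e b = (if arm k e = 0 then height k e b else if arm k e = 1 then 2 ^ Suc k - height k e b else 2 ^ k)"

fun timer :: "nat \<Rightarrow> nat \<Rightarrow> bool \<Rightarrow> real" where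
  "timer 0 e b = (if b then 1 else 0)"
| "timer (Suc k) e b = timer k e b + (if arm k e = 1 then 2 * A (Suc k) * (2 ^ k - height k e b) else 0)"

lemma height_glue: "l \<le> k \<Longrightarrow> height l (z + m k * d) b = height l z b"
  by (induction l) (auto simp: arm_glue_low)
lemma timer_glue: "l \<le> k \<Longrightarrow> timer l (z + m k * d) b = timer l z b"
  by (induction l) (auto simp: arm_glue_low height_glue)

lemma height_bounds: "0 \<le> height k e b \<and> height k e b \<le> 2 ^ k"
proof (induction k)
  case (Suc k)
  have "(2::real) ^ k \<ge> 0" by simp
  then show ?case using Suc by auto
qed simp

lemma height_P: "isP k e b \<Longrightarrow> height k e b = 0 \<and> height k e (\<not> b) = 1"
  by (induction k) (auto simp: isP_Suc)
lemma height_Q: "isQ k e b \<Longrightarrow> height k e b = 2 ^ k \<and> height k e (\<not> b) = 2 ^ k - 1"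
  using height_P by (cases k) auto
lemma height_lip: "\<bar>height k e b - height k e b'\<bar> \<le> 1"
  by (induction k) auto

lemma timer_P: "isP k e b \<Longrightarrow> timer k e b = 0 \<and> timer k e (\<not> b) = 1"
  by (induction k) (auto simp: isP_Suc)
lemma real_t: "real (t k) = 2 ^ k * real (A k)" by (simp add: t_def)
lemma timer_Q: "isQ k e b \<Longrightarrow> timer k e b = t k \<and> timer k e (\<not> b) = real (t k) + 1 - 2 * A k"
proof (cases k)
  case (Suc j)
  assume "isQ k e b"
  then have "isP j e b" "arm j e = 1" using Suc by auto
  then show ?thesis using Suc height_P[of j e b] timer_P[of j e b] by (simp add: real_t algebra_simps)
qed auto

text \<open>The last two inequalities keep the numerator of \<open>pot\<close> in direction
  \<open>True\<close> between 0 and \<open>t k\<close>, since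
  \<open>2 * A k * 2 ^ k = 2 * t k\<close>. They are carried along because the correction in arm 1
  involves \<open>height\<close>.\<close>

lemma timer_bounds: "0 \<le> timer k e b \<and> timer k e b \<le> t k \<and> timer k e b \<le> 2 * A k * height k e b \<and>
   0 \<le> timer k e b + 2 * A k * (2 ^ k - height k e b) - t k"
proof (induction k)
  case (Suc k)
  have near_const: "real (A (Suc k)) \<ge> 2 * A k"
  proof -
    have "A k * 2 \<le> A k * a k" using a_ge2 by (intro mult_le_mono) auto
    then have "real (A k * 2) \<le> real (A k * a k)" by (rule of_nat_mono)
    then show ?thesis by (simp add: A_Suc)
  qed
  have l: "0 \<le> height k e b" "height k e b \<le> 2 ^ k" using height_bounds by auto
  have mono: "2 * A k * height k e b \<le> 2 * A (Suc k) * height k e b"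
    using l near_const by (intro mult_right_mono) auto
  have tm: "real (t k) \<le> 2 * A (Suc k) * 2 ^ k" "real (t k) * 2 \<le> 2 * A (Suc k) * 2 ^ k"
  proof -
    have "2 ^ k * (2 * real (A k)) \<le> 2 ^ k * real (A (Suc k))" using near_const by (intro mult_left_mono) auto
    moreover have "2 ^ k * real (A k) \<ge> 0" by simp
    ultimately show "real (t k) \<le> 2 * A (Suc k) * 2 ^ k" "real (t k) * 2 \<le> 2 * A (Suc k) * 2 ^ k"
      by (simp_all add: real_t)
  qed
  have tS: "real (t (Suc k)) = 2 * A (Suc k) * 2 ^ k" by (simp add: real_t)
  have pos: "0 \<le> 2 * A (Suc k) * (2 ^ k - height k e b)" using l by simp
  consider "arm k e = 0" | "arm k e = 1" | "arm k e \<noteq> 0" "arm k e \<noteq> 1" by blast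
  then show ?case
  proof cases
    case 1 then show ?thesis using Suc mono tm tS pos by (auto simp: algebra_simps)
  next
    case 2 then show ?thesis using Suc mono tm tS pos by (auto simp: algebra_simps)
  next
    case 3 then show ?thesis using Suc mono tm tS pos by (auto simp: algebra_simps)
  qed
qed auto

lemma lt_m_Suc_decomp: "e < m (Suc k) \<Longrightarrow> \<exists>z d. e = z + m k * d \<and> z < m k \<and> d < N k"
  by (rule exI[of _ "e mod m k"], rule exI[of _ "e div m k"])
     (use m_pos[of k] in \<open>auto simp: m_Suc less_mult_imp_div_less mult.commute\<close>)

lemma digit_top: "z < m k \<Longrightarrow> d < N k \<Longrightarrow> digit k (z + m k * d) = d"
  using m_pos[of k] by (simp add: digit_def)
lemma arm_top: "z < m k \<Longrightarrow> d < N k \<Longrightarrow> arm k (z + m k * d) = d mod a k"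
  by (simp add: arm_def digit_top)

lemma av_lessThan_mod: "av {..<N k} (\<lambda>d. h (d mod a k)) = (\<Sum>s<a k. h s) / a k"
  unfolding av_def sum_mod_a using f_pos[of k] by (simp add: N_def)

lemma sum_three: "2 \<le> n \<Longrightarrow> (\<Sum>s<n. if s = 0 then x else if s = Suc 0 then y else z) = x + y + (real n - 2) * z"
proof (induction n rule: nat_induct_at_least)
  case base then show ?case by (simp add: numeral_2_eq_2)
next
  case (Suc n) then show ?case by (simp add: algebra_simps)
qed

lemma av_three: "av {..<N k} (\<lambda>d. if d mod a k = 0 then x else if d mod a k = Suc 0 then y else z) =
    (x + y + (real (a k) - 2) * z) / a k"
  using av_lessThan_mod[of k "\<lambda>s. if s = 0 then x else if s = Suc 0 then y else z"]
  by (simp add: sum_three a_ge2)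

lemma isP_glue: "l \<le> k \<Longrightarrow> isP l (z + m k * d) b = isP l z b"
  by (rule isP_cong) (simp add: arm_glue_low)
lemma isQ_glue: "l \<le> k \<Longrightarrow> isQ l (z + m k * d) b = isQ l z b"
  by (rule isQ_cong) (simp add: arm_glue_low)

text \<open>At the common Q-end of the copies arm 0 lies one unit below \<open>2 ^ k\<close>, arm 1
  one unit above, and the other arms are dead ends on which the height is constant; the mean is
  \<open>2 ^ k\<close>.\<close>

lemma height_harm: "e < m k \<Longrightarrow> \<not> isP k e b \<Longrightarrow> \<not> isQ k e b \<Longrightarrow> walk k (height k) e b = height k e b"
proof (induction k arbitrary: e)
  case (Suc k)
  obtain z d where zd: "e = z + m k * d" "z < m k" "d < N k" using lt_m_Suc_decomp[OF Suc.prems(1)] by blast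
  have s: "height (Suc k) (z + m k * d') b' = (if d' mod a k = 0 then height k z b' else
        if d' mod a k = 1 then 2 ^ Suc k - height k z b' else 2 ^ k)" if "d' < N k" for d' b'
    using zd that by (simp add: arm_top height_glue)
  show ?case
  proof (cases "isQ k z b")
    case True
    have "walk (Suc k) (height (Suc k)) e b = av {..<N k} (\<lambda>d'. height (Suc k) (z + m k * d') (\<not> b))"
      unfolding zd by (rule walk_Suc_Q) (use zd True in auto)
    also have "\<dots> = av {..<N k} (\<lambda>d'. if d' mod a k = 0 then 2 ^ k - 1 else if d' mod a k = Suc 0 then 2 ^ k + 1 else 2 ^ k)"
      by (rule av_cong) (auto simp: s height_Q[OF True] simp del: height.simps)
    also have "\<dots> = 2 ^ k" unfolding av_three using a_ge2[of k] by (simp add: field_simps)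
    also have "\<dots> = height (Suc k) e b" unfolding zd(1) s[OF zd(3)] using height_Q[OF True] by auto
    finally show ?thesis .
  next
    case False
    have "walk (Suc k) (height (Suc k)) e b = walk k (\<lambda>z. height (Suc k) (z + m k * d)) z b"
      unfolding zd by (rule walk_Suc) (use zd False in auto)
    also have "\<dots> = walk k (\<lambda>z b'. if d mod a k = 0 then height k z b' else
        if d mod a k = 1 then 2 ^ Suc k - height k z b' else 2 ^ k) z b"
      by (rule walk_cong) (use zd in \<open>auto simp: arm_top height_glue\<close>)
    also have "\<dots> = height (Suc k) e b"
    proof (cases "d mod a k = 0 \<or> d mod a k = 1")
      case True
      then have nP: "\<not> isP k z b"
        using Suc.prems zd(2,3) unfolding zd(1) by (auto simp: isP_Suc arm_top isP_glue)
      have "walk k (height k) z b = height k z b" by (rule Suc.IH) (use zd nP False in auto)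
      then show ?thesis unfolding zd(1) s[OF zd(3)] using True walk_diff[of k "\<lambda>_ _. 2 ^ Suc k" "height k" z b]
        by auto
    next
      case False then show ?thesis unfolding zd(1) s[OF zd(3)] by auto
    qed
    finally show ?thesis .
  qed
qed auto

text \<open>At the common Q-end a step back into a copy changes the timer of level \<open>k\<close>
  by \<open>1 - 2 * A k\<close>. The extra term gains \<open>2 * A (Suc k)\<close> in arm 1, that is
  with probability \<open>1 / a k\<close>; since \<open>A (Suc k) = A k * a k\<close>, the mean is
  exactly one.\<close>

lemma timer_step: "e < m k \<Longrightarrow> \<not> isQ k e b \<Longrightarrow> walk k (timer k) e b = timer k e b + 1"
proof (induction k arbitrary: e)
  case 0
  then show ?case by (auto simp: walk_def Cl_def)
next
  case (Suc k)
  obtain z d where zd: "e = z + m k * d" "z < m k" "d < N k" using lt_m_Suc_decomp[OF Suc.prems(1)] by blast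
  have s: "timer (Suc k) (z + m k * d') b' = timer k z b' + (if d' mod a k = 1 then 2 * A (Suc k) * (2 ^ k - height k z b') else 0)"
    if "d' < N k" for d' b'
    using zd that by (simp add: arm_top height_glue timer_glue)
  show ?case
  proof (cases "isQ k z b")
    case True
    have "walk (Suc k) (timer (Suc k)) e b = av {..<N k} (\<lambda>d'. timer (Suc k) (z + m k * d') (\<not> b))"
      unfolding zd by (rule walk_Suc_Q) (use zd True in auto)
    also have "\<dots> = av {..<N k} (\<lambda>d'. if d' mod a k = 0 then real (t k) + 1 - 2 * A k else if d' mod a k = Suc 0 then real (t k) + 1 - 2 * A k + 2 * A (Suc k) else real (t k) + 1 - 2 * A k)"
      by (rule av_cong) (auto simp: s height_Q[OF True] timer_Q[OF True] simp del: timer.simps height.simps)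
    also have "\<dots> = real (t k) + 1" unfolding av_three using a_ge2[of k] by (simp add: field_simps A_Suc)
    also have "\<dots> = timer (Suc k) e b + 1" unfolding zd(1) s[OF zd(3)] using height_Q[OF True] timer_Q[OF True] by auto
    finally show ?thesis .
  next
    case False
    have IH: "walk k (timer k) z b = timer k z b + 1" by (rule Suc.IH) (use zd False in auto)
    have "walk (Suc k) (timer (Suc k)) e b = walk k (\<lambda>z. timer (Suc k) (z + m k * d)) z b"
      unfolding zd by (rule walk_Suc) (use zd False in auto)
    also have "\<dots> = walk k (\<lambda>z b'. timer k z b' + (if d mod a k = 1 then 2 * A (Suc k) * (2 ^ k - height k z b') else 0)) z b"
      by (rule walk_cong) (use zd in \<open>auto simp: arm_top height_glue timer_glue\<close>)
    also have "\<dots> = timer (Suc k) e b + 1"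
    proof (cases "d mod a k = 1")
      case True
      then have nP: "\<not> isP k z b"
        using Suc.prems zd(2,3) unfolding zd(1) by (auto simp: arm_top isP_glue)
      have "walk k (height k) z b = height k z b" by (rule height_harm) (use zd nP False in auto)
      then show ?thesis unfolding zd(1) s[OF zd(3)] using True IH walk_diff[of k "\<lambda>_ _. 2 ^ k" "height k" z b]
        by (simp add: walk_add walk_cmult)
    next
      case False then show ?thesis unfolding zd(1) s[OF zd(3)] using IH by auto
    qed
    finally show ?thesis .
  qed
qed

end

section \<open>Poincare inequality and mixing\<close>

lemma sum_sq_le: "(\<Sum>i\<in>I. x i)\<^sup>2 \<le> real (card I) * (\<Sum>i\<in>I. (x i)\<^sup>2)"
  using Cauchy_Schwarz_ineq_sum[of "\<lambda>_. 1" x I] by simp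

context glued_blocks begin

section \<open>Dirichlet energy and resistance between the ends\<close>

definition energy :: "nat \<Rightarrow> (nat \<Rightarrow> bool \<Rightarrow> real) \<Rightarrow> real" where
  "energy k F = (\<Sum>e<m k. (F e False - F e True)\<^sup>2)"

lemma energy_nonneg: "0 \<le> energy k F" by (simp add: energy_def sum_nonneg)
lemma energy_Suc: "energy (Suc k) F = (\<Sum>d<N k. energy k (\<lambda>z. F (z + m k * d)))"
  unfolding energy_def m_Suc by (rule sum_blocks)

text \<open>Average over an end fibre. At a positive level either end is made of P-ends of copies,
  in arm 0 or in arm 1, so the recursion always descends to P-ends.\<close>

primrec EAv :: "nat \<Rightarrow> bool \<Rightarrow> (nat \<Rightarrow> bool \<Rightarrow> real) \<Rightarrow> real" where
  "EAv 0 c F = F 0 c"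
| "EAv (Suc k) c F = (\<Sum>i<f k. EAv k False (\<lambda>z. F (z + m k * ((if c then 1 else 0) + a k * i)))) / f k"

lemma arm_lt: "s < a k \<Longrightarrow> i < f k \<Longrightarrow> s + a k * i < N k"
proof -
  assume *: "s < a k" "i < f k"
  have "s + a k * i < a k * (i + 1)" using * by simp
  also have "\<dots> \<le> N k" unfolding N_def using * by (intro mult_le_mono) auto
  finally show ?thesis .
qed

lemma EAv_cong: "(\<And>z b. z < m k \<Longrightarrow> isE k c z b \<Longrightarrow> F z b = G z b) \<Longrightarrow> EAv k c F = EAv k c G"
proof (induction k arbitrary: c F G)
  case 0
  show ?case using "0"[of 0 c] by (auto simp: isE_def split: if_splits)
next
  case (Suc k)
  let ?s = "if c then 1 else 0 :: nat"
  have "EAv k False (\<lambda>z. F (z + m k * (?s + a k * i))) = EAv k False (\<lambda>z. G (z + m k * (?s + a k * i)))"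
    if i: "i < f k" for i
  proof (rule Suc.IH)
    fix z b assume z: "z < m k" "isE k False z b"
    have s: "?s < a k" using a_ge2[of k] by auto
    have d: "?s + a k * i < N k" using arm_lt[OF s i] .
    have "z + m k * (?s + a k * i) < m k * (?s + a k * i + 1)" using z by simp
    also have "\<dots> \<le> m (Suc k)" unfolding m_Suc using d by (intro mult_le_mono) auto
    finally have lt: "z + m k * (?s + a k * i) < m (Suc k)" .
    have "(?s + a k * i) mod a k = ?s" using s by simp
    then have "arm k (z + m k * (?s + a k * i)) = ?s" using arm_top[OF z(1) d] by (simp only:)
    moreover have "isP k (z + m k * (?s + a k * i)) b" using z(2) by (simp add: isE_def isP_glue)
    ultimately have "isE (Suc k) c (z + m k * (?s + a k * i)) b"
      by (cases c) (simp_all add: isE_def isP_Suc)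
    then show "F (z + m k * (?s + a k * i)) b = G (z + m k * (?s + a k * i)) b"
      using Suc.prems lt by blast
  qed
  then show ?case by simp
qed

lemma glue_lt: "z < m k \<Longrightarrow> d < N k \<Longrightarrow> z + m k * d < m (Suc k)"
proof -
  assume *: "z < m k" "d < N k"
  have "z + m k * d < m k * (d + 1)" using * by simp
  also have "\<dots> \<le> m (Suc k)" unfolding m_Suc using * by (intro mult_le_mono) auto
  finally show ?thesis .
qed

lemma cons_block: assumes "cons (Suc k) F" "d < N k" shows "cons k (\<lambda>z. F (z + m k * d))"
  unfolding cons_def
proof (intro allI impI ballI)
  fix z b z' assume z: "z < m k" "z' \<in> Cl k z b"
  show "F (z' + m k * d) b = F (z + m k * d) b"
  proof (cases "isP k z b \<or> isQ k z b")
    case True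
    then have "isE k (isQ k z b) z b" by (auto simp: isE_def)
    then show ?thesis using z Cl_own_end by auto
  next
    case False
    have "z' + m k * d \<in> Cl (Suc k) (z + m k * d) b"
      using Cl_low[of k "z + m k * d" b "Suc k"] False z by simp
    then show ?thesis using assms z glue_lt consD by blast
  qed
qed

lemma EAv_Q_common: assumes "cons (Suc k) F" "d < N k" "d' < N k"
  shows "EAv k True (\<lambda>z. F (z + m k * d)) = EAv k True (\<lambda>z. F (z + m k * d'))"
proof (rule EAv_cong)
  fix z b assume z: "z < m k" "isE k True z b"
  have "z + m k * d' \<in> Cl (Suc k) (z + m k * d) b"
    using Cl_end[OF z(2,1), of "Suc k" d] CB_Suc_Q[OF assms(2)] assms by auto
  then show "F (z + m k * d) b = F (z + m k * d') b"
    using consD[OF assms(1) glue_lt[OF z(1) assms(2)]] by metis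
qed

text \<open>Parallel law: the \<open>f k\<close> copies of one arm lead from the new end to the same
  fibre, and the Cauchy-Schwarz inequality divides the resistance by \<open>f k\<close>.\<close>

lemma ends_step:
  assumes F: "cons (Suc k) F" and s: "s = (if c then 1 else 0)"
    and IH: "\<And>F. cons k F \<Longrightarrow> (EAv k False F - EAv k True F)\<^sup>2 \<le> 2 ^ k / W k * energy k F"
  shows "(EAv (Suc k) c F - EAv k True (\<lambda>z. F (z + m k * 0)))\<^sup>2
      \<le> 2 ^ k / W (Suc k) * (\<Sum>i<f k. energy k (\<lambda>z. F (z + m k * (s + a k * i))))"
proof -
  let ?c = "EAv k True (\<lambda>z. F (z + m k * 0))"
  let ?F = "\<lambda>i z. F (z + m k * (s + a k * i))"
  have sl: "s < a k" using s a_ge2[of k] by auto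
  have f0: "real (f k) > 0" using f_pos by simp
  have "EAv (Suc k) c F - ?c = (\<Sum>i<f k. EAv k False (?F i) - ?c) / f k"
    using f0 by (simp add: s sum_subtractf diff_divide_distrib)
  also have "(\<Sum>i<f k. EAv k False (?F i) - ?c) = (\<Sum>i<f k. EAv k False (?F i) - EAv k True (?F i))"
  proof (rule sum.cong[OF refl])
    fix i assume "i \<in> {..<f k}"
    then show "EAv k False (?F i) - ?c = EAv k False (?F i) - EAv k True (?F i)"
      using EAv_Q_common[OF F arm_lt[OF sl] N_pos, of i] by simp
  qed
  finally have "(EAv (Suc k) c F - ?c)\<^sup>2 = (\<Sum>i<f k. EAv k False (?F i) - EAv k True (?F i))\<^sup>2 / (f k)\<^sup>2"
    by (simp add: power_divide)
  also have "\<dots> \<le> (f k * (\<Sum>i<f k. (EAv k False (?F i) - EAv k True (?F i))\<^sup>2)) / (f k)\<^sup>2"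
    using sum_sq_le[of _ "{..<f k}"] by (intro divide_right_mono) auto
  also have "\<dots> = (\<Sum>i<f k. (EAv k False (?F i) - EAv k True (?F i))\<^sup>2) / f k"
    using f0 by (simp add: power2_eq_square)
  also have "\<dots> \<le> (\<Sum>i<f k. 2 ^ k / W k * energy k (?F i)) / f k"
    by (intro divide_right_mono sum_mono IH cons_block F) (use arm_lt[OF sl] in auto)
  also have "\<dots> = 2 ^ k / W (Suc k) * (\<Sum>i<f k. energy k (?F i))"
    unfolding sum_distrib_left[symmetric] by (simp add: W_Suc)
  finally show ?thesis .
qed

lemma sum_arm_le: assumes "\<And>d. 0 \<le> (h d :: real)" "S \<subseteq> {..<a k}"
  shows "(\<Sum>s\<in>S. \<Sum>i<f k. h (s + a k * i)) \<le> (\<Sum>d<N k. h d)"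
proof -
  have "(\<Sum>s\<in>S. \<Sum>i<f k. h (s + a k * i)) \<le> (\<Sum>s<a k. \<Sum>i<f k. h (s + a k * i))"
    by (rule sum_mono2) (use assms in \<open>auto intro: sum_nonneg\<close>)
  also have "\<dots> = (\<Sum>d<N k. h d)" unfolding N_def sum_blocks by (rule sum.swap)
  finally show ?thesis .
qed

text \<open>Series law: the path between the ends runs through arms 0 and 1, which meet at the
  common Q-end. Splitting the square there costs the factor two.\<close>

lemma ends_bound: "cons k F \<Longrightarrow> (EAv k False F - EAv k True F)\<^sup>2 \<le> 2 ^ k / W k * energy k F"
proof (induction k arbitrary: F)
  case 0 then show ?case by (simp add: energy_def)
next
  case (Suc k)
  let ?c = "EAv k True (\<lambda>z. F (z + m k * 0))"
  let ?E = "\<lambda>s. \<Sum>i<f k. energy k (\<lambda>z. F (z + m k * (s + a k * i)))"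
  let ?K = "2 ^ k / real (W (Suc k))"
  have "(EAv (Suc k) False F - EAv (Suc k) True F)\<^sup>2
      \<le> 2 * (EAv (Suc k) False F - ?c)\<^sup>2 + 2 * (EAv (Suc k) True F - ?c)\<^sup>2"
    using sum_squares_ge_zero[of "EAv (Suc k) False F + EAv (Suc k) True F - 2 * ?c" 0]
    by (simp add: power2_eq_square algebra_simps)
  also have "\<dots> \<le> 2 * (?K * ?E 0) + 2 * (?K * ?E 1)"
    by (intro add_mono mult_left_mono ends_step[OF Suc.prems]) (use Suc.IH in auto)
  also have "\<dots> = 2 * ?K * (\<Sum>s\<in>{0,1}. ?E s)" by (simp add: algebra_simps)
  also have "\<dots> \<le> 2 * ?K * energy (Suc k) F"
    unfolding energy_Suc by (intro mult_left_mono sum_arm_le energy_nonneg) (use a_ge2[of k] in auto)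
  finally show ?case by simp
qed

text \<open>Centring at the Q-end average instead of the mean lets the induction close, since all
  copies share this value. The old terms double to \<open>8 * t k\<close>. Moving the centre to the
  new Q-end costs volume times resistance,
  \<open>4 * m (Suc k) * 2 ^ k / W (Suc k) = 2 * t (Suc k)\<close>. Both fit into
  \<open>4 * t (Suc k)\<close> because \<open>4 * t k \<le> t (Suc k)\<close>.\<close>

lemma poincare_aux: "cons k F \<Longrightarrow> HS k (\<lambda>e b. (F e b - EAv k True F)\<^sup>2) \<le> 4 * t k * energy k F"
proof (induction k arbitrary: F)
  case 0
  have "(F 0 False - F 0 True)\<^sup>2 \<ge> 0" by simp
  then show ?case by (simp add: energy_def HS_def)
next
  case (Suc k)
  let ?F = "\<lambda>d z. F (z + m k * d)"
  let ?c = "EAv k True (?F 0)" and ?Q = "EAv (Suc k) True F"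
  have cQ: "(?Q - ?c)\<^sup>2 \<le> 2 ^ k / W (Suc k) * energy (Suc k) F"
  proof -
    have "(?Q - ?c)\<^sup>2 \<le> 2 ^ k / W (Suc k) * (\<Sum>s\<in>{1}. \<Sum>i<f k. energy k (?F (s + a k * i)))"
      using ends_step[OF Suc.prems _ ends_bound, of 1 True] by simp
    also have "\<dots> \<le> 2 ^ k / W (Suc k) * energy (Suc k) F"
      unfolding energy_Suc by (intro mult_left_mono sum_arm_le energy_nonneg) (use a_ge2[of k] in auto)
    finally show ?thesis .
  qed
  have blk: "HS k (\<lambda>e b. (?F d e b - ?Q)\<^sup>2) \<le> 2 * (4 * t k * energy k (?F d)) + 4 * m k * (?Q - ?c)\<^sup>2"
    if d: "d < N k" for d
  proof -
    have "HS k (\<lambda>e b. (?F d e b - ?Q)\<^sup>2) \<le> HS k (\<lambda>e b. 2 * (?F d e b - ?c)\<^sup>2 + 2 * (?Q - ?c)\<^sup>2)"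
    proof (rule HS_mono)
      fix e b
      show "(?F d e b - ?Q)\<^sup>2 \<le> 2 * (?F d e b - ?c)\<^sup>2 + 2 * (?Q - ?c)\<^sup>2"
        using sum_squares_ge_zero[of "?F d e b + ?Q - 2 * ?c" 0] by (simp add: power2_eq_square algebra_simps)
    qed
    also have "\<dots> = 2 * HS k (\<lambda>e b. (?F d e b - ?c)\<^sup>2) + 2 * m k * (2 * (?Q - ?c)\<^sup>2)"
      by (simp only: HS_add HS_cmult HS_const of_nat_mult of_nat_numeral)
    also have "?c = EAv k True (?F d)" by (rule EAv_Q_common[OF Suc.prems N_pos d])
    also have "HS k (\<lambda>e b. (?F d e b - EAv k True (?F d))\<^sup>2) \<le> 4 * t k * energy k (?F d)"
      by (rule Suc.IH[OF cons_block[OF Suc.prems d]])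
    finally show ?thesis using EAv_Q_common[OF Suc.prems N_pos d] by simp
  qed
  have "HS (Suc k) (\<lambda>e b. (F e b - ?Q)\<^sup>2) = (\<Sum>d<N k. HS k (\<lambda>e b. (?F d e b - ?Q)\<^sup>2))" by (rule HS_Suc)
  also have "\<dots> \<le> (\<Sum>d<N k. 2 * (4 * t k * energy k (?F d)) + 4 * m k * (?Q - ?c)\<^sup>2)"
    by (intro sum_mono blk) auto
  also have "\<dots> = 8 * t k * energy (Suc k) F + 4 * m (Suc k) * (?Q - ?c)\<^sup>2"
    by (simp add: energy_Suc sum.distrib sum_distrib_left m_Suc mult.assoc)
  also have "\<dots> \<le> 8 * t k * energy (Suc k) F + 4 * m (Suc k) * (2 ^ k / W (Suc k) * energy (Suc k) F)"
    using cQ by (intro add_left_mono mult_left_mono) auto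
  also have "4 * m (Suc k) * (2 ^ k / W (Suc k) * energy (Suc k) F) = 2 * t (Suc k) * energy (Suc k) F"
    using W_pos[of "Suc k"] by (simp add: m_eq[of "Suc k"] t_def)
  also have "8 * t k * energy (Suc k) F + 2 * t (Suc k) * energy (Suc k) F = (8 * t k + 2 * t (Suc k)) * energy (Suc k) F"
    by (simp add: algebra_simps)
  also have "\<dots> \<le> 4 * t (Suc k) * energy (Suc k) F"
    using t_Suc_ge[of k] by (intro mult_right_mono energy_nonneg) linarith
  finally show ?case .
qed

lemma poincare: assumes "cons k F" "HS k F = 0" shows "IP k F F \<le> 4 * t k * energy k F"
proof -
  let ?c = "EAv k True F"
  have "HS k (\<lambda>e b. (F e b - ?c)\<^sup>2) = HS k (\<lambda>e b. (F e b * F e b + (-2 * ?c) * F e b) + ?c\<^sup>2)"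
    by (rule HS_cong) (simp add: power2_eq_square algebra_simps)
  also have "\<dots> = IP k F F + 2 * m k * ?c\<^sup>2"
    by (simp add: HS_add HS_diff HS_cmult HS_const assms(2) IP_def)
  finally have "HS k (\<lambda>e b. (F e b - ?c)\<^sup>2) = IP k F F + 2 * m k * ?c\<^sup>2" .
  moreover have "2 * m k * ?c\<^sup>2 \<ge> 0" by simp
  ultimately show ?thesis using poincare_aux[OF assms(1)] by linarith
qed

lemma energy_IP: "cons k F \<Longrightarrow> energy k F = IP k F F - IP k (walk k F) F"
  unfolding IP_walk by (simp add: energy_def IP_def HS_def sum_subtractf[symmetric] power2_eq_square algebra_simps)

lemma IP_add_left: "IP k (\<lambda>e b. F e b + G e b) H = IP k F H + IP k G H"
  unfolding IP_def HS_add[symmetric] by (simp add: distrib_right)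
lemma IP_add_right: "IP k H (\<lambda>e b. F e b + G e b) = IP k H F + IP k H G"
  by (simp add: IP_commute[of k H] IP_add_left)
lemma IP_cmult_left: "IP k (\<lambda>e b. c * F e b) H = c * IP k F H"
  unfolding IP_def HS_cmult[symmetric] by (simp add: mult.assoc)
lemma IP_diff_left: "IP k (\<lambda>e b. F e b - G e b) H = IP k F H - IP k G H"
  unfolding IP_def HS_diff[symmetric] by (simp add: left_diff_distrib)
lemma IP_diff_right: "IP k H (\<lambda>e b. F e b - G e b) = IP k H F - IP k H G"
  by (simp add: IP_commute[of k H] IP_diff_left)
lemma IP_nonneg: "0 \<le> IP k F F" unfolding IP_def by (rule HS_nonneg) simp
lemma IP_mono: "(\<And>e b. e < m k \<Longrightarrow> 0 \<le> H e b) \<Longrightarrow> (\<And>e b. e < m k \<Longrightarrow> F e b \<le> G e b) \<Longrightarrow> IP k F H \<le> IP k G H"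
  unfolding IP_def by (intro HS_mono mult_right_mono) auto
lemma IP_abs: "\<bar>IP k F G\<bar> \<le> (IP k F F + IP k G G) / 2"
proof -
  have "0 \<le> HS k (\<lambda>e b. (F e b + G e b)\<^sup>2)" "0 \<le> HS k (\<lambda>e b. (F e b - G e b)\<^sup>2)"
    by (rule HS_nonneg, simp)+
  moreover have "HS k (\<lambda>e b. (F e b + G e b)\<^sup>2) = IP k F F + IP k G G + 2 * IP k F G"
    unfolding IP_def HS_add[symmetric] HS_cmult[symmetric] by (rule HS_cong) (simp add: power2_eq_square algebra_simps)
  moreover have "HS k (\<lambda>e b. (F e b - G e b)\<^sup>2) = IP k F F + IP k G G - 2 * IP k F G"
    unfolding IP_def HS_add[symmetric] HS_cmult[symmetric] HS_diff[symmetric] by (rule HS_cong) (simp add: power2_eq_square algebra_simps)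
  ultimately have "0 \<le> IP k F F + IP k G G + 2 * IP k F G" "0 \<le> IP k F F + IP k G G - 2 * IP k F G" by simp_all
  then show ?thesis by (simp add: abs_le_iff field_simps)
qed

lemma cons_add: "cons k F \<Longrightarrow> cons k G \<Longrightarrow> cons k (\<lambda>e b. F e b + G e b)" unfolding cons_def by metis
lemma cons_diff: "cons k F \<Longrightarrow> cons k G \<Longrightarrow> cons k (\<lambda>e b. F e b - G e b)" unfolding cons_def by metis

text \<open>The graph is bipartite, so \<open>walk\<close> has no spectral gap at \<open>-1\<close>; for a function \<open>F\<close> living on one
  side the energy of \<open>F + walk F\<close> is exactly the loss of \<open>L\<^sup>2\<close> norm of \<open>F\<close> in one step.\<close>

lemma L2_decay:
  assumes F: "cons k F" and sup: "\<And>e. F e (\<not> c) = 0" and mean: "HS k F = 0"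
  shows "IP k (walk k F) (walk k F) \<le> (1 - 1 / (4 * t k)) * IP k F F"
proof -
  let ?P = "walk k"
  let ?g = "\<lambda>e b. F e b + ?P F e b"
  have supb: "b \<noteq> c \<Longrightarrow> F e b = 0" for e b using sup by (cases b; cases c) auto
  have suP: "b = c \<Longrightarrow> ?P F e b = 0" for e b
    unfolding walk_def using sup by (simp add: av_def)
  have suPP: "b \<noteq> c \<Longrightarrow> ?P (?P F) e b = 0" for e b
    using suP unfolding walk_def[of k "?P F"] by (cases b; cases c) (auto simp: av_def)
  have z: "IP k F (?P F) = 0" "IP k (?P (?P F)) (?P F) = 0"
  proof -
    have "F e b * ?P F e b = 0" "?P (?P F) e b * ?P F e b = 0" for e b
      using supb suP suPP by (cases "b = c"; simp)+
    note zero = this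
    show "IP k F (?P F) = 0" "IP k (?P (?P F)) (?P F) = 0"
      unfolding IP_def HS_def zero by simp_all
  qed
  have adj: "IP k (?P (?P F)) F = IP k (?P F) (?P F)"
    by (rule walk_adj) (use cons_walk F in auto)
  have g: "cons k ?g" using F cons_walk by (intro cons_add) auto
  have "IP k ?g ?g \<le> 4 * t k * energy k ?g"
    by (rule poincare[OF g]) (simp add: HS_add HS_walk mean)
  moreover have "IP k ?g ?g = IP k F F + IP k (?P F) (?P F)"
    using z by (simp add: IP_add_left IP_add_right IP_commute[of k "?P F" F])
  moreover have "energy k ?g = IP k F F - IP k (?P F) (?P F)"
  proof -
    have "IP k (?P ?g) ?g = IP k (\<lambda>e b. ?P F e b + ?P (?P F) e b) ?g"
      by (rule arg_cong[of _ _ "\<lambda>x. IP k x ?g"]) (simp add: walk_add fun_eq_iff)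
    then show ?thesis
      unfolding energy_IP[OF g] using z adj by (simp add: IP_add_left IP_add_right IP_commute[of k "?P F" F])
  qed
  ultimately have *: "(4 * real (t k) + 1) * IP k (?P F) (?P F) \<le> (4 * real (t k) - 1) * IP k F F"
    by (simp add: algebra_simps)
  have t1: "real (t k) \<ge> 1" using t_pos[of k] by linarith
  have "IP k (?P F) (?P F) \<le> (4 * real (t k) - 1) / (4 * real (t k) + 1) * IP k F F"
    using * t1 by (simp add: field_simps)
  also have "(4 * real (t k) - 1) / (4 * real (t k) + 1) \<le> 1 - 1 / (4 * t k)"
    using t1 by (simp add: field_simps)
  then have "(4 * real (t k) - 1) / (4 * real (t k) + 1) * IP k F F \<le> (1 - 1 / (4 * t k)) * IP k F F"
    by (intro mult_right_mono IP_nonneg)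
  finally show ?thesis .
qed

section \<open>Heat kernels of the blocks\<close>

definition delta :: "nat \<Rightarrow> nat \<Rightarrow> bool \<Rightarrow> nat \<Rightarrow> bool \<Rightarrow> real" where
  "delta M x bx e b = (if b = bx \<and> e \<in> Cl M x bx then 1 / card (Cl M x bx) else 0)"
text \<open>\<open>delta\<close> is the density of a point mass with respect to the degree measure,
  so the iterates are heat kernels and not transition probabilities.\<close>

definition kern :: "nat \<Rightarrow> nat \<Rightarrow> nat \<Rightarrow> bool \<Rightarrow> nat \<Rightarrow> bool \<Rightarrow> real" where
  "kern M n x bx = (walk M ^^ n) (delta M x bx)"

lemma kern_0: "kern M 0 x bx = delta M x bx" by (simp add: kern_def)
lemma kern_Suc: "kern M (Suc n) x bx = walk M (kern M n x bx)" by (simp add: kern_def)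

lemma cons_delta: "cons M (delta M x bx)"
proof -
  have "e' \<in> Cl M x bx \<longleftrightarrow> e \<in> Cl M x bx" if "e' \<in> Cl M e bx" for e e'
    using Cl_eq[OF that] Cl_sym[of x M _ bx] Cl_sym[of _ M x bx] by blast
  note cl = this
  show ?thesis unfolding cons_def
  proof (intro allI impI ballI)
    fix e b e' assume "e' \<in> Cl M e b"
    then show "delta M x bx e' b = delta M x bx e b"
      by (cases "b = bx") (simp_all add: delta_def cl[of e' e])
  qed
qed
lemma cons_kern: "cons M (kern M n x bx)"
  by (cases n) (auto simp: kern_0 kern_Suc cons_delta cons_walk)

lemma IP_delta: assumes "x < m M" "cons M G" shows "IP M (delta M x bx) G = G x bx"
proof -
  have "IP M (delta M x bx) G = (\<Sum>e<m M. if e \<in> Cl M x bx then G x bx / card (Cl M x bx) else 0)"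
    unfolding IP_def HS_def
  proof (rule sum.cong[OF refl])
    fix e
    show "delta M x bx e False * G e False + delta M x bx e True * G e True = (if e \<in> Cl M x bx then G x bx / card (Cl M x bx) else 0)"
      using consD[OF assms(2,1), of e bx] by (cases bx) (auto simp: delta_def)
  qed
  also have "\<dots> = (\<Sum>e\<in>{..<m M} \<inter> Cl M x bx. G x bx / card (Cl M x bx))"
    by (rule sum.inter_restrict[symmetric]) simp
  also have "{..<m M} \<inter> Cl M x bx = Cl M x bx" using Cl_lt assms(1) by auto
  also have "(\<Sum>e\<in>Cl M x bx. G x bx / card (Cl M x bx)) = G x bx"
    using card_Cl_pos[of M x bx] by simp
  finally show ?thesis .
qed

lemma HS_delta: "x < m M \<Longrightarrow> HS M (delta M x bx) = 1"
  using IP_delta[of x M "\<lambda>_ _. 1" bx] by (simp add: IP_def cons_def)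
lemma HS_kern: "x < m M \<Longrightarrow> HS M (kern M n x bx) = 1"
  by (induction n) (simp_all add: kern_0 kern_Suc HS_delta HS_walk)
lemma kern_nonneg: "e < m M \<Longrightarrow> 0 \<le> kern M n x bx e b"
  by (induction n arbitrary: e b) (auto simp: kern_0 kern_Suc delta_def intro: walk_nonneg)

lemma kern_shift: "IP M (kern M (n + j) x bx) (kern M i y by) = IP M (kern M n x bx) (kern M (i + j) y by)"
proof (induction j arbitrary: i)
  case (Suc j)
  have "IP M (kern M (n + Suc j) x bx) (kern M i y by) = IP M (kern M (n + j) x bx) (walk M (kern M i y by))"
    using walk_adj[of M "kern M (n + j) x bx" "kern M i y by"] by (simp add: kern_Suc cons_kern)
  then show ?case using Suc[of "Suc i"] by (simp add: kern_Suc)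
qed simp

text \<open>Chapman-Kolmogorov relation, with the time split made free by self-adjointness.\<close>

lemma kern_eq_IP: assumes "x < m M"
  shows "kern M (n + i) y by x bx = IP M (kern M n x bx) (kern M i y by)"
  using kern_shift[of M 0 n x bx i y "by"] IP_delta[OF assms cons_kern] by (simp add: kern_0 add.commute)

lemma kern_sym: assumes "x < m M" "y < m M" shows "kern M n x bx y by = kern M n y by x bx"
  using kern_eq_IP[of x M n 0 y "by" bx] kern_eq_IP[of y M 0 n x bx "by"] assms by (simp add: IP_commute)

lemma kern_supp: "b \<noteq> (if even n then bx else \<not> bx) \<Longrightarrow> kern M n x bx e b = 0"
proof (induction n arbitrary: e b)
  case (Suc n)
  have "kern M n x bx e' (\<not> b) = 0" for e' by (rule Suc.IH) (use Suc.prems in \<open>auto split: if_splits\<close>)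
  then show ?case by (simp add: kern_Suc walk_def av_def)
qed (simp add: kern_0 delta_def)

text \<open>At each time the walk lives on one side of the bipartition, and each side has total
  degree \<open>m M\<close>. Subtracting the equilibrium density of that side alone gives mean zero,
  as \<open>L2_decay\<close> requires.\<close>

definition kern0 :: "nat \<Rightarrow> nat \<Rightarrow> nat \<Rightarrow> bool \<Rightarrow> nat \<Rightarrow> bool \<Rightarrow> real" where
  "kern0 M n x bx e b = kern M n x bx e b - (if b = (if even n then bx else \<not> bx) then 1 / m M else 0)"

lemma kern0_Suc: "kern0 M (Suc n) x bx e b = walk M (kern0 M n x bx) e b"
proof -
  let ?I = "\<lambda>n (e::nat) b. if b = (if even n then bx else \<not> bx) then 1 / real (m M) else 0"
  have k0: "kern0 M n x bx = (\<lambda>e b. kern M n x bx e b - ?I n e b)"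
    by (simp add: kern0_def fun_eq_iff)
  have "walk M (kern0 M n x bx) e b = walk M (kern M n x bx) e b - walk M (?I n) e b"
    unfolding k0 by (rule walk_diff)
  also have "walk M (?I n) e b = ?I (Suc n) e b"
    unfolding walk_def by (rule av_const) (auto)
  finally show ?thesis by (simp add: kern0_def[of M "Suc n"] kern_Suc)
qed

lemma cons_kern0: "cons M (kern0 M n x bx)"
  unfolding kern0_def by (rule cons_diff[OF cons_kern]) (simp add: cons_def)

lemma HS_ind: "HS M (\<lambda>e b. if b = c then r else 0) = real (m M) * r"
  by (cases c) (simp_all add: HS_def)

lemma HS_kern0: "x < m M \<Longrightarrow> HS M (kern0 M n x bx) = 0"
  unfolding kern0_def HS_diff using m_pos[of M] by (simp add: HS_kern HS_ind)

lemma IP_kern0: assumes "x < m M" "y < m M"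
  shows "IP M (kern0 M n x bx) (kern0 M n y bx) = IP M (kern M n x bx) (kern M n y bx) - 1 / m M"
proof -
  let ?c = "if even n then bx else \<not> bx"
  let ?I = "\<lambda>(e::nat) b. if b = ?c then 1 / real (m M) else 0"
  have I: "IP M G ?I = 1 / m M" if "HS M G = 1" "\<And>e b. b \<noteq> ?c \<Longrightarrow> G e b = 0" for G
  proof -
    have "IP M G ?I = HS M (\<lambda>e b. 1 / m M * G e b)"
      unfolding IP_def by (rule HS_cong) (use that(2) in auto)
    then show ?thesis using that(1) by (simp only: HS_cmult)
  qed
  have II: "IP M ?I ?I = 1 / m M"
    by (rule I) (use m_pos[of M] in \<open>auto simp: HS_ind\<close>)
  have k: "kern0 M n z bx = (\<lambda>e b. kern M n z bx e b - ?I e b)" for z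
    by (simp add: kern0_def fun_eq_iff)
  have kI: "IP M (kern M n z bx) ?I = 1 / m M" if "z < m M" for z
    by (rule I) (use that HS_kern kern_supp in auto)
  have Ik: "IP M ?I (kern M n z bx) = 1 / m M" if "z < m M" for z
    unfolding IP_commute[of M ?I] by (rule kI) fact
  show ?thesis unfolding k IP_diff_left IP_diff_right II kI[OF assms(1)] Ik[OF assms(2)] by simp
qed

lemma kern0_decay: assumes "x < m k"
  shows "IP k (kern0 k (n + j) x bx) (kern0 k (n + j) x bx)
      \<le> exp (- real j / (4 * t k)) * IP k (kern0 k n x bx) (kern0 k n x bx)"
proof (induction j)
  case (Suc j)
  let ?V = "kern0 k (n + j) x bx" and ?W = "kern0 k (n + Suc j) x bx"
  have W: "?W = walk k ?V" using kern0_Suc by (simp add: fun_eq_iff)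
  have "IP k ?W ?W \<le> (1 - 1 / (4 * t k)) * IP k ?V ?V"
    unfolding W
  proof (rule L2_decay[OF cons_kern0])
    show "kern0 k (n + j) x bx e (\<not> (if even (n + j) then bx else \<not> bx)) = 0" for e
      by (simp add: kern0_def kern_supp)
  qed (use HS_kern0 assms in simp)
  also have "\<dots> \<le> exp (- 1 / (4 * t k)) * IP k ?V ?V"
    using exp_ge_add_one_self[of "- 1 / (4 * real (t k))"] by (intro mult_right_mono IP_nonneg) simp
  also have "\<dots> \<le> exp (- 1 / (4 * t k)) * (exp (- real j / (4 * t k)) * IP k (kern0 k n x bx) (kern0 k n x bx))"
    by (intro mult_left_mono Suc) simp
  also have "\<dots> = exp (- real (Suc j) / (4 * t k)) * IP k (kern0 k n x bx) (kern0 k n x bx)"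
    by (simp add: exp_add[symmetric] mult.assoc[symmetric] diff_divide_distrib)
  finally show ?case .
qed simp

section \<open>Folding onto a smaller block\<close>

lemma CB_nonempty[simp]: "CB M l c B \<noteq> {}" using CB_refl by blast

text \<open>At an end all glued blocks carry the same folded value, which is what reflection in the
  single block sees; elsewhere the neighbourhoods agree.\<close>

lemma walk_fold: assumes "l \<le> M"
  shows "walk M (\<lambda>e. G (e mod m l)) e b = walk l G (e mod m l) b"
proof (cases "isP l (e mod m l) b \<or> isQ l (e mod m l) b")
  case True
  then have "isE l (isQ l (e mod m l) b) (e mod m l) b" by (auto simp: isE_def)
  from walk_end[OF this, of M "\<lambda>e. G (e mod m l)" "e div m l"] walk_own_end[OF this, of G]
  show ?thesis using m_pos[of l] card_CB_pos[of M l "isQ l (e mod m l) b" "e div m l"]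
    by (simp add: av_def)
next
  case False
  have "walk M (\<lambda>e. G (e mod m l)) (e mod m l + m l * (e div m l)) b = walk l (\<lambda>z. G ((z + m l * (e div m l)) mod m l)) (e mod m l) b"
    by (rule walk_low) (use False assms m_pos in auto)
  also have "\<dots> = walk l G (e mod m l) b" by (rule walk_cong) (use m_pos in auto)
  finally show ?thesis by simp
qed

lemma Cl_fold: assumes "e' \<in> Cl M e b" "l \<le> M" shows "e' mod m l \<in> Cl l (e mod m l) b"
proof (cases "isP l (e mod m l) b \<or> isQ l (e mod m l) b")
  case True then show ?thesis using Cl_mod_high[OF _ assms(1)] by simp
next
  case False
  then have "Cl M e b = (\<lambda>z. z + m l * (e div m l)) ` Cl l (e mod m l) b"
    using Cl_low[of l e b M] assms by auto
  then obtain z where "z \<in> Cl l (e mod m l) b" "e' = z + m l * (e div m l)" using assms by auto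
  moreover from this have "z < m l" using Cl_lt m_pos by (metis mod_less_divisor)
  ultimately show ?thesis by simp
qed

lemma card_Cl_fold: assumes "l \<le> M" shows "card (Cl l (e mod m l) b) \<le> card (Cl M e b)"
proof (cases "isP l (e mod m l) b \<or> isQ l (e mod m l) b")
  case True
  then have "isE l (isQ l (e mod m l) b) (e mod m l) b" by (auto simp: isE_def)
  then show ?thesis using Cl_own_end card_Cl_pos[of M e b] by simp
next
  case False
  then have "Cl M e b = (\<lambda>z. z + m l * (e div m l)) ` Cl l (e mod m l) b"
    using Cl_low[of l e b M] assms by auto
  then show ?thesis by (simp add: card_image inj_on_def)
qed

lemma delta_fold_le: assumes "l \<le> M"
  shows "delta M x bx e b \<le> delta l (x mod m l) bx (e mod m l) b"
  using Cl_fold[OF _ assms, of e x bx] card_Cl_fold[OF assms, of x bx] card_Cl_pos[of l "x mod m l" bx]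
  by (auto simp: delta_def field_simps)

text \<open>Degrees can only drop under folding, so at time 0 the folded density is the larger one.
  Afterwards both sides evolve by the same walk, which preserves order.\<close>

lemma kern_fold_le: assumes "l \<le> M" "e < m M"
  shows "kern M n x bx e b \<le> kern l n (x mod m l) bx (e mod m l) b"
  using assms(2)
proof (induction n arbitrary: e b)
  case 0 then show ?case using delta_fold_le[OF assms(1)] by (simp add: kern_0)
next
  case (Suc n)
  have "kern M (Suc n) x bx e b \<le> walk M (\<lambda>e. kern l n (x mod m l) bx (e mod m l)) e b"
    unfolding kern_Suc by (rule walk_mono) (use Suc in auto)
  then show ?case by (simp add: walk_fold[OF assms(1)] kern_Suc)
qed

text \<open>At least \<open>16 * D\<close> units of \<open>t (Suc k)\<close> are available. The
  mixing time of level \<open>k\<close> uses at most a quarter of the time, and the remaining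
  \<open>12 * D\<close> units at rate \<open>1 / (4 * t (Suc k))\<close> give
  \<open>exp (- 3 * D) \<le> 1 / (3 * D)\<close>, which cancels the loss \<open>3 * D\<close> from
  the previous level.\<close>

definition mix_const :: nat where "mix_const = 16 * D"

text \<open>Bootstrapping over the levels: folding gives a bound of the right order, up to the
  factor \<open>D\<close> by which the volume may grow, already at the mixing time of level
  \<open>k\<close>. The spectral decay then has to gain a constant only, and no logarithm of the
  volume appears.\<close>

lemma kern0_mix: "x < m k \<Longrightarrow> mix_const * t k \<le> n \<Longrightarrow> IP k (kern0 k n x bx) (kern0 k n x bx) \<le> 1 / (2 * m k)"
proof (induction k arbitrary: x n)
  case 0
  have "kern 0 n x bx e b \<le> 1" if "e < m 0" for e b n
    using that
  proof (induction n arbitrary: e b)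
    case 0
    then show ?case using card_Cl_pos[of 0 x bx] by (auto simp: kern_0 delta_def)
  next
    case (Suc n)
    have "walk 0 (kern 0 n x bx) e b \<le> walk 0 (\<lambda>_ _. 1) e b" by (rule walk_mono) (use Suc in auto)
    then show ?case by (simp add: kern_Suc)
  qed
  then have "kern 0 (n + n) x bx x bx \<le> 1" using 0 by blast
  then have "IP 0 (kern0 0 n x bx) (kern0 0 n x bx) \<le> 0"
    using IP_kern0[of x 0 x n bx] kern_eq_IP[of x 0 n n x bx bx] 0 by simp
  then show ?case by simp
next
  case (Suc k)
  let ?n = "mix_const * t k" and ?y = "x mod m k"
  have y: "?y < m k" using m_pos by simp
  have tt: "4 * ?n \<le> n" using t_Suc_ge[of k] Suc.prems(2) mult_le_mono2[of "4 * t k" "t (Suc k)" mix_const] by linarith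
  let ?j = "n - ?n"
  have nj: "n = ?n + ?j" using tt by simp
  have "IP (Suc k) (kern0 (Suc k) ?n x bx) (kern0 (Suc k) ?n x bx) \<le> kern (Suc k) (?n + ?n) x bx x bx"
    using IP_kern0[OF Suc.prems(1) Suc.prems(1)] kern_eq_IP[OF Suc.prems(1)] by simp
  also have "\<dots> \<le> kern k (?n + ?n) ?y bx ?y bx" by (rule kern_fold_le) (use Suc.prems in auto)
  also have "\<dots> = IP k (kern0 k ?n ?y bx) (kern0 k ?n ?y bx) + 1 / m k"
    using IP_kern0[OF y y] kern_eq_IP[OF y] by simp
  also have "\<dots> \<le> 1 / (2 * m k) + 1 / m k" using Suc.IH[OF y order_refl] by (intro add_right_mono)
  also have "\<dots> = 3 * N k / (2 * m (Suc k))"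
    using m_pos[of k] N_pos[of k] by (simp add: m_Suc field_simps)
  also have "\<dots> \<le> 3 * D / (2 * m (Suc k))" using N_le[of k] by (intro divide_right_mono) auto
  finally have start: "IP (Suc k) (kern0 (Suc k) ?n x bx) (kern0 (Suc k) ?n x bx) \<le> 3 * D / (2 * m (Suc k))" .
  have jge: "real ?j \<ge> 12 * D * t (Suc k)"
  proof -
    have "4 * ?j \<ge> 3 * n" using tt by simp
    moreover have "n \<ge> 16 * (D * t (Suc k))" using Suc.prems(2) by (simp add: mix_const_def)
    ultimately have "12 * (D * t (Suc k)) \<le> ?j" by linarith
    then have "real (12 * (D * t (Suc k))) \<le> ?j" by (rule of_nat_mono)
    then show ?thesis by (simp add: mult.assoc)
  qed
  have "exp (- real ?j / (4 * t (Suc k))) \<le> exp (- (3 * real D))"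
    using jge t_pos[of "Suc k"] by (simp add: field_simps)
  also have "\<dots> \<le> 1 / (3 * D)"
  proof -
    have "3 * real D \<le> exp (3 * real D)" using exp_ge_add_one_self[of "3 * real D"] by linarith
    then show ?thesis using D_ge2 by (simp add: exp_minus field_simps)
  qed
  finally have ex: "exp (- real ?j / (4 * t (Suc k))) \<le> 1 / (3 * D)" .
  have "IP (Suc k) (kern0 (Suc k) n x bx) (kern0 (Suc k) n x bx)
     \<le> exp (- real ?j / (4 * t (Suc k))) * IP (Suc k) (kern0 (Suc k) ?n x bx) (kern0 (Suc k) ?n x bx)"
    using kern0_decay[OF Suc.prems(1), of ?n ?j bx] nj by simp
  also have "\<dots> \<le> 1 / (3 * D) * (3 * D / (2 * m (Suc k)))"
    by (intro mult_mono ex start IP_nonneg) simp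
  also have "\<dots> = 1 / (2 * m (Suc k))" using D_ge2 by simp
  finally show ?case .
qed

text \<open>The deviation at time \<open>n + n\<close> is an inner product of two centred kernels at
  time \<open>n\<close>, both of small norm.\<close>

lemma kern_mix: assumes "x < m k" "y < m k" "mix_const * t k \<le> n"
  shows "\<bar>kern k (n + n) x bx y bx - 1 / m k\<bar> \<le> 1 / (2 * m k)"
proof -
  have "kern k (n + n) x bx y bx = IP k (kern k n y bx) (kern k n x bx)" by (rule kern_eq_IP) fact
  then have "kern k (n + n) x bx y bx - 1 / m k = IP k (kern0 k n y bx) (kern0 k n x bx)"
    unfolding IP_kern0[OF assms(2,1)] by (simp only:)
  moreover note IP_abs[of k "kern0 k n y bx" "kern0 k n x bx"]
  moreover note kern0_mix[OF assms(1,3), of bx]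
  moreover note kern0_mix[OF assms(2,3), of bx]
  ultimately show ?thesis by argo
qed

section \<open>Crossing labels\<close>

text \<open>Label \<open>0\<close> means that no block end has been visited yet; a positive label counts the
  changes of the last visited end type, odd labels standing for P-ends and even ones for Q-ends.\<close>

definition adv :: "bool \<Rightarrow> nat \<Rightarrow> nat" where
  "adv c j = (if j = 0 then (if c then 2 else 1) else if even j = c then j else Suc j)"

lemma adv_le: "adv c i \<le> i + 2" by (simp add: adv_def)
lemma adv_pos: "adv c i > 0" by (simp add: adv_def)
lemma even_adv: "even (adv c i) = c" by (auto simp: adv_def)

context fixes l x :: nat and bx :: bool begin

text \<open>Density of the reflected walk on one block, jointly with its label. The label is updated
  on arrival at an end; at time 0 it is 0 even if the walk starts at an end. A step raises it by at
  most two, whence the range \<open>i \<le> 2 * n\<close>.\<close>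

primrec lkern :: "nat \<Rightarrow> nat \<Rightarrow> nat \<Rightarrow> bool \<Rightarrow> real" where
  "lkern 0 = (\<lambda>i z b. if i = 0 then delta l x bx z b else 0)"
| "lkern (Suc n) = (\<lambda>j z b.
    if isP l z b then \<Sum>i\<le>2 * n. if adv False i = j then lkern n i z (\<not> b) else 0
    else if isQ l z b then \<Sum>i\<le>2 * n. if adv True i = j then lkern n i z (\<not> b) else 0
    else walk l (lkern n j) z b)"

lemma lkern_end: "isE l c z b \<Longrightarrow> lkern (Suc n) j z b = (\<Sum>i\<le>2 * n. if adv c i = j then lkern n i z (\<not> b) else 0)"
  using isP_not_isQ[of l z b] by (cases c) (auto simp: isE_def)
lemma lkern_int: "\<not> isP l z b \<Longrightarrow> \<not> isQ l z b \<Longrightarrow> lkern (Suc n) j z b = walk l (lkern n j) z b"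
  by simp

lemma end_cases: obtains c where "isE l c z b" | "\<not> isP l z b" "\<not> isQ l z b"
  by (cases "isP l z b"; cases "isQ l z b") (auto simp: isE_def)

declare lkern.simps(2)[simp del]

lemma lkern_nonneg: "z < m l \<Longrightarrow> 0 \<le> lkern n i z b"
proof (induction n arbitrary: i z b)
  case (Suc n)
  show ?case by (cases rule: end_cases[of z b])
    (use Suc in \<open>auto simp: lkern_end lkern_int intro!: sum_nonneg walk_nonneg\<close>)
qed (simp add: delta_def)

lemma lkern_zero: "2 * n < i \<Longrightarrow> lkern n i z b = 0"
proof (induction n arbitrary: i z b)
  case (Suc n)
  show ?case
  proof (cases rule: end_cases[of z b])
    case (1 c)
    have "adv c i' \<noteq> i" if "i' \<le> 2 * n" for i' using adv_le[of c i'] that Suc.prems by auto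
    then show ?thesis unfolding lkern_end[OF 1] by (intro sum.neutral) auto
  next
    case 2 then show ?thesis using Suc by (simp add: lkern_int walk_def av_def)
  qed
qed simp

lemma sum_adv: "(\<Sum>j\<le>2 * Suc n. g j * (\<Sum>i\<le>2 * n. if adv c i = j then h i else 0)) = (\<Sum>i\<le>2 * n. g (adv c i) * h i :: real)"
proof -
  have "(\<Sum>j\<le>2 * Suc n. g j * (\<Sum>i\<le>2 * n. if adv c i = j then h i else 0)) =
      (\<Sum>i\<le>2 * n. \<Sum>j\<le>2 * Suc n. if adv c i = j then g j * h i else 0)"
    unfolding sum_distrib_left by (subst sum.swap) (intro sum.cong refl, simp)
  also have "\<dots> = (\<Sum>i\<le>2 * n. g (adv c i) * h i)"
  proof (rule sum.cong[OF refl])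
    fix i assume "i \<in> {..2 * n}"
    then have "adv c i \<in> {..2 * Suc n}" using adv_le[of c i] by auto
    then show "(\<Sum>j\<le>2 * Suc n. if adv c i = j then g j * h i else 0) = g (adv c i) * h i"
      using sum.delta'[of "{..2 * Suc n}" "adv c i" "\<lambda>j. g j * h i"] by simp
  qed
  finally show ?thesis .
qed

lemma lkern_weighted_end: "isE l c z b \<Longrightarrow>
    (\<Sum>j\<le>2 * Suc n. g j * lkern (Suc n) j z b) = (\<Sum>i\<le>2 * n. g (adv c i) * lkern n i z (\<not> b))"
  unfolding lkern_end by (rule sum_adv)

lemma lkern_weighted_int: "\<not> isP l z b \<Longrightarrow> \<not> isQ l z b \<Longrightarrow>
    (\<Sum>j\<le>2 * Suc n. g j * lkern (Suc n) j z b) = (\<Sum>i\<le>2 * n. g i * walk l (lkern n i) z b)"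
proof -
  assume *: "\<not> isP l z b" "\<not> isQ l z b"
  have "walk l (lkern n i) z b = 0" if "2 * n < i" for i using that by (simp add: walk_def av_def lkern_zero)
  then show ?thesis unfolding lkern_int[OF *] by (intro sum.mono_neutral_right) auto
qed

lemma lkern_sum: "z < m l \<Longrightarrow> (\<Sum>i\<le>2 * n. lkern n i z b) = kern l n x bx z b"
proof (induction n arbitrary: z b)
  case (Suc n)
  show ?case
  proof (cases rule: end_cases[of z b])
    case (1 c)
    show ?thesis using lkern_weighted_end[OF 1, of "\<lambda>_. 1" n] Suc walk_own_end[OF 1] by (simp add: kern_Suc)
  next
    case 2
    have "(\<Sum>i\<le>2 * n. walk l (lkern n i) z b) = walk l (\<lambda>z b. \<Sum>i\<le>2 * n. lkern n i z b) z b"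
      by (rule walk_sum[symmetric])
    also have "\<dots> = walk l (kern l n x bx) z b" by (rule walk_cong) (use Suc in auto)
    finally show ?thesis using lkern_weighted_int[OF 2, of "\<lambda>_. 1" n] by (simp add: kern_Suc)
  qed
qed (simp add: kern_0)

lemma lkern_wrong: "i > 0 \<Longrightarrow> isE l c z b \<Longrightarrow> even i \<noteq> c \<Longrightarrow> lkern n i z b = 0"
proof (cases n)
  case (Suc n')
  assume "i > 0" and *: "isE l c z b" and "even i \<noteq> c"
  then have "adv c i' \<noteq> i" for i' using even_adv by metis
  then show ?thesis unfolding Suc lkern_end[OF *] by (intro sum.neutral) auto
qed simp

lemma lkern_0_end: "isE l c z b \<Longrightarrow> lkern (Suc n) 0 z b = 0"
  unfolding lkern_end using adv_pos by (intro sum.neutral) (metis less_numeral_extra(3))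

lemma cons_end: assumes "\<And>z z' b. z < m l \<Longrightarrow> \<not> isP l z b \<Longrightarrow> \<not> isQ l z b \<Longrightarrow> z' \<in> Cl l z b \<Longrightarrow> F z' b = F z b"
  shows "cons l F"
  unfolding cons_def
proof (intro allI impI ballI)
  fix z b z' assume z: "z < m l" "z' \<in> Cl l z b"
  show "F z' b = F z b"
  proof (cases rule: end_cases[of z b])
    case (1 c) then show ?thesis using z Cl_own_end by auto
  next
    case 2 then show ?thesis using assms z by blast
  qed
qed

lemma Cl_int: assumes "\<not> isP l z b" "\<not> isQ l z b" "z < m l" "z' \<in> Cl l z b"
  shows "\<not> isP l z' b \<and> \<not> isQ l z' b"
proof -
  have "isE l c z' b \<Longrightarrow> False" for c
    using Cl_own_end[of l c z' b] Cl_eq[OF assms(4)] Cl_refl[of z l b] assms(1,2) by (auto simp: isE_def split: if_splits)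
  then show ?thesis by (metis isE_def)
qed

lemma cons_lkern: "cons l (lkern n i)"
proof (cases n)
  case 0
  have "lkern 0 i = (if i = 0 then delta l x bx else (\<lambda>_ _. 0))" by (simp add: fun_eq_iff)
  moreover have "cons l (\<lambda>_ _. 0)" by (simp add: cons_def)
  ultimately show ?thesis using cons_delta[of l x bx] 0 by simp
next
  case (Suc n')
  show ?thesis
  proof (rule cons_end)
    fix z z' b assume *: "z < m l" "\<not> isP l z b" "\<not> isQ l z b" "z' \<in> Cl l z b"
    then show "lkern n i z' b = lkern n i z b"
      unfolding Suc using Cl_int[OF *(2,3,1,4)] cons_walk[of l "lkern n' i"] consD[of l "walk l (lkern n' i)" z z' b]
      by (simp add: lkern_int)
  qed
qed

text \<open>\<open>G i\<close> is the potential seen from label \<open>i\<close>, with the label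
  update at the ends already carried out. Self-adjointness moves the step from the law to
  \<open>G\<close>, so it remains to check a one-step inequality, and only where the law does not
  vanish.\<close>

lemma potential_step:
  fixes H G :: "nat \<Rightarrow> nat \<Rightarrow> bool \<Rightarrow> real" and s r :: real
  assumes consG: "\<And>i. cons l (G i)"
    and Gend: "\<And>i c z b. z < m l \<Longrightarrow> isE l c z b \<Longrightarrow> G i z b = s ^ adv c i * H (adv c i) z b"
    and Gint: "\<And>i z b. z < m l \<Longrightarrow> \<not> isP l z b \<Longrightarrow> \<not> isQ l z b \<Longrightarrow> G i z b = s ^ i * H i z b"
    and sup: "\<And>i z b. z < m l \<Longrightarrow> lkern n i z b = 0 \<or> walk l (G i) z b \<le> r * (s ^ i * H i z b)"
  shows "(\<Sum>i\<le>2 * Suc n. s ^ i * IP l (lkern (Suc n) i) (H i)) \<le> r * (\<Sum>i\<le>2 * n. s ^ i * IP l (lkern n i) (H i))"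
proof -
  have "(\<Sum>i\<le>2 * Suc n. s ^ i * IP l (lkern (Suc n) i) (H i)) =
      HS l (\<lambda>z b. \<Sum>i\<le>2 * Suc n. (s ^ i * H i z b) * lkern (Suc n) i z b)"
    unfolding HS_sum IP_def HS_cmult[symmetric] by (intro sum.cong refl HS_cong) simp
  also have "\<dots> = HS l (\<lambda>z b. \<Sum>i\<le>2 * n. walk l (lkern n i) z b * G i z b)"
  proof (rule HS_cong)
    fix z b assume z: "z < m l"
    show "(\<Sum>i\<le>2 * Suc n. (s ^ i * H i z b) * lkern (Suc n) i z b) = (\<Sum>i\<le>2 * n. walk l (lkern n i) z b * G i z b)"
    proof (cases rule: end_cases[of z b])
      case (1 c)
      show ?thesis unfolding lkern_weighted_end[OF 1] walk_own_end[OF 1] Gend[OF z 1]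
        by (intro sum.cong refl) simp
    next
      case 2
      show ?thesis unfolding lkern_weighted_int[OF 2] Gint[OF z 2] by (intro sum.cong refl) simp
    qed
  qed
  also have "\<dots> = (\<Sum>i\<le>2 * n. IP l (lkern n i) (walk l (G i)))"
    unfolding HS_sum by (intro sum.cong refl) (simp add: IP_def[symmetric] walk_adj cons_lkern consG)
  also have "\<dots> \<le> (\<Sum>i\<le>2 * n. r * (s ^ i * IP l (lkern n i) (H i)))"
  proof (rule sum_mono)
    fix i
    have "IP l (lkern n i) (walk l (G i)) \<le> HS l (\<lambda>z b. (r * s ^ i) * (lkern n i z b * H i z b))"
      unfolding IP_def
    proof (rule HS_mono)
      fix z b assume z: "z < m l"
      show "lkern n i z b * walk l (G i) z b \<le> (r * s ^ i) * (lkern n i z b * H i z b)"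
      proof (cases "lkern n i z b = 0")
        case False
        then have "walk l (G i) z b \<le> r * (s ^ i * H i z b)" using sup[OF z, of i b] by blast
        from mult_left_mono[OF this lkern_nonneg[OF z, of n i b]] show ?thesis by (simp add: algebra_simps)
      qed simp
    qed
    then show "IP l (lkern n i) (walk l (G i)) \<le> r * (s ^ i * IP l (lkern n i) (H i))"
      by (simp add: HS_cmult IP_def mult.assoc)
  qed
  finally show ?thesis by (simp add: sum_distrib_left)
qed

end

text \<open>\<open>timer / t\<close> for \<open>c = False\<close>; for \<open>c = True\<close> the harmonic correction exchanges its values at the two ends.\<close>

definition pot :: "nat \<Rightarrow> bool \<Rightarrow> nat \<Rightarrow> bool \<Rightarrow> real" where
  "pot l c z b = (if c then timer l z b + 2 * A l * (2 ^ l - height l z b) - t l else timer l z b) / t l"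

lemma pot_bounds: "0 \<le> pot l c z b \<and> pot l c z b \<le> 1"
proof -
  have "2 * real (A l) * (2 ^ l - height l z b) = 2 * t l - 2 * A l * height l z b" by (simp add: real_t algebra_simps)
  then show ?thesis using timer_bounds[of l z b] t_pos[of l] by (cases c) (simp_all add: pot_def)
qed

lemma pot_end: "isE l c z b \<Longrightarrow> pot l c' z b = (if c = c' then 0 else 1)"
  using timer_P[of l z b] height_P[of l z b] timer_Q[of l z b] height_Q[of l z b] t_pos[of l] A_pos[of l]
  by (auto simp: isE_def pot_def real_t split: if_splits)

text \<open>The drift is \<open>1 / t l\<close> everywhere except at the opposite end; it includes
  the end \<open>c\<close> itself, where the walk is reflected.\<close>

lemma pot_step: "z < m l \<Longrightarrow> \<not> isE l (\<not> c) z b \<Longrightarrow> walk l (pot l c) z b = pot l c z b + 1 / t l"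
proof -
  assume z: "z < m l" "\<not> isE l (\<not> c) z b"
  show ?thesis
  proof (cases c)
    case False
    have "walk l (pot l c) z b = walk l (\<lambda>z b. (1 / t l) * timer l z b) z b"
      using False by (simp add: pot_def[abs_def])
    also have "\<dots> = (1 / t l) * (timer l z b + 1)" unfolding walk_cmult
      using z False by (subst timer_step) (auto simp: isE_def)
    finally have "walk l (pot l c) z b = (1 / t l) * timer l z b + 1 / t l" by (simp only: distrib_left mult_1_right)
    moreover have "pot l c z b = (1 / t l) * timer l z b" using False by (simp add: pot_def)
    ultimately show ?thesis by simp
  next
    case True
    have nP: "\<not> isP l z b" using z(2) True by (simp add: isE_def)
    let ?S = "\<lambda>z b. timer l z b + 2 * A l * (2 ^ l - height l z b) - t l"
    have "walk l (pot l c) z b = walk l (\<lambda>z b. (1 / t l) * ?S z b) z b"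
      using True by (simp add: pot_def[abs_def])
    also have "\<dots> = (1 / t l) * walk l ?S z b" by (rule walk_cmult)
    also have "walk l ?S z b = ?S z b + 1"
    proof (cases "isQ l z b")
      case True
      then have "walk l ?S z b = ?S z (\<not> b)" by (intro walk_own_end[of l True]) (simp add: isE_def)
      then show ?thesis using True timer_Q[OF True] height_Q[OF True] by (simp add: real_t)
    next
      case False
      have "walk l ?S z b = walk l (timer l) z b + 2 * A l * (2 ^ l - walk l (height l) z b) - t l"
        by (simp add: walk_diff walk_add walk_cmult)
      then show ?thesis using timer_step[OF z(1) False] height_harm[OF z(1) nP False] by simp
    qed
    finally have "walk l (pot l c) z b = (1 / t l) * ?S z b + 1 / t l" by (simp only: distrib_left mult_1_right)
    moreover have "pot l c z b = (1 / t l) * ?S z b" using True by (simp add: pot_def)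
    ultimately show ?thesis by simp
  qed
qed

lemma cons_height: "cons k (height k)" and cons_timer: "cons k (timer k)"
proof -
  have "height k e' b = height k e b \<and> timer k e' b = timer k e b" if "e < m k" "e' \<in> Cl k e b" for e e' b
    using that
  proof (induction k arbitrary: e e')
    case 0 then show ?case by (simp add: Cl_def)
  next
    case (Suc k)
    obtain z d where zd: "e = z + m k * d" "z < m k" "d < N k" using lt_m_Suc_decomp[OF Suc.prems(1)] by blast
    show ?case
    proof (cases "isP k z b \<or> isQ k z b")
      case True
      show ?thesis
      proof (cases "isQ k z b")
        case True
        then have "Cl (Suc k) e b = (\<lambda>d'. z + m k * d') ` {..<N k}"
          unfolding zd(1) using Cl_end[of k True z b "Suc k" d] zd(2) CB_Suc_Q[OF zd(3)] by (simp add: isE_def)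
        then obtain d' where d': "d' < N k" "e' = z + m k * d'" using Suc.prems(2) by auto
        show ?thesis unfolding zd(1) d'(2) using zd d' height_Q[OF True] by (simp add: arm_top height_glue timer_glue)
      next
        case False
        then have "Cl (Suc k) e b = {e}"
          unfolding zd(1) using Cl_end[of k False z b "Suc k" d] True zd(2) by (simp add: isE_def CB_Suc_P)
        then show ?thesis using Suc.prems(2) by auto
      qed
    next
      case False
      then have "Cl (Suc k) e b = (\<lambda>z. z + m k * d) ` Cl k z b"
        unfolding zd(1) using Cl_low[of k "z + m k * d" b "Suc k"] zd(2) by simp
      then obtain z' where z': "z' \<in> Cl k z b" "e' = z' + m k * d" using Suc.prems(2) by auto
      have "z' < m k" using z' Cl_lt zd by blast
      then show ?thesis unfolding zd(1) z'(2) using Suc.IH[OF zd(2) z'(1)] zd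
        by (simp add: arm_top height_glue timer_glue)
    qed
  qed
  then show "cons k (height k)" "cons k (timer k)" unfolding cons_def by blast+
qed

lemma cons_pot: "cons l (pot l c)"
  unfolding cons_def
proof (intro allI impI ballI)
  fix e b e' assume "e < m l" "e' \<in> Cl l e b"
  then have "height l e' b = height l e b" "timer l e' b = timer l e b"
    using consD[OF cons_height] consD[OF cons_timer] by blast+
  then show "pot l c e' b = pot l c e b" by (simp add: pot_def)
qed

section \<open>Exponential moments of the label\<close>

context fixes l x :: nat and bx :: bool assumes xl: "x < m l" begin

text \<open>The weight \<open>2 ^ i * (1 + pot)\<close> is continuous across a change of label: at
  the opposite end it is \<open>2 ^ i * 2\<close> before and \<open>2 ^ Suc i * 1\<close> after. In
  between it grows by at most the factor \<open>1 + 1 / t l\<close> per step. Label 0 gets the value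
  4, the largest it can jump to.\<close>

lemma lkern_upper_tail:
  "(\<Sum>i\<le>2 * n. 2 ^ i * HS l (lkern l x bx n i)) \<le> 4 * exp (real n / t l)"
proof -
  define H :: "nat \<Rightarrow> nat \<Rightarrow> bool \<Rightarrow> real" where
    "H i z b = (if i = 0 then 4 else 1 + pot l (even i) z b)" for i z b
  define G :: "nat \<Rightarrow> nat \<Rightarrow> bool \<Rightarrow> real" where
    "G i z b = (if i = 0 then if isP l z b then 2 else 4 else 2 ^ i * H i z b)" for i z b
  let ?r = "1 + 1 / real (t l)"
  have t0: "real (t l) > 0" using t_pos by simp
  have H1: "1 \<le> H i z b" for i z b using pot_bounds[of l "even i" z b] by (simp add: H_def)
  have step: "(\<Sum>i\<le>2 * Suc n. 2 ^ i * IP l (lkern l x bx (Suc n) i) (H i)) \<le> ?r * (\<Sum>i\<le>2 * n. 2 ^ i * IP l (lkern l x bx n i) (H i))" for n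
  proof (rule potential_step[where G = G])
    show "cons l (G i)" for i
    proof (rule cons_end)
      fix z z' b assume *: "z < m l" "\<not> isP l z b" "\<not> isQ l z b" "z' \<in> Cl l z b"
      then show "G i z' b = G i z b"
        using Cl_int[OF *(2,3,1,4)] consD[OF cons_pot *(1,4), of "even i"] by (simp add: G_def H_def)
    qed
    show "G i z b = 2 ^ adv c i * H (adv c i) z b" if "isE l c z b" for i c z b
    proof -
      have ip: "isP l z b \<longleftrightarrow> \<not> c" using that isP_not_isQ[of l z b] by (cases c) (auto simp: isE_def)
      show ?thesis
        by (cases "i = 0"; cases "even i = c"; cases c) (simp_all add: G_def H_def adv_def ip pot_end[OF that])
    qed
    show "G i z b = 2 ^ i * H i z b" if "\<not> isP l z b" for i z b
      using that by (simp add: G_def H_def)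
    show "lkern l x bx n i z b = 0 \<or> walk l (G i) z b \<le> ?r * (2 ^ i * H i z b)" if z: "z < m l" for i z b
    proof (rule disjI2, cases "i = 0")
      case True
      have "walk l (G i) z b \<le> walk l (\<lambda>_ _. 4) z b" by (rule walk_mono[OF z]) (simp add: G_def True)
      also have "\<dots> \<le> ?r * (2 ^ i * H i z b)" using t0 by (simp add: H_def True)
      finally show "walk l (G i) z b \<le> ?r * (2 ^ i * H i z b)" .
    next
      case False
      let ?c = "even i"
      have "walk l (G i) z b = walk l (\<lambda>z b. 2 ^ i * (1 + pot l ?c z b)) z b" using False by (simp add: G_def[abs_def] H_def)
      then have P: "walk l (G i) z b = 2 ^ i * (1 + walk l (pot l ?c) z b)" by (simp add: walk_cmult walk_add)
      have "1 + walk l (pot l ?c) z b \<le> ?r * (1 + pot l ?c z b)"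
      proof (cases "isE l (\<not> ?c) z b")
        case True
        have g1: "pot l ?c z b = 1" using pot_end[OF True] by simp
        have "1 + walk l (pot l ?c) z b \<le> 1 * (1 + 1)"
          using walk_own_end[OF True] pot_bounds by auto
        also have "\<dots> \<le> ?r * (1 + 1)" by (rule mult_right_mono) auto
        finally show ?thesis unfolding g1 .
      next
        case False
        then show ?thesis using pot_step[OF z False] t0 pot_bounds[of l ?c z b] by (simp add: field_simps)
      qed
      then have "2 ^ i * (1 + walk l (pot l ?c) z b) \<le> 2 ^ i * (?r * (1 + pot l ?c z b))" by (rule mult_left_mono) simp
      then show "walk l (G i) z b \<le> ?r * (2 ^ i * H i z b)" unfolding P using False by (simp add: H_def algebra_simps)
    qed
  qed
  have bound: "(\<Sum>i\<le>2 * n. 2 ^ i * IP l (lkern l x bx n i) (H i)) \<le> 4 * exp (real n / t l)" for n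
  proof (induction n)
    case 0
    have "IP l (delta l x bx) (H 0) = 4" using IP_delta[OF xl, of "H 0" bx] by (simp add: H_def[abs_def] cons_def)
    moreover have "lkern l x bx 0 0 = delta l x bx" by (simp add: fun_eq_iff)
    ultimately show ?case by simp
  next
    case (Suc n)
    have "(\<Sum>i\<le>2 * Suc n. 2 ^ i * IP l (lkern l x bx (Suc n) i) (H i)) \<le> ?r * (\<Sum>i\<le>2 * n. 2 ^ i * IP l (lkern l x bx n i) (H i))"
      by (rule step)
    also have "\<dots> \<le> exp (1 / t l) * (4 * exp (real n / t l))"
      using Suc exp_ge_add_one_self[of "1 / real (t l)"] t0
      by (intro mult_mono) (auto intro!: sum_nonneg mult_nonneg_nonneg HS_nonneg lkern_nonneg order_trans[OF _ H1] simp: IP_def)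
    also have "\<dots> = 4 * exp (real (Suc n) / t l)"
      by (simp add: add_divide_distrib exp_add mult.left_commute)
    finally show ?case .
  qed
  have "(\<Sum>i\<le>2 * n. 2 ^ i * HS l (lkern l x bx n i)) \<le> (\<Sum>i\<le>2 * n. 2 ^ i * IP l (lkern l x bx n i) (H i))"
    unfolding IP_def
  proof (intro sum_mono mult_left_mono HS_mono)
    fix i z b assume z: "z < m l"
    show "lkern l x bx n i z b \<le> lkern l x bx n i z b * H i z b"
      using mult_left_mono[OF H1[of i z b] lkern_nonneg[OF z, of x bx n i b]] by simp
  qed simp
  also note bound[of n]
  finally show ?thesis .
qed

text \<open>The same device with base \<open>1/2\<close> and the decreasing weight
  \<open>1 - pot / 2\<close>. Label 0 has no last end, so it uses both potentials at once. Decay is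
  counted from time 1 on, since only then label 0 is absent from the ends, where its weight need not
  decrease. The factor 4 comes from \<open>1/2 \<le> H \<le> 2\<close>.\<close>

lemma lkern_lower_tail:
  "(\<Sum>i\<le>2 * Suc n. (1/2) ^ i * HS l (lkern l x bx (Suc n) i)) \<le> 4 * exp (- real n / (2 * t l))"
proof -
  define H :: "nat \<Rightarrow> nat \<Rightarrow> bool \<Rightarrow> real" where
    "H i z b = (if i = 0 then 2 - (pot l False z b + pot l True z b) / 2 else 1 - pot l (even i) z b / 2)" for i z b
  define G :: "nat \<Rightarrow> nat \<Rightarrow> bool \<Rightarrow> real" where
    "G i z b = (if i = 0 then if isP l z b then 1/2 else if isQ l z b then 1/4 else H 0 z b else (1/2) ^ i * H i z b)" for i z b
  let ?r = "1 - 1 / (2 * real (t l))"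
  have t0: "real (t l) \<ge> 1" using t_pos[of l] by linarith
  have r0: "0 \<le> ?r" using t0 by (simp add: field_simps)
  have H1: "1/2 \<le> H i z b" and H2: "H i z b \<le> 2" for i z b
    using pot_bounds[of l "even i" z b] pot_bounds[of l False z b] pot_bounds[of l True z b] by (auto simp: H_def)
  have H01: "1 \<le> H 0 z b" for z b
    using pot_bounds[of l False z b] pot_bounds[of l True z b] by (auto simp: H_def)
  have step: "(\<Sum>i\<le>2 * Suc (Suc n). (1/2) ^ i * IP l (lkern l x bx (Suc (Suc n)) i) (H i))
      \<le> ?r * (\<Sum>i\<le>2 * Suc n. (1/2) ^ i * IP l (lkern l x bx (Suc n) i) (H i))" for n
  proof (rule potential_step[where G = G])
    show "cons l (G i)" for i
    proof (rule cons_end)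
      fix z z' b assume *: "z < m l" "\<not> isP l z b" "\<not> isQ l z b" "z' \<in> Cl l z b"
      then show "G i z' b = G i z b"
        using Cl_int[OF *(2,3,1,4)] consD[OF cons_pot *(1,4)] by (simp add: G_def H_def)
    qed
    show "G i z b = (1/2) ^ adv c i * H (adv c i) z b" if "isE l c z b" for i c z b
    proof -
      have ip: "isP l z b \<longleftrightarrow> \<not> c" "isQ l z b \<longleftrightarrow> c" using that isP_not_isQ[of l z b] by (cases c; auto simp: isE_def)+
      show ?thesis
        by (cases "i = 0"; cases "even i = c"; cases c) (simp_all add: G_def H_def adv_def ip pot_end[OF that] power2_eq_square)
    qed
    show "G i z b = (1/2) ^ i * H i z b" if "\<not> isP l z b" "\<not> isQ l z b" for i z b
      using that by (simp add: G_def H_def)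
    show "lkern l x bx (Suc n) i z b = 0 \<or> walk l (G i) z b \<le> ?r * ((1/2) ^ i * H i z b)" if z: "z < m l" for i z b
    proof (cases "i = 0")
      case True
      show ?thesis
      proof (cases rule: end_cases[of l z b])
        case (1 c) then show ?thesis using lkern_0_end True by blast
      next
        case 2
        have "walk l (G i) z b \<le> walk l (H 0) z b"
        proof (rule walk_mono[OF z])
          show "G i e b \<le> H 0 e b" for e b
            using H01[of e b] by (simp add: G_def True)
        qed
        also have "walk l (H 0) z b = walk l (\<lambda>z b. 2 - (1/2) * (pot l False z b + pot l True z b)) z b"
          by (rule walk_cong[OF z]) (simp add: H_def)
        also have "\<dots> = 2 - (1/2) * (walk l (pot l False) z b + walk l (pot l True) z b)"
          by (simp only: walk_diff walk_cmult walk_add walk_const)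
        also have "\<dots> = H 0 z b - 1 / t l"
          using pot_step[OF z, of False b] pot_step[OF z, of True b] 2 by (simp add: isE_def H_def field_simps)
        also have "\<dots> \<le> ?r * H 0 z b" using H2[of 0 z b] t0 by (simp add: field_simps)
        finally show ?thesis using True by simp
      qed
    next
      case False
      let ?c = "even i"
      show ?thesis
      proof (cases "isE l (\<not> ?c) z b")
        case True then show ?thesis using lkern_wrong[of i l "\<not> ?c" z b] False by blast
      next
        case nE: False
        have "walk l (G i) z b = walk l (\<lambda>z b. (1/2) ^ i * (1 - (1/2) * pot l ?c z b)) z b"
          by (rule walk_cong[OF z]) (use False in \<open>simp add: G_def H_def\<close>)
        also have "\<dots> = (1/2) ^ i * (1 - (1/2) * walk l (pot l ?c) z b)"
          by (simp only: walk_cmult walk_diff walk_const)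
        also have "\<dots> \<le> (1/2) ^ i * (?r * H i z b)"
          unfolding pot_step[OF z nE] using t0 pot_bounds[of l ?c z b] False
          by (intro mult_left_mono) (simp_all add: H_def field_simps)
        finally show ?thesis by (simp add: algebra_simps)
      qed
    qed
  qed
  have bound: "(\<Sum>i\<le>2 * Suc n. (1/2) ^ i * IP l (lkern l x bx (Suc n) i) (H i)) \<le> 2 * exp (- real n / (2 * t l))" for n
  proof (induction n)
    case 0
    have "(\<Sum>i\<le>2 * Suc 0. (1/2) ^ i * IP l (lkern l x bx (Suc 0) i) (H i)) \<le> (\<Sum>i\<le>2 * Suc 0. 2 * HS l (lkern l x bx (Suc 0) i))"
    proof (rule sum_mono)
      fix i
      have p: "(1/2::real) ^ i * h \<le> h" if "0 \<le> h" for h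
        using mult_right_mono[OF power_le_one[of "1/2::real" i] that] by simp
      have "(1/2) ^ i * IP l (lkern l x bx (Suc 0) i) (H i) \<le> IP l (lkern l x bx (Suc 0) i) (H i)"
        by (rule p) (auto intro!: HS_nonneg mult_nonneg_nonneg lkern_nonneg order_trans[OF _ H1] simp: IP_def)
      also have "\<dots> \<le> HS l (\<lambda>z b. 2 * lkern l x bx (Suc 0) i z b)"
        unfolding IP_def
      proof (rule HS_mono)
        fix z b assume z: "z < m l"
        show "lkern l x bx (Suc 0) i z b * H i z b \<le> 2 * lkern l x bx (Suc 0) i z b"
          using mult_left_mono[OF H2[of i z b] lkern_nonneg[OF z, of x bx "Suc 0" i b]] by simp
      qed
      finally show "(1/2) ^ i * IP l (lkern l x bx (Suc 0) i) (H i) \<le> 2 * HS l (lkern l x bx (Suc 0) i)"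
        by (simp add: HS_cmult)
    qed
    also have "\<dots> = 2 * HS l (\<lambda>z b. \<Sum>i\<le>2 * Suc 0. lkern l x bx (Suc 0) i z b)"
      by (simp only: sum_distrib_left[symmetric] HS_sum)
    also have "HS l (\<lambda>z b. \<Sum>i\<le>2 * Suc 0. lkern l x bx (Suc 0) i z b) = HS l (kern l (Suc 0) x bx)"
      by (rule HS_cong) (rule lkern_sum)
    finally show ?case using HS_kern[OF xl, of "Suc 0" bx] by simp
  next
    case (Suc n)
    have "(\<Sum>i\<le>2 * Suc (Suc n). (1/2) ^ i * IP l (lkern l x bx (Suc (Suc n)) i) (H i))
       \<le> ?r * (\<Sum>i\<le>2 * Suc n. (1/2) ^ i * IP l (lkern l x bx (Suc n) i) (H i))"
      by (rule step)
    also have "\<dots> \<le> ?r * (2 * exp (- real n / (2 * t l)))" by (rule mult_left_mono[OF Suc r0])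
    also have "\<dots> \<le> exp (- 1 / (2 * t l)) * (2 * exp (- real n / (2 * t l)))"
      using exp_ge_add_one_self[of "- 1 / (2 * real (t l))"] by (intro mult_right_mono) auto
    also have "\<dots> = 2 * exp (- real (Suc n) / (2 * t l))"
      by (simp add: exp_add[symmetric] diff_divide_distrib)
    finally show ?case .
  qed
  have "(\<Sum>i\<le>2 * Suc n. (1/2) ^ i * HS l (lkern l x bx (Suc n) i)) \<le> (\<Sum>i\<le>2 * Suc n. (1/2) ^ i * (2 * IP l (lkern l x bx (Suc n) i) (H i)))"
    unfolding IP_def HS_cmult[symmetric]
  proof (intro sum_mono mult_left_mono HS_mono)
    fix i z b assume z: "z < m l"
    show "lkern l x bx (Suc n) i z b \<le> 2 * (lkern l x bx (Suc n) i z b * H i z b)"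
      using mult_left_mono[OF H1[of i z b] lkern_nonneg[OF z, of x bx "Suc n" i b]] by simp
  qed simp
  also have "\<dots> = 2 * (\<Sum>i\<le>2 * Suc n. (1/2) ^ i * IP l (lkern l x bx (Suc n) i) (H i))"
    by (simp add: sum_distrib_left mult.left_commute del: sum.atMost_Suc)
  also have "\<dots> \<le> 4 * exp (- real n / (2 * t l))" using bound[of n] by simp
  finally show ?thesis .
qed

end

text \<open>Averaging over the blocks glued at an end at each change of label. Label \<open>2\<close> is reached both from \<open>0\<close>
  and from \<open>1\<close>; the factor \<open>1 / D\<close> makes \<open>weight_avg\<close> hold in both cases.\<close>

fun weight :: "nat \<Rightarrow> nat \<Rightarrow> nat \<Rightarrow> nat \<Rightarrow> nat \<Rightarrow> real" where
  "weight M l B0 0 B = (if B = B0 then 1 else 0)"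
| "weight M l B0 (Suc 0) B = av (CB M l False B) (\<lambda>B'. if B' = B0 then 1 else 0)"
| "weight M l B0 (Suc (Suc 0)) B = av (CB M l True B) (\<lambda>B'. if B' = B0 then 1 else 0) / D"
| "weight M l B0 (Suc (Suc (Suc j))) B = av (CB M l (odd j) B) (weight M l B0 (Suc (Suc j)))"

section \<open>Distributing the labels over the blocks\<close>

lemma weight_nonneg: "0 \<le> weight M l B0 j B"
  by (induction M l B0 j B rule: weight.induct) (auto intro!: av_nonneg divide_nonneg_nonneg)

lemma weight_Suc: "2 \<le> j \<Longrightarrow> weight M l B0 (Suc j) B = av (CB M l (odd j) B) (weight M l B0 j)"
  by (cases j; cases "j - 1") auto

lemma av_idem: "av (CB M l c B) (\<lambda>B'. av (CB M l c B') h) = av (CB M l c B) h"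
  by (rule av_const) (auto simp: CB_eq)

lemma av_ge_own: "(\<And>B. 0 \<le> h B) \<Longrightarrow> h B / D \<le> av (CB M l c B) h"
  by (rule av_ge_member) (auto simp: card_CB_le)

lemma av_ge_other: "(\<And>B. 0 \<le> h B) \<Longrightarrow> B' \<in> CB M l c B \<Longrightarrow> h B' / D \<le> av (CB M l c B) h"
  by (rule av_ge_member) (auto simp: card_CB_le)

text \<open>Returning to the last visited end moves no weight, because averaging over a class is
  idempotent.\<close>

lemma weight_own: assumes *: "even i = c" "i > 0"
  shows "av (CB M l c B) (weight M l B0 i) = weight M l B0 i B"
proof -
  let ?a = "\<lambda>c B. av (CB M l c B)" and ?W = "weight M l B0"
  have W0: "?W 0 = (\<lambda>B'. if B' = B0 then 1 else 0)" by (simp add: fun_eq_iff)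
  have W1: "?W (Suc 0) = (\<lambda>B. ?a False B (?W 0))" unfolding W0 by (simp add: fun_eq_iff)
  have W2: "?W 2 = (\<lambda>B. (1 / D) * ?a True B (?W 0))" unfolding W0 by (simp add: fun_eq_iff numeral_2_eq_2)
    consider "i = 1" | "i = 2" | j where "i = Suc j" "2 \<le> j" using *(2) by (cases i) (auto simp: numeral_2_eq_2, fastforce)
    then show ?thesis
    proof cases
      case 1 then show ?thesis using * by (simp add: W1 av_idem del: weight.simps)
    next
      case 2 then show ?thesis using * by (simp only: W2 av_cmult av_idem) (simp add: av_idem)
    next
      case 3
      then have "odd j = c" using * by auto
      then have "?W i = (\<lambda>B. ?a c B (?W j))" using 3 by (simp add: fun_eq_iff weight_Suc)
      then show ?thesis by (simp add: av_idem)
    qed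
  qed

lemma weight_avg: "weight M l B0 (adv c i) B \<le> av (CB M l c B) (weight M l B0 i)"
proof -
  let ?a = "\<lambda>c B. av (CB M l c B)" and ?W = "weight M l B0"
  have W0: "?W 0 = (\<lambda>B'. if B' = B0 then 1 else 0)" by (simp add: fun_eq_iff)
  have W1: "?W (Suc 0) = (\<lambda>B. ?a False B (?W 0))" unfolding W0 by (simp add: fun_eq_iff)
  have W2: "?W 2 = (\<lambda>B. (1 / D) * ?a True B (?W 0))" unfolding W0 by (simp add: fun_eq_iff numeral_2_eq_2)
  have D1: "1 / real D \<le> 1" using D_ge2 by simp
  consider "i = 0" "c" | "i = 0" "\<not> c" | "i > 0" "even i = c" | "i = 1" "c" | "i \<ge> 2" "even i \<noteq> c"
    by (cases "i = 0"; cases "even i = c"; cases "i = 1") auto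
  then show ?thesis
  proof cases
    case 1
    have "0 \<le> ?a True B (?W 0)" by (rule av_nonneg) (rule weight_nonneg)
    from mult_right_mono[OF D1 this] show ?thesis using 1 by (simp add: adv_def W2 del: weight.simps)
  next
    case 2 then show ?thesis by (simp add: adv_def W1 del: weight.simps)
  next
    case 3 then show ?thesis using weight_own by (simp add: adv_def)
  next
    case 4
    have "?W 2 B = ?a True B (\<lambda>B. ?W 0 B / D)" unfolding W2 av_cmult[symmetric] by simp
    also have "\<dots> \<le> ?a True B (?W (Suc 0))"
    proof (rule av_mono)
      show "?W 0 B' / D \<le> ?W (Suc 0) B'" for B' unfolding W1 by (rule av_ge_own) (rule weight_nonneg)
    qed
    finally show ?thesis using 4 by (simp add: adv_def numeral_2_eq_2 del: weight.simps)
  next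
    case 5
    then have "?W (Suc i) B = ?a c B (?W i)" by (subst weight_Suc) auto
    then show ?thesis using 5 by (simp add: adv_def)
  qed
qed

text \<open>The right-hand kernel dominates a product form in which \<open>weight\<close> plays the
  role of the law of the block given the label. By \<open>weight_avg\<close> the product form is a
  subsolution at the ends, and inside a block the weight is constant. The factor
  \<open>1 / D\<close> compares the two point densities at time 0.\<close>

lemma kern_ge_labels:
  assumes lM: "l \<le> M" and X: "X < m M" and z: "z < m l" and B: "z + m l * B < m M"
  shows "(\<Sum>i\<le>2 * n. weight M l (X div m l) i B * lkern l (X mod m l) bx n i z b) / D \<le> kern M n X bx (z + m l * B) b"
  using z B
proof (induction n arbitrary: z B b)
  case 0
  let ?x = "X mod m l" and ?B0 = "X div m l"
  show ?case
  proof (cases "B = ?B0 \<and> b = bx \<and> z \<in> Cl l ?x bx")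
    case True
    have "z + m l * B \<in> Cl M X bx"
    proof (cases "isP l ?x bx \<or> isQ l ?x bx")
      case True': True
      then have "isE l (isQ l ?x bx) ?x bx" by (auto simp: isE_def)
      then have "z = ?x" using True Cl_own_end by blast
      then show ?thesis using True by simp
    next
      case False then show ?thesis using Cl_low[of l X bx M] lM True by auto
    qed
    moreover have "1 / real (card (Cl l ?x bx)) \<le> 1" using card_Cl_pos[of l ?x bx] by simp
    moreover have "1 / real D \<le> 1 / card (Cl M X bx)"
      using card_Cl_pos[of M X bx] card_Cl_le[of M X bx] by (intro divide_left_mono) auto
    moreover have "1 / real (card (Cl l ?x bx)) / D \<le> 1 / D"
      using card_Cl_pos[of l ?x bx] by (intro divide_right_mono) auto
    ultimately show ?thesis using True by (simp add: kern_0 delta_def)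
  next
    case False then show ?thesis by (auto simp: kern_0 delta_def)
  qed
next
  case (Suc n)
  let ?x = "X mod m l" and ?W = "weight M l (X div m l)"
  let ?K = "lkern l ?x bx"
  show ?case
  proof (cases rule: end_cases[of l z b])
    case (1 c)
    have "(\<Sum>j\<le>2 * Suc n. ?W j B * ?K (Suc n) j z b) / D = (\<Sum>i\<le>2 * n. ?W (adv c i) B * ?K n i z (\<not> b)) / D"
      by (simp only: lkern_weighted_end[OF 1])
    also have "\<dots> \<le> (\<Sum>i\<le>2 * n. av (CB M l c B) (?W i) * ?K n i z (\<not> b)) / D"
      by (intro divide_right_mono sum_mono mult_right_mono weight_avg lkern_nonneg Suc.prems) simp
    also have "\<dots> = av (CB M l c B) (\<lambda>B'. (\<Sum>i\<le>2 * n. ?W i B' * ?K n i z (\<not> b)) / D)"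
    proof -
      have "av (CB M l c B) (\<lambda>B'. (\<Sum>i\<le>2 * n. ?W i B' * ?K n i z (\<not> b)) / D) =
         (\<Sum>i\<le>2 * n. av (CB M l c B) (\<lambda>B'. (?K n i z (\<not> b) / D) * ?W i B'))"
        unfolding av_sum[symmetric] by (rule av_cong[OF refl]) (simp add: sum_divide_distrib mult.commute)
      also have "\<dots> = (\<Sum>i\<le>2 * n. av (CB M l c B) (?W i) * ?K n i z (\<not> b)) / D"
        unfolding av_cmult sum_divide_distrib by (intro sum.cong refl) simp
      finally show ?thesis by simp
    qed
    also have "\<dots> \<le> av (CB M l c B) (\<lambda>B'. kern M n X bx (z + m l * B') (\<not> b))"
    proof (rule av_mono, rule Suc.IH[OF Suc.prems(1)])
      fix B' assume "B' \<in> CB M l c B"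
      then have "z + m l * B' \<in> Cl M (z + m l * B) b" unfolding Cl_end[OF 1 Suc.prems(1)] by blast
      then show "z + m l * B' < m M" using Cl_lt Suc.prems by blast
    qed
    also have "\<dots> = kern M (Suc n) X bx (z + m l * B) b"
      unfolding kern_Suc by (rule walk_end[OF 1 Suc.prems(1), symmetric])
    finally show ?thesis .
  next
    case 2
    have Blt: "z' + m l * B < m M" if "z' < m l" for z'
    proof -
      have "z + m l * B < (m M div m l) * m l" using Suc.prems(2) m_dvd[OF lM] by simp
      from less_mult_imp_div_less[OF this] have "B < m M div m l" using Suc.prems(1) by simp
      then have "B + 1 \<le> m M div m l" by simp
      then have "m l * (B + 1) \<le> m M" using m_dvd[OF lM] by (metis dvd_mult_div_cancel mult_le_mono2)
      then show ?thesis using that by simp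
    qed
    have "(\<Sum>j\<le>2 * Suc n. ?W j B * ?K (Suc n) j z b) / D = (\<Sum>i\<le>2 * n. (?W i B / D) * walk l (?K n i) z b)"
      by (simp only: lkern_weighted_int[OF 2] sum_divide_distrib) simp
    also have "\<dots> = walk l (\<lambda>z b. \<Sum>i\<le>2 * n. (?W i B / D) * ?K n i z b) z b"
      by (simp only: walk_cmult walk_sum)
    also have "\<dots> \<le> walk l (\<lambda>z. kern M n X bx (z + m l * B)) z b"
    proof (rule walk_mono[OF Suc.prems(1)])
      fix z' b' assume z': "z' < m l"
      show "(\<Sum>i\<le>2 * n. (?W i B / D) * ?K n i z' b') \<le> kern M n X bx (z' + m l * B) b'"
        using Suc.IH[OF z' Blt[OF z'], of b'] by (simp add: sum_divide_distrib)
    qed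
    also have "\<dots> = kern M (Suc n) X bx (z + m l * B) b"
      unfolding kern_Suc by (rule walk_low[OF 2 Suc.prems(1) lM, symmetric])
    finally show ?thesis .
  qed
qed

text \<open>Each average runs over at most \<open>D\<close> blocks, among them the block
  itself.\<close>

lemma weight_step_ge: assumes "2 \<le> i" "1 / D ^ i \<le> weight M l B0 i B" "i \<le> j"
  shows "1 / D ^ j \<le> weight M l B0 j B"
  using assms(3)
proof (induction j rule: dec_induct)
  case (step j)
  have "1 / D ^ Suc j = 1 / D ^ j / D" by simp
  also have "\<dots> \<le> weight M l B0 j B / D" by (rule divide_right_mono) (use step in auto)
  also have "\<dots> \<le> weight M l B0 (Suc j) B"
    using step assms(1) by (subst weight_Suc) (auto intro: av_ge_own weight_nonneg)
  finally show ?case .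
qed (rule assms(2))

lemma weight_2_own: "B0 \<in> CB M l True B \<Longrightarrow> 1 / D ^ 2 \<le> weight M l B0 2 B"
proof -
  assume B: "B0 \<in> CB M l True B"
  let ?h = "\<lambda>B'. if B' = B0 then 1 else 0 :: real"
  have "1 / real D \<le> av (CB M l True B) ?h"
    using av_ge_other[of ?h B0 M l True B] B by simp
  then have "1 / real D / D \<le> av (CB M l True B) ?h / D" by (rule divide_right_mono) simp
  moreover have "weight M l B0 2 B = av (CB M l True B) ?h / D" by (simp only: numeral_2_eq_2 weight.simps)
  ultimately show ?thesis by (simp add: power2_eq_square)
qed

section \<open>Near-diagonal lower bound\<close>

lemma kern_le_mix: assumes "x < m k" "y < m k" "2 * mix_const * t k + 1 \<le> n"
  shows "kern k n x bx y by \<le> 3 / (2 * m k)"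
proof -
  have ev: "kern k (2 * n') x bx e b \<le> 3 / (2 * m k)" if "mix_const * t k \<le> n'" "e < m k" for n' e b
  proof (cases "b = bx")
    case True
    have "kern k (n' + n') x bx e bx - 1 / m k \<le> 1 / (2 * m k)"
      using kern_mix[OF assms(1) that(2,1), of bx] by (rule abs_le_D1)
    moreover have "3 / (2 * real (m k)) = 1 / m k + 1 / (2 * m k)" using m_pos[of k] by (simp add: field_simps)
    ultimately show ?thesis unfolding True mult_2[of n'] by linarith
  next
    case False
    then have "kern k (2 * n') x bx e b = 0" by (intro kern_supp) simp
    then show ?thesis by simp
  qed
  show ?thesis
  proof (cases "even n")
    case True
    then obtain n' where n': "n = 2 * n'" by blast
    show ?thesis unfolding n' by (rule ev) (use assms n' in auto)
  next
    case False
    then obtain n' where n': "n = Suc (2 * n')" by (auto elim: oddE)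
    have "kern k n x bx y by \<le> walk k (\<lambda>_ _. 3 / (2 * m k)) y by"
      unfolding n' kern_Suc by (rule walk_mono[OF assms(2)], rule ev) (use assms n' in auto)
    then show ?thesis by simp
  qed
qed

text \<open>Both walks run for time \<open>n\<close> and are compared in the block of
  \<open>Y\<close>. By mixing, the folded kernels have inner product at least
  \<open>1 / (2 * m l)\<close>. Dropping the labels outside \<open>{j0..j1}\<close> removes mass at
  most \<open>1 / 12\<close> from each, which the sup bound \<open>3 / (2 * m l)\<close> turns into
  a total loss of at most half. For the remaining labels the weight is at least
  \<open>1 / D ^ j1\<close>, and \<open>kern_ge_labels\<close> carries the overlap to the large
  graph.\<close>

lemma kern_near:
  assumes lM: "l \<le> M" and X: "X < m M" and Y: "Y < m M"
    and n: "2 * mix_const * t l + 2 \<le> n"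
    and lo: "2 ^ j0 * (4 * exp (- real (n - 1) / (2 * t l))) \<le> 1 / 24"
    and hi: "4 * exp (real n / t l) / 2 ^ j1 \<le> 1 / 24"
    and j0: "2 \<le> j0"
    and WX: "1 / D ^ j0 \<le> weight M l (X div m l) j0 (Y div m l)"
  shows "1 / (4 * real (D ^ (2 * j1 + 2)) * m l) \<le> kern M (n + n) X bx Y bx"
proof -
  let ?BY = "Y div m l" and ?x = "X mod m l" and ?y = "Y mod m l"
  let ?kX = "\<lambda>z b. \<Sum>i\<in>{j0..j1}. lkern l ?x bx n i z b" and ?kY = "\<lambda>z b. \<Sum>i\<in>{j0..j1}. lkern l ?y bx n i z b"
  let ?pX = "kern l n ?x bx" and ?pY = "kern l n ?y bx"
  have xl: "?x < m l" "?y < m l" using m_pos by auto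
  obtain n' where n': "n = Suc n'" using n by (cases n) auto
  have WY: "1 / D ^ j0 \<le> weight M l ?BY j0 ?BY"
    by (rule weight_step_ge[OF order_refl weight_2_own j0]) simp
  have W: "1 / D ^ j1 \<le> weight M l (X div m l) i ?BY" "1 / D ^ j1 \<le> weight M l ?BY i ?BY" if "i \<in> {j0..j1}" for i
  proof -
    have "1 / real D ^ j1 \<le> 1 / D ^ i"
      using that D_ge2 by (intro divide_left_mono power_increasing) auto
    then show "1 / D ^ j1 \<le> weight M l (X div m l) i ?BY" "1 / D ^ j1 \<le> weight M l ?BY i ?BY"
      using weight_step_ge[OF j0 WX, of i] weight_step_ge[OF j0 WY, of i] that by auto
  qed
  have BY: "?BY < m M div m l" using Y m_dvd[OF lM] by (metis dvd_mult_div_cancel less_mult_imp_div_less mult.commute)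
  have inM: "z + m l * ?BY < m M" if "z < m l" for z
  proof -
    have "m l * (?BY + 1) \<le> m l * (m M div m l)" using BY by (intro mult_le_mono) auto
    then show ?thesis using that m_dvd[OF lM] by simp
  qed
  have err: "(\<Sum>i\<le>2 * n. lkern l w bx n i z b) - (\<Sum>i\<in>{j0..j1}. lkern l w bx n i z b) \<ge> 0 \<and>
      0 \<le> (\<Sum>i\<in>{j0..j1}. lkern l w bx n i z b) \<and>
      HS l (\<lambda>z b. (\<Sum>i\<le>2 * n. lkern l w bx n i z b) - (\<Sum>i\<in>{j0..j1}. lkern l w bx n i z b)) \<le> 1 / 12"
    if w: "w < m l" and z: "z < m l" for w z b
  proof -
    let ?k = "\<lambda>z b. \<Sum>i\<in>{j0..j1}. lkern l w bx n i z b"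
    let ?I = "{..2 * n} - {j0..j1}"
    have eq: "(\<Sum>i\<le>2 * n. lkern l w bx n i z b) - ?k z b = (\<Sum>i\<in>?I. lkern l w bx n i z b)" for z b
    proof -
      have "?k z b = (\<Sum>i\<in>{..2 * n} \<inter> {j0..j1}. lkern l w bx n i z b)"
        by (rule sum.mono_neutral_right) (auto simp: lkern_zero)
      moreover have "(\<Sum>i\<le>2 * n. lkern l w bx n i z b) = (\<Sum>i\<in>?I. lkern l w bx n i z b) + (\<Sum>i\<in>{..2 * n} \<inter> {j0..j1}. lkern l w bx n i z b)"
        by (subst sum.union_disjoint[symmetric]) (auto intro!: sum.cong)
      ultimately show ?thesis by simp
    qed
    have HSnn: "0 \<le> HS l (lkern l w bx n i)" for i by (rule HS_nonneg) (rule lkern_nonneg)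
    have "HS l (\<lambda>z b. \<Sum>i\<in>?I. lkern l w bx n i z b) = (\<Sum>i\<in>?I. HS l (lkern l w bx n i))" by (rule HS_sum)
    \<comment> \<open>Exponential Chebyshev inequality: \<open>2 ^ j0 * (1/2) ^ i\<close> is at
      least one for labels below \<open>j0\<close>, and \<open>2 ^ i / 2 ^ j1\<close> for labels
      above \<open>j1\<close>.\<close>
    also have "\<dots> \<le> (\<Sum>i\<in>?I. 2 ^ j0 * ((1/2) ^ i * HS l (lkern l w bx n i)) + 2 ^ i * HS l (lkern l w bx n i) / 2 ^ j1)"
    proof (rule sum_mono)
      fix i assume "i \<in> ?I"
      then consider "i < j0" | "j1 < i" by fastforce
      then show "HS l (lkern l w bx n i) \<le> 2 ^ j0 * ((1/2) ^ i * HS l (lkern l w bx n i)) + 2 ^ i * HS l (lkern l w bx n i) / 2 ^ j1"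
      proof cases
        case 1
        have "1 \<le> (2::real) ^ j0 * (1/2) ^ i" using 1 power_increasing[of i j0 "2::real"] by (simp add: power_one_over field_simps)
        from mult_right_mono[OF this HSnn[of i]] HSnn[of i] show ?thesis by (simp add: mult.assoc add_increasing2)
      next
        case 2
        have "1 \<le> (2::real) ^ i / 2 ^ j1" using 2 power_increasing[of j1 i "2::real"] by simp
        from mult_right_mono[OF this HSnn[of i]] HSnn[of i] show ?thesis by (simp add: add_increasing)
      qed
    qed
    also have "\<dots> \<le> (\<Sum>i\<le>2 * n. 2 ^ j0 * ((1/2) ^ i * HS l (lkern l w bx n i)) + 2 ^ i * HS l (lkern l w bx n i) / 2 ^ j1)"
      by (rule sum_mono2) (auto intro!: add_nonneg_nonneg divide_nonneg_nonneg mult_nonneg_nonneg HSnn)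
    also have "\<dots> = 2 ^ j0 * (\<Sum>i\<le>2 * n. (1/2) ^ i * HS l (lkern l w bx n i)) + (\<Sum>i\<le>2 * n. 2 ^ i * HS l (lkern l w bx n i)) / 2 ^ j1"
      by (simp add: sum.distrib sum_distrib_left sum_divide_distrib)
    also have "\<dots> \<le> 2 ^ j0 * (4 * exp (- real (n - 1) / (2 * t l))) + 4 * exp (real n / t l) / 2 ^ j1"
      using lkern_lower_tail[OF w, of bx n'] lkern_upper_tail[OF w, of bx n] unfolding n'
      by (intro add_mono mult_left_mono divide_right_mono) auto
    also have "\<dots> \<le> 1 / 24 + 1 / 24" by (rule add_mono[OF lo hi])
    finally show ?thesis unfolding eq using lkern_nonneg[OF z, of w bx n _ b] by (auto intro!: sum_nonneg)
  qed
  have eX: "?kX z b \<le> ?pX z b" "0 \<le> ?kX z b" and eY: "?kY z b \<le> ?pY z b" "0 \<le> ?kY z b" if z: "z < m l" for z b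
    using err[OF xl(1) z, of b] err[OF xl(2) z, of b] lkern_sum[OF z, where n = n and x = ?x and bx = bx and b = b] lkern_sum[OF z, where n = n and x = ?y and bx = bx and b = b] by auto
  have HSX: "HS l (\<lambda>z b. ?pX z b - ?kX z b) \<le> 1 / 12" and HSY: "HS l (\<lambda>z b. ?pY z b - ?kY z b) \<le> 1 / 12"
  proof -
    have "HS l (\<lambda>z b. ?pX z b - ?kX z b) = HS l (\<lambda>z b. (\<Sum>i\<le>2 * n. lkern l ?x bx n i z b) - ?kX z b)"
      by (rule HS_cong) (simp only: lkern_sum)
    then show "HS l (\<lambda>z b. ?pX z b - ?kX z b) \<le> 1 / 12" using err[OF xl(1) m_pos] by simp
    have "HS l (\<lambda>z b. ?pY z b - ?kY z b) = HS l (\<lambda>z b. (\<Sum>i\<le>2 * n. lkern l ?y bx n i z b) - ?kY z b)"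
      by (rule HS_cong) (simp only: lkern_sum)
    then show "HS l (\<lambda>z b. ?pY z b - ?kY z b) \<le> 1 / 12" using err[OF xl(2) m_pos] by simp
  qed
  let ?c = "3 / (2 * real (m l))"
  have n2: "2 * mix_const * t l + 1 \<le> n" using n by simp
  have pb: "?pX z b \<le> ?c" "?pY z b \<le> ?c" if "z < m l" for z b
    using kern_le_mix[OF xl(1) that n2] kern_le_mix[OF xl(2) that n2] by auto
  have "1 / (4 * real (m l)) \<le> 1 / (2 * m l) - (?c * (1 / 12) + ?c * (1 / 12))" by (simp add: field_simps)
  also have "\<dots> \<le> IP l ?pX ?pY - (?c * HS l (\<lambda>z b. ?pX z b - ?kX z b) + ?c * HS l (\<lambda>z b. ?pY z b - ?kY z b))"
  proof -
    have "IP l ?pX ?pY = kern l (n + n) ?y bx ?x bx" using kern_eq_IP[OF xl(1)] by simp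
    moreover have "mix_const * t l \<le> n" using n by simp
    ultimately have "- (IP l ?pX ?pY - 1 / m l) \<le> 1 / (2 * m l)"
      using abs_le_D2[OF kern_mix[OF xl(2,1), of n bx]] by simp
    moreover have "1 / real (m l) = 1 / (2 * m l) + 1 / (2 * m l)" by simp
    ultimately have "1 / (2 * m l) \<le> IP l ?pX ?pY" by linarith
    moreover have "?c * HS l (\<lambda>z b. ?pX z b - ?kX z b) \<le> ?c * (1/12)" by (rule mult_left_mono[OF HSX]) simp
    moreover have "?c * HS l (\<lambda>z b. ?pY z b - ?kY z b) \<le> ?c * (1/12)" by (rule mult_left_mono[OF HSY]) simp
    ultimately show ?thesis by linarith
  qed
  also have "\<dots> = HS l (\<lambda>z b. ?pX z b * ?pY z b - (?c * (?pX z b - ?kX z b) + ?c * (?pY z b - ?kY z b)))"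
    unfolding IP_def HS_diff HS_add HS_cmult by simp
  also have "\<dots> \<le> HS l (\<lambda>z b. ?kX z b * ?kY z b)"
  proof (rule HS_mono)
    fix z b assume z: "z < m l"
    have "(?pX z b - ?kX z b) * ?pY z b \<le> (?pX z b - ?kX z b) * ?c"
      by (rule mult_left_mono) (use pb[OF z] eX[OF z] in auto)
    moreover have "(?pY z b - ?kY z b) * ?kX z b \<le> (?pY z b - ?kY z b) * ?c"
      by (rule mult_left_mono) (use pb[OF z, of b] eX[OF z, of b] eY[OF z, of b] in auto)
    ultimately show "?pX z b * ?pY z b - (?c * (?pX z b - ?kX z b) + ?c * (?pY z b - ?kY z b)) \<le> ?kX z b * ?kY z b"
      by (simp add: algebra_simps)
  qed
  finally have main: "1 / (4 * real (m l)) \<le> HS l (\<lambda>z b. ?kX z b * ?kY z b)" .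
  let ?d = "1 / real (D ^ j1) / D"
  have low: "?d * ?kX z b \<le> kern M n X bx (z + m l * ?BY) b" "?d * ?kY z b \<le> kern M n Y bx (z + m l * ?BY) b" if z: "z < m l" for z b
  proof -
    have *: "?d * (\<Sum>i\<in>{j0..j1}. lkern l w bx n i z b) \<le> (\<Sum>i\<le>2 * n. weight M l B0 i ?BY * lkern l w bx n i z b) / D"
      if "\<And>i. i \<in> {j0..j1} \<Longrightarrow> 1 / D ^ j1 \<le> weight M l B0 i ?BY" for B0 w
    proof -
      have "1 / D ^ j1 * (\<Sum>i\<in>{j0..j1}. lkern l w bx n i z b) = (\<Sum>i\<in>{..2 * n} \<inter> {j0..j1}. 1 / D ^ j1 * lkern l w bx n i z b)"
        unfolding sum_distrib_left by (rule sum.mono_neutral_right) (auto simp: lkern_zero)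
      also have "\<dots> \<le> (\<Sum>i\<in>{..2 * n} \<inter> {j0..j1}. weight M l B0 i ?BY * lkern l w bx n i z b)"
        by (intro sum_mono mult_right_mono lkern_nonneg z) (use that in auto)
      also have "\<dots> \<le> (\<Sum>i\<le>2 * n. weight M l B0 i ?BY * lkern l w bx n i z b)"
        by (rule sum_mono2) (auto intro!: mult_nonneg_nonneg weight_nonneg lkern_nonneg z)
      finally show ?thesis using divide_right_mono[of _ _ "real D"] by fastforce
    qed
    show "?d * ?kX z b \<le> kern M n X bx (z + m l * ?BY) b"
      by (rule order_trans[OF *[of "X div m l" ?x] kern_ge_labels[OF lM X z inM[OF z]]]) (use W in auto)
    show "?d * ?kY z b \<le> kern M n Y bx (z + m l * ?BY) b"
      by (rule order_trans[OF *[of ?BY ?y] kern_ge_labels[OF lM Y z inM[OF z]]]) (use W in auto)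
  qed
  have d0: "0 \<le> ?d" by simp
  have "1 / (4 * real (D ^ (2 * j1 + 2)) * m l) = (?d * ?d) * (1 / (4 * real (m l)))"
    by (simp add: power_add mult_2 power2_eq_square)
  also have "\<dots> \<le> (?d * ?d) * HS l (\<lambda>z b. ?kX z b * ?kY z b)" by (rule mult_left_mono[OF main]) simp
  also have "\<dots> = HS l (\<lambda>z b. (?d * ?kX z b) * (?d * ?kY z b))"
    unfolding HS_cmult[symmetric] by (rule HS_cong) (simp add: algebra_simps)
  also have "\<dots> \<le> HS l (\<lambda>z b. kern M n X bx (z + m l * ?BY) b * kern M n Y bx (z + m l * ?BY) b)"
    by (intro HS_mono mult_mono low mult_nonneg_nonneg d0 eX eY kern_nonneg inM)
  \<comment> \<open>The Chapman-Kolmogorov sum runs over all blocks; only the block of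
    \<open>Y\<close> is kept.\<close>
  also have "\<dots> \<le> (\<Sum>B<m M div m l. HS l (\<lambda>z b. kern M n X bx (z + m l * B) b * kern M n Y bx (z + m l * B) b))"
  proof (rule member_le_sum)
    fix B assume "B \<in> {..<m M div m l} - {?BY}"
    then have "m l * (B + 1) \<le> m l * (m M div m l)" by (intro mult_le_mono) auto
    then have "z + m l * B < m M" if "z < m l" for z using that m_dvd[OF lM] by simp
    then show "0 \<le> HS l (\<lambda>z b. kern M n X bx (z + m l * B) b * kern M n Y bx (z + m l * B) b)"
      by (intro HS_nonneg mult_nonneg_nonneg kern_nonneg) auto
  qed (use BY in auto)
  also have "\<dots> = IP M (kern M n X bx) (kern M n Y bx)"
    unfolding IP_def HS_blocks[OF lM] ..
  also have "\<dots> = kern M (n + n) Y bx X bx" by (rule kern_eq_IP[symmetric]) fact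
  also have "\<dots> = kern M (n + n) X bx Y bx" by (rule kern_sym) fact+
  finally show ?thesis .
qed

section \<open>The graphs and their distance\<close>

definition Cw :: "nat \<Rightarrow> bool \<Rightarrow> nat set" where
  "Cw e b = {e'. e' = e \<or> (\<exists>k. isQ k e b \<and> (\<exists>d<N k. e' = upd k d e))}"
text \<open>The least edge of the class names the vertex, and the parity of the number records the
  side of the bipartition.\<close>

definition vert :: "nat \<Rightarrow> bool \<Rightarrow> nat" where
  "vert e b = 2 * (LEAST e'. e' \<in> Cw e b) + (if b then 1 else 0)"
definition ES :: "nat set \<Rightarrow> (nat \<times> nat) set" where
  "ES S = {(vert e b, vert e (\<not> b)) | e b. e \<in> S}"
definition XS :: "nat set \<Rightarrow> nat set" where "XS S = {vert e b | e b. e \<in> S}"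

lemma Cw_Cl: obtains k where "\<And>M. k < M \<Longrightarrow> Cw e b = Cl M e b"
proof (cases "\<exists>k. isQ k e b")
  case True
  then obtain k where k: "isQ k e b" by blast
  have "Cw e b = Cl M e b" if "k < M" for M
    unfolding Cw_def Cl_def using k that isQ_unique by blast
  then show ?thesis using that by blast
next
  case False
  then have "Cw e b = Cl M e b" for M unfolding Cw_def Cl_def by blast
  then show ?thesis using that by blast
qed

lemma Cw_refl[simp]: "e \<in> Cw e b" by (simp add: Cw_def)
lemma Cw_finite[simp]: "finite (Cw e b)" by (metis Cw_Cl Cl_finite lessI)
lemma Cw_eq: "e' \<in> Cw e b \<Longrightarrow> Cw e' b = Cw e b"
proof -
  assume *: "e' \<in> Cw e b"
  obtain k k' where k: "\<And>M. k < M \<Longrightarrow> Cw e b = Cl M e b" "\<And>M. k' < M \<Longrightarrow> Cw e' b = Cl M e' b"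
    using Cw_Cl by metis
  have "Cw e b = Cl (Suc (max k k')) e b" "Cw e' b = Cl (Suc (max k k')) e' b" by (rule k, simp)+
  then show ?thesis using * Cl_eq by simp
qed

text \<open>Edges below \<open>m M\<close> have zero digits from position \<open>M\<close> on, so
  gluing at level \<open>M\<close> or higher either leaves this range or changes nothing.\<close>

lemma Cl_eq_Cw: assumes "e < m M" shows "Cl M e b = Cw e b \<inter> {..<m M}"
proof (intro set_eqI iffI)
  fix e' assume "e' \<in> Cl M e b"
  then show "e' \<in> Cw e b \<inter> {..<m M}" using Cl_lt[OF assms] by (auto simp: Cl_def Cw_def)
next
  fix e' assume e': "e' \<in> Cw e b \<inter> {..<m M}"
  show "e' \<in> Cl M e b"
  proof (cases "e' = e")
    case False
    then obtain k d where k: "isQ k e b" "d < N k" "e' = upd k d e" using e' by (auto simp: Cw_def)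
    have "k < M"
    proof (rule ccontr)
      assume "\<not> k < M"
      then have "digit k e' = 0" "digit k e = 0" using digit_ge e' assms by auto
      then have "d = digit k e" using k digit_upd[of d k k e] by simp
      then show False using False k upd_same by simp
    qed
    then show ?thesis using k by (auto simp: Cl_def)
  qed simp
qed

lemma vert_eq: "vert e b = vert e' b' \<longleftrightarrow> b = b' \<and> e' \<in> Cw e b"
proof
  assume v: "vert e b = vert e' b'"
  have "odd (vert e b) = b" "odd (vert e' b') = b'" by (auto simp: vert_def)
  then have b: "b = b'" using v by metis
  have "(LEAST i. i \<in> Cw e b) = (LEAST i. i \<in> Cw e' b)" using v b by (simp add: vert_def)
  moreover have "(LEAST i. i \<in> Cw e b) \<in> Cw e b" "(LEAST i. i \<in> Cw e' b) \<in> Cw e' b"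
    by (rule LeastI[of _ e] LeastI[of _ e'], simp)+
  ultimately have "Cw e b = Cw e' b" using Cw_eq by metis
  then show "b = b' \<and> e' \<in> Cw e b" using b by simp
next
  assume "b = b' \<and> e' \<in> Cw e b"
  then show "vert e b = vert e' b'" using Cw_eq by (auto simp: vert_def)
qed

lemma vert_eq_Cl: "e < m M \<Longrightarrow> e' < m M \<Longrightarrow> vert e b = vert e' b' \<longleftrightarrow> b = b' \<and> e' \<in> Cl M e b"
  by (auto simp: vert_eq Cl_eq_Cw)

lemma sym_ES: "sym (ES S)" unfolding ES_def sym_def by fastforce
lemma ES_mono: "S \<subseteq> T \<Longrightarrow> ES S \<subseteq> ES T" unfolding ES_def by blast
lemma ES_XS: "ES S \<subseteq> XS S \<times> XS S" unfolding ES_def XS_def by blast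
lemma irrefl_ES: "irrefl (ES S)" unfolding ES_def irrefl_def by (auto simp: vert_eq)

lemma nbrs: "ES S `` {vert e b} = (\<lambda>e'. vert e' (\<not> b)) ` (Cw e b \<inter> S)"
proof (intro set_eqI iffI)
  fix y assume "y \<in> ES S `` {vert e b}"
  then obtain e' b' where "e' \<in> S" "vert e b = vert e' b'" "y = vert e' (\<not> b')" by (auto simp: ES_def)
  then show "y \<in> (\<lambda>e'. vert e' (\<not> b)) ` (Cw e b \<inter> S)" by (auto simp: vert_eq)
next
  fix y assume "y \<in> (\<lambda>e'. vert e' (\<not> b)) ` (Cw e b \<inter> S)"
  then obtain e' where e': "e' \<in> S" "e' \<in> Cw e b" "y = vert e' (\<not> b)" by auto
  then have "vert e b = vert e' b" by (simp add: vert_eq)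
  then show "y \<in> ES S `` {vert e b}" using e' by (auto simp: ES_def)
qed

text \<open>Two edges with both endpoints in common would differ in one digit only, at the gluing
  level of one end and also at that of the other; these levels are different. So there are no
  multiple edges, and the degree is the size of the class.\<close>

lemma nbr_inj: "inj_on (\<lambda>e'. vert e' (\<not> b)) (Cw e b)"
proof (rule inj_onI)
  fix x y assume xy: "x \<in> Cw e b" "y \<in> Cw e b" and v: "vert x (\<not> b) = vert y (\<not> b)"
  have "y \<in> Cw x b" "y \<in> Cw x (\<not> b)" using xy v Cw_eq vert_eq by auto
  show "x = y"
  proof (rule ccontr)
    assume ne: "x \<noteq> y"
    from \<open>y \<in> Cw x b\<close> ne obtain k d where k: "isQ k x b" "d < N k" "y = upd k d x" by (auto simp: Cw_def)
    from \<open>y \<in> Cw x (\<not> b)\<close> ne obtain k' d' where k': "isQ k' x (\<not> b)" "d' < N k'" "y = upd k' d' x" by (auto simp: Cw_def)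
    have "k \<noteq> k'"
    proof
      assume "k = k'"
      then show False using k k' by (cases k) (auto simp: isP_def)
    qed
    have "digit j y = digit j x" for j
      using digit_upd[OF k(2), of j x] digit_upd[OF k'(2), of j x] k(3) k'(3) \<open>k \<noteq> k'\<close> by (cases "j = k") auto
    then show False using ne digits_ext by metis
  qed
qed

section \<open>Finite block graphs and their diameters\<close>

definition EE :: "nat \<Rightarrow> (nat \<times> nat) set" where "EE M = ES {..<m M}"
definition XX :: "nat \<Rightarrow> nat set" where "XX M = XS {..<m M}"

lemma nbrs_M: "e < m M \<Longrightarrow> EE M `` {vert e b} = (\<lambda>e'. vert e' (\<not> b)) ` Cl M e b"
  unfolding EE_def nbrs by (simp add: Cl_eq_Cw)
lemma nbr_inj_M: "e < m M \<Longrightarrow> inj_on (\<lambda>e'. vert e' (\<not> b)) (Cl M e b)"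
  by (rule inj_on_subset[OF nbr_inj[of b e]]) (simp add: Cl_eq_Cw)
lemma deg_M: "e < m M \<Longrightarrow> deg (EE M) (vert e b) = card (Cl M e b)"
  unfolding deg_def nbrs_M by (rule card_image) (rule nbr_inj_M)

text \<open>Half of the length leads to the common Q-end of the copies, the other half from there to
  the end of the block. Any vertex of the fibre may be prescribed as the target, which keeps the
  diameter at \<open>2 * 2 ^ k\<close> although the fibre has many vertices.\<close>

lemma block_dist:
  assumes "\<And>z. z < m k \<Longrightarrow> z + m k * B \<in> S" "z < m k" "z' < m k" "isE k c z' b'"
  shows "\<exists>n\<le>2 ^ k. (vert (z + m k * B) b, vert (z' + m k * B) b') \<in> ES S ^^ n"
  using assms
proof (induction k arbitrary: B z z' b b' c)
  case 0
  then have zz: "z = 0" "z' = 0" and B: "B \<in> S" using "0.prems"(1)[of 0] by auto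
  show ?case
  proof (cases "b = b'")
    case True then show ?thesis using zz by (intro exI[of _ 0]) simp
  next
    case False
    then have "b' = (\<not> b)" by auto
    then have "(vert B b, vert B b') \<in> ES S" using B unfolding ES_def by blast
    then show ?thesis using zz by (intro exI[of _ 1]) simp
  qed
next
  case (Suc k)
  obtain z0 d0 where z: "z = z0 + m k * d0" "z0 < m k" "d0 < N k" using lt_m_Suc_decomp[OF Suc.prems(2)] by blast
  obtain z1 d1 where z': "z' = z1 + m k * d1" "z1 < m k" "d1 < N k" using lt_m_Suc_decomp[OF Suc.prems(3)] by blast
  have P1: "isE k False z1 b'"
    using Suc.prems(4) unfolding z' by (auto simp: isE_def isP_Suc isP_glue split: if_splits)
  let ?q = "zr k True" and ?bq = "bz k True"
  have q: "?q < m k" "isE k True ?q ?bq" using zr_lt isE_zr by auto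
  have inS: "w + m k * (d + N k * B) \<in> S" if "w < m k" "d < N k" for w d
    using Suc.prems(1)[OF glue_lt[OF that]] by (simp add: m_Suc algebra_simps)
  have e: "z + m (Suc k) * B = z0 + m k * (d0 + N k * B)" "z' + m (Suc k) * B = z1 + m k * (d1 + N k * B)"
    by (simp_all add: z z' m_Suc algebra_simps)
  obtain n0 where n0: "n0 \<le> 2 ^ k" "(vert (z0 + m k * (d0 + N k * B)) b, vert (?q + m k * (d0 + N k * B)) ?bq) \<in> ES S ^^ n0"
    using Suc.IH[of "d0 + N k * B" z0 ?q True ?bq b, OF inS[OF _ z(3)] z(2) q] by blast
  obtain n1 where n1: "n1 \<le> 2 ^ k" "(vert (?q + m k * (d1 + N k * B)) ?bq, vert (z1 + m k * (d1 + N k * B)) b') \<in> ES S ^^ n1"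
    using Suc.IH[of "d1 + N k * B" ?q z1 False b' ?bq, OF inS[OF _ z'(3)] q(1) z'(2) P1] by blast
  have "vert (?q + m k * (d0 + N k * B)) ?bq = vert (?q + m k * (d1 + N k * B)) ?bq"
  proof -
    have Q: "isQ k (?q + m k * (d0 + N k * B)) ?bq" using q(2) isQ_glue[of k k ?q "d0 + N k * B" ?bq] by (simp add: isE_def)
    have "upd k d1 (?q + m k * (d0 + N k * B)) = ?q + m k * (d1 + N k * B)"
    proof -
      have "(?q + m k * (d0 + N k * B)) div m (Suc k) = B"
        using q(1) z(3) by (simp add: m_Suc div_mult2_eq)
      then show ?thesis using q(1) by (simp add: upd_def)
    qed
    note u = this
    show ?thesis unfolding vert_eq Cw_def mem_Collect_eq
      by (intro conjI refl disjI2 exI[of _ k] exI[of _ d1]) (use Q z'(3) u in simp_all)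
  qed
  then have "(vert (z0 + m k * (d0 + N k * B)) b, vert (z1 + m k * (d1 + N k * B)) b') \<in> ES S ^^ (n0 + n1)"
    unfolding relpow_add using n0(2) n1(2) by (intro relcompI) simp_all
  then show ?case unfolding e using n0 n1 by (intro exI[of _ "n0 + n1"]) auto
qed

lemma block_in: "l \<le> M \<Longrightarrow> Y < m M \<Longrightarrow> z < m l \<Longrightarrow> z + m l * (Y div m l) < m M"
proof -
  assume lM: "l \<le> M" and Y: "Y < m M" and z: "z < m l"
  have "Y < (m M div m l) * m l" using Y m_dvd[OF lM] by simp
  from less_mult_imp_div_less[OF this] have "m l * (Y div m l + 1) \<le> m l * (m M div m l)"
    by (intro mult_le_mono) auto
  then show ?thesis using z m_dvd[OF lM] by simp
qed

lemma relpow_sym: "sym E \<Longrightarrow> (x, y) \<in> E ^^ n \<Longrightarrow> (y, x) \<in> E ^^ n"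
proof (induction n arbitrary: x y)
  case (Suc n)
  then obtain w where "(x, w) \<in> E ^^ n" "(w, y) \<in> E" by auto
  then have "(y, w) \<in> E" "(w, x) \<in> E ^^ n" using Suc symD by metis+
  then show ?case by (rule relpow_Suc_I2)
qed simp

definition ds :: "nat \<Rightarrow> nat \<Rightarrow> bool \<Rightarrow> nat \<Rightarrow> bool \<Rightarrow> nat" where
  "ds M X bX Y bY = graph_dist (EE M) (vert X bX) (vert Y bY)"

lemma graph_dist_le: "(x, y) \<in> E ^^ n \<Longrightarrow> graph_dist E x y \<le> n"
  unfolding graph_dist_def by (rule Least_le)
lemma graph_dist_path: "(x, y) \<in> E ^^ n \<Longrightarrow> (x, y) \<in> E ^^ graph_dist E x y"
  unfolding graph_dist_def by (rule LeastI)

lemma block_dist_M: assumes "l \<le> M" "Y < m M" "z < m l" "isE l c z b'"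
  shows "\<exists>n\<le>2 ^ l. (vert Y b, vert (z + m l * (Y div m l)) b') \<in> EE M ^^ n"
  using block_dist[of l "Y div m l" "{..<m M}" "Y mod m l" z c b' b] assms block_in[OF assms(1,2)] m_pos[of l]
  by (simp add: EE_def)

lemma block_diam_M: assumes "l \<le> M" "Y < m M" "Y' < m M" "Y div m l = Y' div m l"
  shows "\<exists>n\<le>2 * 2 ^ l. (vert Y b, vert Y' b') \<in> EE M ^^ n"
proof -
  let ?p = "vert (zr l False + m l * (Y div m l)) (bz l False)"
  have E: "isE l False (zr l False) (bz l False)" by (rule isE_zr)
  obtain n0 where n0: "n0 \<le> 2 ^ l" "(vert Y b, ?p) \<in> EE M ^^ n0"
    using block_dist_M[OF assms(1,2) zr_lt E, of b] by blast
  obtain n1 where n1: "n1 \<le> 2 ^ l" "(vert Y' b', ?p) \<in> EE M ^^ n1"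
    using block_dist_M[OF assms(1,3) zr_lt E, of b'] unfolding assms(4) by blast
  have "(?p, vert Y' b') \<in> EE M ^^ n1" using n1(2) unfolding EE_def by (rule relpow_sym[OF sym_ES])
  then have "(vert Y b, vert Y' b') \<in> EE M ^^ (n0 + n1)" unfolding relpow_add using n0(2) by (rule relcompI[rotated])
  moreover have "n0 + n1 \<le> 2 * 2 ^ l" using n0(1) n1(1) by simp
  ultimately show ?thesis by blast
qed

lemma connected_M: assumes "Y < m M" "Y' < m M"
  shows "\<exists>n\<le>2 * 2 ^ M. (vert Y b, vert Y' b') \<in> EE M ^^ n"
  by (rule block_diam_M[of M]) (use assms in auto)

lemma ds_path: "X < m M \<Longrightarrow> Y < m M \<Longrightarrow> (vert X bX, vert Y bY) \<in> EE M ^^ ds M X bX Y bY"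
proof -
  assume "X < m M" "Y < m M"
  then obtain n where "(vert X bX, vert Y bY) \<in> EE M ^^ n" using connected_M[of X M Y bX bY] by blast
  then show ?thesis unfolding ds_def by (rule graph_dist_path)
qed
lemma ds_le: "(vert X bX, vert Y bY) \<in> EE M ^^ n \<Longrightarrow> ds M X bX Y bY \<le> n"
  unfolding ds_def by (rule graph_dist_le)
lemma ds_tri: "X < m M \<Longrightarrow> Y < m M \<Longrightarrow> (vert Y bY, vert Z bZ) \<in> EE M ^^ n \<Longrightarrow> ds M X bX Z bZ \<le> ds M X bX Y bY + n"
proof -
  assume *: "X < m M" "Y < m M" "(vert Y bY, vert Z bZ) \<in> EE M ^^ n"
  have "(vert X bX, vert Z bZ) \<in> EE M ^^ (ds M X bX Y bY + n)"
    unfolding relpow_add using ds_path[OF *(1,2)] *(3) by (rule relcompI)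
  then show ?thesis by (rule ds_le)
qed
lemma ds_diam: "X < m M \<Longrightarrow> Y < m M \<Longrightarrow> ds M X bX Y bY \<le> 2 * 2 ^ M"
proof -
  assume "X < m M" "Y < m M"
  then obtain n where "n \<le> 2 * 2 ^ M" "(vert X bX, vert Y bY) \<in> EE M ^^ n" using connected_M[of X M Y bX bY] by blast
  then show ?thesis using ds_le[of X bX Y bY n M] by linarith
qed
lemma ds_sym: "X < m M \<Longrightarrow> Y < m M \<Longrightarrow> ds M X bX Y bY = ds M Y bY X bX"
proof -
  have "sym (EE M)" unfolding EE_def by (rule sym_ES)
  note s = relpow_sym[OF this]
  assume "X < m M" "Y < m M"
  then show ?thesis using s[OF ds_path[of X M Y bX bY]] s[OF ds_path[of Y M X bY bX]]
    by (intro le_antisym ds_le)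
qed

text \<open>Following a path from \<open>X\<close>, the label index grows by at most one per \<open>2 ^ l\<close> steps.\<close>

definition reached :: "nat \<Rightarrow> nat \<Rightarrow> nat \<Rightarrow> nat \<Rightarrow> nat \<Rightarrow> bool \<Rightarrow> bool" where
  "reached M l B0 n Y b \<longleftrightarrow> (\<exists>i. i \<noteq> 1 \<and> 1 / D ^ i \<le> weight M l B0 i (Y div m l) \<and>
     (i = 0 \<or> (real i - 3) * 2 ^ l + (if odd i then height l (Y mod m l) b else 2 ^ l - height l (Y mod m l) b) \<le> n))"

text \<open>Passing to a glued block costs a factor \<open>1 / D\<close>, and the label rises by one
  if the end is opposite to the last one. The cost in \<open>reached\<close> is continuous there
  because \<open>height\<close> runs from 0 to \<open>2 ^ l\<close>. The shift by 3 makes the first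
  end free: from label 0 to label 2 at a Q-end, and to label 3 at a P-end. Label 1 is skipped, since
  the weights form a chain of averages only from 2 on.\<close>

lemma reached_class: assumes r: "reached M l B0 n Y b" and Y': "Y' \<in> Cl M Y b" and lM: "l \<le> M"
  shows "reached M l B0 n Y' b"
proof -
  let ?z = "Y mod m l" and ?B = "Y div m l" and ?B' = "Y' div m l"
  obtain i where i: "i \<noteq> 1" "1 / D ^ i \<le> weight M l B0 i ?B"
      "i = 0 \<or> (real i - 3) * 2 ^ l + (if odd i then height l ?z b else 2 ^ l - height l ?z b) \<le> n"
    using r by (auto simp: reached_def)
  have z: "?z < m l" using m_pos by simp
  show ?thesis
  proof (cases rule: end_cases[of l ?z b])
    case 2
    then have "Y' \<in> (\<lambda>z. z + m l * ?B) ` Cl l ?z b" using Cl_low[of l Y b M] Y' lM by simp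
    then obtain z' where z': "z' \<in> Cl l ?z b" "Y' = z' + m l * ?B" by auto
    have "z' < m l" using Cl_lt z' z by blast
    then have "Y' mod m l = z'" "?B' = ?B" using z' by auto
    note md = this
    have lfe: "height l z' b = height l ?z b" by (rule consD[OF cons_height z z'(1)])
    show ?thesis using r unfolding reached_def md lfe .
  next
    case (1 c)
    have "Y' \<in> (\<lambda>B'. ?z + m l * B') ` CB M l c ?B" using Cl_end[OF 1 z, of M ?B] Y' by simp
    then obtain B' where B': "B' \<in> CB M l c ?B" "Y' = ?z + m l * B'" by auto
    have md: "Y' mod m l = ?z" "?B' = B'" using B' z by auto
    have BB: "CB M l c B' = CB M l c ?B" by (rule CB_eq[OF B'(1)])
    have Bin: "?B \<in> CB M l c B'" unfolding BB by simp
    have lfz: "height l ?z b = (if c then 2 ^ l else 0)" using 1 height_P[of l ?z b] height_Q[of l ?z b] by (auto simp: isE_def split: if_splits)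
    consider "i = 0" "c" | "i = 0" "\<not> c" | "i \<ge> 2" "even i = c" | "i \<ge> 2" "even i \<noteq> c" using i(1) by linarith
    then show ?thesis
    proof cases
      case 1
      then have "?B = B0" using i(2) by (auto split: if_splits)
      then have "1 / D ^ 2 \<le> weight M l B0 2 B'" using weight_2_own[of B0 M l B'] Bin 1 by simp
      moreover have "- (2 ^ l) \<le> real n" by (rule order_trans[of _ 0]) simp_all
      ultimately show ?thesis unfolding reached_def md lfz using 1 by (intro exI[of _ 2]) simp
    next
      case 2
      then have "?B = B0" using i(2) by (auto split: if_splits)
      then have "1 / D ^ 2 \<le> weight M l B0 2 ?B" using weight_2_own[of B0 M l ?B] by simp
      then have "1 / D ^ 2 / D \<le> weight M l B0 2 ?B / D" by (rule divide_right_mono) simp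
      also have "\<dots> \<le> av (CB M l False B') (weight M l B0 2)"
        by (rule av_ge_other) (use Bin 2 weight_nonneg in auto)
      also have "\<dots> = weight M l B0 3 B'" using weight_Suc[of 2 M l B0 B'] by (simp add: eval_nat_numeral)
      finally have "1 / D ^ 3 \<le> weight M l B0 3 B'" by (simp add: eval_nat_numeral)
      then show ?thesis unfolding reached_def md lfz using 2 by (intro exI[of _ 3]) simp
    next
      case 3
      have "weight M l B0 i B' = weight M l B0 i ?B"
        using weight_own[of i c M l B' B0] weight_own[of i c M l ?B B0] 3 BB by simp
      then show ?thesis unfolding reached_def md by (intro exI[of _ i]) (use i in simp)
    next
      case 4
      have "1 / D ^ i / D \<le> weight M l B0 i ?B / D" by (rule divide_right_mono) (use i in auto)
      also have "\<dots> \<le> av (CB M l c B') (weight M l B0 i)"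
        by (rule av_ge_other) (use Bin weight_nonneg in auto)
      also have "\<dots> = weight M l B0 (Suc i) B'" using weight_Suc[of i M l B0 B'] 4 by simp
      finally have w: "1 / D ^ Suc i \<le> weight M l B0 (Suc i) B'" by (simp add: mult.commute)
      have "(real (Suc i) - 3) * 2 ^ l + (if odd (Suc i) then height l ?z b else 2 ^ l - height l ?z b) \<le> n"
        using i(3) 4 lfz by (auto simp: algebra_simps split: if_splits)
      then show ?thesis unfolding reached_def md using w by (intro exI[of _ "Suc i"]) (use 4 in auto)
    qed
  qed
qed

lemma reached_flip: assumes "reached M l B0 n Y b" shows "reached M l B0 (Suc n) Y (\<not> b)"
proof -
  obtain i where i: "i \<noteq> 1" "1 / D ^ i \<le> weight M l B0 i (Y div m l)"
      "i = 0 \<or> (real i - 3) * 2 ^ l + (if odd i then height l (Y mod m l) b else 2 ^ l - height l (Y mod m l) b) \<le> n"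
    using assms by (auto simp: reached_def)
  have "i = 0 \<or> (real i - 3) * 2 ^ l + (if odd i then height l (Y mod m l) (\<not> b) else 2 ^ l - height l (Y mod m l) (\<not> b)) \<le> Suc n"
    using i(3) height_lip[of l "Y mod m l" b "\<not> b"] by (auto split: if_splits)
  then show ?thesis unfolding reached_def using i by blast
qed

lemma reached_path: assumes lM: "l \<le> M" and X: "X < m M"
  shows "Y < m M \<Longrightarrow> (vert X bX, vert Y bY) \<in> EE M ^^ n \<Longrightarrow> reached M l (X div m l) n Y bY"
proof (induction n arbitrary: Y bY)
  case 0
  then have "bY = bX" "Y \<in> Cl M X bX" using vert_eq_Cl[OF X, of Y bX bY] by auto
  moreover have "reached M l (X div m l) 0 X bX" unfolding reached_def by (intro exI[of _ 0]) simp
  ultimately show ?case using reached_class lM by blast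
next
  case (Suc n)
  obtain v where v: "(vert X bX, v) \<in> EE M ^^ n" "(v, vert Y bY) \<in> EE M" using Suc.prems(2) by auto
  then obtain e b where e: "e < m M" "v = vert e b" "vert Y bY = vert e (\<not> b)" by (auto simp: EE_def ES_def)
  have "reached M l (X div m l) n e b" using Suc.IH e v by blast
  then have "reached M l (X div m l) (Suc n) e (\<not> b)" by (rule reached_flip)
  moreover have "bY = (\<not> b)" "Y \<in> Cl M e (\<not> b)" using vert_eq_Cl[OF e(1) Suc.prems(1), of "\<not> b" bY] e(3) by auto
  ultimately show ?case using reached_class lM by blast
qed

text \<open>A path of this length produces some label \<open>i \<le> j\<close> with weight at least
  \<open>1 / D ^ i\<close>, and each further label loses at most a factor \<open>D\<close>.\<close>

lemma reach: assumes lM: "l \<le> M" and X: "X < m M" and Y: "Y < m M"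
    and p: "(vert X bX, vert Y bY) \<in> EE M ^^ n" and j: "2 \<le> j" "real n < (real j - 2) * 2 ^ l"
  shows "1 / D ^ j \<le> weight M l (X div m l) j (Y div m l)"
proof -
  obtain i where i: "i \<noteq> 1" "1 / D ^ i \<le> weight M l (X div m l) i (Y div m l)"
      "i = 0 \<or> (real i - 3) * 2 ^ l + (if odd i then height l (Y mod m l) bY else 2 ^ l - height l (Y mod m l) bY) \<le> n"
    using reached_path[OF lM X Y p] by (auto simp: reached_def)
  show ?thesis
  proof (cases "i = 0")
    case True
    then have "Y div m l = X div m l" using i(2) by (auto split: if_splits)
    then have "1 / D ^ 2 \<le> weight M l (X div m l) 2 (Y div m l)" by (intro weight_2_own) simp
    then show ?thesis using weight_step_ge[OF order_refl] j by blast
  next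
    case False
    have "(real i - 3) * 2 ^ l \<le> n" using i(3) False height_bounds[of l "Y mod m l" bY] by (auto split: if_splits)
    then have "(real i - 3) * 2 ^ l < (real j - 2) * 2 ^ l" using j by linarith
    then have "real i - 3 < real j - 2" by (simp add: mult_less_cancel_right)
    then have "i \<le> j" by linarith
    then show ?thesis using weight_step_ge[OF _ i(2), of j] i(1) False by linarith
  qed
qed

section \<open>Volumes of balls\<close>

lemma CB_lt: assumes "l \<le> M" "B < m M div m l" "B' \<in> CB M l c B" shows "B' < m M div m l"
proof -
  have d: "m l * (m M div m l) = m M" using m_dvd[OF assms(1)] by simp
  have "m l * (B + 1) \<le> m l * (m M div m l)" using assms(2) by (intro mult_le_mono) auto
  then have lt: "zr l c + m l * B < m M" using zr_lt[of l c] d by simp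
  obtain e' where e': "e' \<in> Cl M (zr l c + m l * B) (bz l c)" "B' = e' div m l" using assms(3) by (auto simp: CB_def)
  then have "e' < (m M div m l) * m l" using Cl_lt[OF lt] d by (simp add: mult.commute)
  then show ?thesis using e' less_mult_imp_div_less by blast
qed

lemma sum_weight: assumes "l \<le> M" shows "(\<Sum>B<m M div m l. weight M l B0 j B) \<le> 1"
proof -
  have s: "(\<Sum>B<m M div m l. av (CB M l c B) h) = (\<Sum>B<m M div m l. h B)" for c h
    by (rule sum_av_classes) (use CB_lt[OF assms] CB_eq in auto)
  have 0: "(\<Sum>B<m M div m l. if B = B0 then 1 else 0::real) \<le> 1"
    by (subst sum.delta) auto
  show ?thesis
  proof (cases "j \<ge> 2")
    case False
    then consider "j = 0" | "j = Suc 0" by linarith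
    then show ?thesis using 0 by cases (simp_all add: s)
  next
    case True
    then show ?thesis
    proof (induction j rule: dec_induct)
      case base
      have "(\<Sum>B<m M div m l. weight M l B0 2 B) = (\<Sum>B<m M div m l. if B = B0 then 1 else 0::real) / D"
        by (simp add: numeral_2_eq_2 sum_divide_distrib[symmetric] s)
      also have "\<dots> \<le> 1 / D" by (rule divide_right_mono[OF 0]) simp
      also have "\<dots> \<le> 1" using D_ge2 by simp
      finally show ?case .
    next
      case (step j) then show ?case by (simp add: weight_Suc s)
    qed
  qed
qed

text \<open>Averages over classes preserve sums, so the total weight is at most one and leaves room
  for at most \<open>D ^ j\<close> blocks of weight \<open>1 / D ^ j\<close>.\<close>

lemma near_blocks: assumes lM: "l \<le> M" and X: "X < m M"
  shows "card {B. B < m M div m l \<and> 1 / D ^ j \<le> weight M l (X div m l) j B} \<le> D ^ j"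
proof -
  let ?S = "{B. B < m M div m l \<and> 1 / D ^ j \<le> weight M l (X div m l) j B}"
  have "real (card ?S) * (1 / D ^ j) = (\<Sum>B\<in>?S. 1 / D ^ j)" by simp
  also have "\<dots> \<le> (\<Sum>B\<in>?S. weight M l (X div m l) j B)" by (rule sum_mono) auto
  also have "\<dots> \<le> (\<Sum>B<m M div m l. weight M l (X div m l) j B)" by (rule sum_mono2) (auto intro: weight_nonneg)
  also have "\<dots> \<le> 1" by (rule sum_weight[OF lM])
  finally have "real (card ?S) \<le> real (D ^ j)" using D_ge2 by (simp add: field_simps)
  then show ?thesis by (simp only: of_nat_le_iff)
qed

definition Vol :: "nat \<Rightarrow> nat \<Rightarrow> bool \<Rightarrow> real \<Rightarrow> real" where
  "Vol M X bX r = HS M (\<lambda>e b. if real (ds M X bX e b) < r then 1 else 0)"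

lemma Vol_le: "Vol M X bX r \<le> 2 * m M"
proof -
  have "Vol M X bX r \<le> HS M (\<lambda>_ _. 1)" unfolding Vol_def by (rule HS_mono) auto
  then show ?thesis by (simp add: HS_const)
qed

text \<open>For \<open>j = 3\<close> the condition in \<open>reach\<close> is exactly distance below
  \<open>2 ^ l\<close>, so the ball meets at most \<open>D ^ 3\<close> blocks.\<close>

lemma Vol_upper: assumes lM: "l \<le> M" and X: "X < m M" and r: "r \<le> 2 ^ l"
  shows "Vol M X bX r \<le> 2 * real (D ^ 3) * m l"
proof -
  let ?S = "{B. B < m M div m l \<and> 1 / D ^ 3 \<le> weight M l (X div m l) 3 B}"
  have "Vol M X bX r = (\<Sum>B<m M div m l. HS l (\<lambda>z b. if real (ds M X bX (z + m l * B) b) < r then 1 else 0))"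
    unfolding Vol_def by (rule HS_blocks[OF lM])
  also have "\<dots> \<le> (\<Sum>B<m M div m l. if B \<in> ?S then 2 * real (m l) else 0)"
  proof (rule sum_mono)
    fix B assume B: "B \<in> {..<m M div m l}"
    show "HS l (\<lambda>z b. if real (ds M X bX (z + m l * B) b) < r then 1 else 0) \<le> (if B \<in> ?S then 2 * real (m l) else 0)"
    proof (cases "B \<in> ?S")
      case True
      have "HS l (\<lambda>z b. if real (ds M X bX (z + m l * B) b) < r then 1 else 0) \<le> HS l (\<lambda>_ _. 1)"
        by (rule HS_mono) auto
      then show ?thesis using True by (simp add: HS_const)
    next
      case False
      have "\<not> real (ds M X bX (z + m l * B) b) < r" if z: "z < m l" for z b
      proof
        assume *: "real (ds M X bX (z + m l * B) b) < r"
        have "m l * (B + 1) \<le> m l * (m M div m l)" using B by (intro mult_le_mono) auto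
        then have Y: "z + m l * B < m M" using z m_dvd[OF lM] by simp
        have "1 / D ^ 3 \<le> weight M l (X div m l) 3 ((z + m l * B) div m l)"
        proof (rule reach[OF lM X Y ds_path[OF X Y, of bX b]])
          have "(real 3 - 2) * 2 ^ l = (2::real) ^ l" by simp
          then show "real (ds M X bX (z + m l * B) b) < (real 3 - 2) * 2 ^ l"
            using less_le_trans[OF * r] by (simp only:)
        qed simp
        then show False using False B z by simp
      qed
      then have "HS l (\<lambda>z b. if real (ds M X bX (z + m l * B) b) < r then 1 else 0) \<le> HS l (\<lambda>_ _. 0)"
        by (intro HS_mono) auto
      then show ?thesis using False by (simp add: HS_const)
    qed
  qed
  also have "\<dots> = (\<Sum>B\<in>{..<m M div m l} \<inter> ?S. 2 * real (m l))"
    by (rule sum.inter_restrict[symmetric]) simp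
  also have "{..<m M div m l} \<inter> ?S = ?S" by auto
  also have "(\<Sum>B\<in>?S. 2 * real (m l)) = card ?S * (2 * real (m l))" by simp
  also have "\<dots> \<le> real (D ^ 3) * (2 * real (m l))"
    using near_blocks[OF lM X, of 3] by (intro mult_right_mono) (auto simp only: of_nat_le_iff)
  finally show ?thesis by simp
qed

lemma Vol_lower: assumes lM: "l \<le> M" and X: "X < m M" and r: "2 * 2 ^ l < r"
  shows "2 * m l \<le> Vol M X bX r"
proof -
  let ?B = "X div m l"
  have "X < (m M div m l) * m l" using X m_dvd[OF lM] by simp
  then have B: "?B < m M div m l" by (rule less_mult_imp_div_less)
  have "2 * real (m l) = HS l (\<lambda>_ _. 1)" by (simp add: HS_const)
  also have "\<dots> \<le> HS l (\<lambda>z b. if real (ds M X bX (z + m l * ?B) b) < r then 1 else 0)"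
  proof (rule HS_mono)
    fix z b assume z: "z < m l"
    obtain n where n: "n \<le> 2 * 2 ^ l" "(vert X bX, vert (z + m l * ?B) b) \<in> EE M ^^ n"
      using block_diam_M[OF lM X block_in[OF lM X z], of bX b] z by auto
    have "real (ds M X bX (z + m l * ?B) b) \<le> real (2 * 2 ^ l)"
      using ds_le[OF n(2)] n(1) by (intro of_nat_mono) linarith
    then show "1 \<le> (if real (ds M X bX (z + m l * ?B) b) < r then 1 else 0 :: real)" using r by simp
  qed
  also have "\<dots> \<le> (\<Sum>B<m M div m l. HS l (\<lambda>z b. if real (ds M X bX (z + m l * B) b) < r then 1 else 0))"
    by (rule member_le_sum) (use B in \<open>auto intro!: HS_nonneg\<close>)
  also have "\<dots> = Vol M X bX r" unfolding Vol_def by (rule HS_blocks[OF lM, symmetric])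
  finally show ?thesis by simp
qed

section \<open>Off-diagonal decay\<close>

text \<open>Interpolation starts from the smaller end value, so inside a block the drift is the
  difference of the end values over \<open>t l\<close>; the ratio of at most two bounds this
  difference by the smaller value, hence by \<open>h\<close>. At an end, a glued block in which the
  value is the larger one contributes smaller neighbours, and any other contributes the drift of
  \<open>pot\<close>, whose value next to its own end is \<open>1 / t l\<close>.\<close>

lemma interpolation_superharmonic:
  fixes al be :: "nat \<Rightarrow> real"
  assumes lM: "l \<le> M"
    and alP: "\<And>B B'. B' \<in> CB M l False B \<Longrightarrow> B < m M div m l \<Longrightarrow> al B' = al B"
    and beQ: "\<And>B B'. B' \<in> CB M l True B \<Longrightarrow> B < m M div m l \<Longrightarrow> be B' = be B"
    and ab: "\<And>B. B < m M div m l \<Longrightarrow> 0 < al B \<and> 0 < be B \<and> al B \<le> 2 * be B \<and> be B \<le> 2 * al B"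
    and h: "\<And>z B b. z < m l \<Longrightarrow> B < m M div m l \<Longrightarrow> h (z + m l * B) b =
        (if al B \<le> be B then al B + (be B - al B) * pot l False z b else be B + (al B - be B) * pot l True z b)"
  shows "cons M h" and "e < m M \<Longrightarrow> walk M h e b \<le> (1 + 1 / t l) * h e b"
proof -
  have t0: "real (t l) > 0" using t_pos by simp
  have dec: "e = e mod m l + m l * (e div m l)" "e mod m l < m l" "e < m M \<Longrightarrow> e div m l < m M div m l" for e
  proof -
    show "e div m l < m M div m l" if "e < m M"
    proof -
      have "e < (m M div m l) * m l" using that m_dvd[OF lM] by simp
      then show ?thesis by (rule less_mult_imp_div_less)
    qed
  qed (use m_pos in auto)
  have hend: "h (z + m l * B) b = (if c then be B else al B)"
    if "isE l c z b" "z < m l" "B < m M div m l" for c z b B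
    using h[OF that(2,3)] pot_end[OF that(1)] by auto
  show "cons M h" unfolding cons_def
  proof (intro allI impI ballI)
    fix e b e' assume e: "e < m M" "e' \<in> Cl M e b"
    let ?z = "e mod m l" and ?B = "e div m l"
    show "h e' b = h e b"
    proof (cases rule: end_cases[of l ?z b])
      case (1 c)
      have "e' \<in> (\<lambda>B'. ?z + m l * B') ` CB M l c ?B" using Cl_end[OF 1 dec(2), of M ?B] e(2) by simp
      then obtain B' where B': "B' \<in> CB M l c ?B" "e' = ?z + m l * B'" by auto
      have B'l: "B' < m M div m l" by (rule CB_lt[OF lM dec(3)[OF e(1)] B'(1)])
      have "(if c then be B' else al B') = (if c then be ?B else al ?B)"
        using B'(1) alP[of B' ?B] beQ[of B' ?B] dec(3)[OF e(1)] by auto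
      then show ?thesis using hend[OF 1 dec(2) B'l] hend[OF 1 dec(2) dec(3)[OF e(1)]] B'(2) by simp
    next
      case 2
      then have "e' \<in> (\<lambda>z. z + m l * ?B) ` Cl l ?z b" using Cl_low[of l e b M] e(2) lM by simp
      then obtain z' where z': "z' \<in> Cl l ?z b" "e' = z' + m l * ?B" by auto
      have zl: "z' < m l" using Cl_lt z'(1) dec(2) by blast
      have "pot l c z' b = pot l c ?z b" for c by (rule consD[OF cons_pot dec(2) z'(1)])
      then show ?thesis using h[OF zl dec(3)[OF e(1)], of b] h[OF dec(2)[of e] dec(3)[OF e(1)], of b] z'(2) by simp
    qed
  qed
  assume e: "e < m M"
  let ?z = "e mod m l" and ?B = "e div m l"
  have Bl: "?B < m M div m l" by (rule dec(3)[OF e])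
  show "walk M h e b \<le> (1 + 1 / t l) * h e b"
  proof (cases rule: end_cases[of l ?z b])
    case (1 c)
    let ?v = "if c then be ?B else al ?B"
    have nbr: "h (?z + m l * B') (\<not> b) \<le> ?v * (1 + 1 / t l)" if B': "B' \<in> CB M l c ?B" for B'
    proof -
      have B'l: "B' < m M div m l" by (rule CB_lt[OF lM Bl B'])
      have v: "(if c then be B' else al B') = ?v"
        using B' alP[of B' ?B] beQ[of B' ?B] Bl by auto
      have nE: "\<not> isE l (\<not> c) ?z b" using 1 isP_not_isQ[of l ?z b] by (auto simp: isE_def)
      have g1: "pot l c ?z (\<not> b) = 1 / t l"
        using pot_step[OF dec(2) nE] walk_own_end[OF 1] pot_end[OF 1] by simp
      have gb: "0 \<le> pot l c' ?z (\<not> b)" "pot l c' ?z (\<not> b) \<le> 1" for c' using pot_bounds by auto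
      have ab': "0 < al B'" "0 < be B'" "al B' \<le> 2 * be B'" "be B' \<le> 2 * al B'" using ab[OF B'l] by auto
      have up: "x + (y - x) * (1 / t l) \<le> x * (1 + 1 / t l)" if "y \<le> 2 * x" for x y :: real
        using that t0 by (simp add: field_simps)
      have dn: "x + (y - x) * g \<le> y * (1 + 1 / t l)" if "x \<le> y" "0 < y" "g \<le> 1" for x y g :: real
      proof -
        have "x + (y - x) * g \<le> x + (y - x) * 1" using that by (intro add_left_mono mult_left_mono) auto
        also have "\<dots> = y" by simp
        also have "y \<le> y * (1 + 1 / t l)" using that t0 by (simp add: field_simps)
        finally show ?thesis .
      qed
      show ?thesis
      proof (cases c)
        case True
        have v': "?v = be B'" using v True by simp
        show ?thesis
        proof (cases "al B' \<le> be B'")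
          case le: True
          then show ?thesis unfolding v' h[OF dec(2) B'l] using dn[OF le _ gb(2)] ab' by simp
        next
          case False
          then show ?thesis unfolding v' h[OF dec(2) B'l] using up[of "al B'" "be B'"] ab' g1 True by simp
        qed
      next
        case False
        have v': "?v = al B'" using v False by simp
        show ?thesis
        proof (cases "al B' \<le> be B'")
          case True
          then show ?thesis unfolding v' h[OF dec(2) B'l] using up[of "be B'" "al B'"] ab' g1 False by simp
        next
          case nle: False
          then show ?thesis unfolding v' h[OF dec(2) B'l] using dn[of "be B'" "al B'", OF _ _ gb(2)] ab' by simp
        qed
      qed
    qed
    have "walk M h e b = av (CB M l c ?B) (\<lambda>B'. h (?z + m l * B') (\<not> b))"
      using walk_end[OF 1 dec(2), of M h ?B] by simp
    also have "\<dots> \<le> ?v * (1 + 1 / t l)" by (rule av_le_const) (use nbr in auto)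
    also have "\<dots> = (1 + 1 / t l) * h e b" using hend[OF 1 dec(2) Bl] by simp
    finally show ?thesis .
  next
    case 2
    have "walk M h e b = walk l (\<lambda>z. h (z + m l * ?B)) ?z b"
      using walk_low[OF 2 dec(2) lM, of h ?B] by simp
    also have "\<dots> = walk l (\<lambda>z b. if al ?B \<le> be ?B then al ?B + (be ?B - al ?B) * pot l False z b else be ?B + (al ?B - be ?B) * pot l True z b) ?z b"
      by (rule walk_cong[OF dec(2)]) (rule h[OF _ Bl])
    also have "\<dots> \<le> (1 + 1 / t l) * h e b"
    proof (cases "al ?B \<le> be ?B")
      case True
      have hv: "h e b = al ?B + (be ?B - al ?B) * pot l False ?z b" using h[OF dec(2)[of e] Bl, of b] True by simp
      have g: "walk l (pot l False) ?z b = pot l False ?z b + 1 / t l" by (rule pot_step[OF dec(2)]) (use 2 in \<open>auto simp: isE_def\<close>)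
      have "0 \<le> (be ?B - al ?B) * pot l False ?z b" using True pot_bounds by simp
      then have "be ?B - al ?B \<le> h e b" unfolding hv using ab[OF Bl] by linarith
      then have "(be ?B - al ?B) / t l \<le> h e b / t l" using t0 by (intro divide_right_mono) auto
      moreover have "walk l (\<lambda>z b. al ?B + (be ?B - al ?B) * pot l False z b) ?z b = h e b + (be ?B - al ?B) / t l"
        unfolding walk_add walk_cmult walk_const g hv by (simp add: distrib_left)
      moreover have "(1 + 1 / t l) * h e b = h e b + h e b / t l" by (simp add: distrib_right)
      ultimately show ?thesis using True by simp
    next
      case False
      have hv: "h e b = be ?B + (al ?B - be ?B) * pot l True ?z b" using h[OF dec(2)[of e] Bl, of b] False by simp
      have g: "walk l (pot l True) ?z b = pot l True ?z b + 1 / t l" by (rule pot_step[OF dec(2)]) (use 2 in \<open>auto simp: isE_def\<close>)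
      have "0 \<le> (al ?B - be ?B) * pot l True ?z b" using False pot_bounds by simp
      then have "al ?B - be ?B \<le> h e b" unfolding hv using ab[OF Bl] by linarith
      then have "(al ?B - be ?B) / t l \<le> h e b / t l" using t0 by (intro divide_right_mono) auto
      moreover have "walk l (\<lambda>z b. be ?B + (al ?B - be ?B) * pot l True z b) ?z b = h e b + (al ?B - be ?B) / t l"
        unfolding walk_add walk_cmult walk_const g hv by (simp add: distrib_left)
      moreover have "(1 + 1 / t l) * h e b = h e b + h e b / t l" by (simp add: distrib_right)
      ultimately show ?thesis using False by simp
    qed
    finally show ?thesis .
  qed
qed

lemma kern_pairing: "cons M h \<Longrightarrow> x < m M \<Longrightarrow> (\<And>e b. e < m M \<Longrightarrow> 0 \<le> h e b) \<Longrightarrow> 0 \<le> r \<Longrightarrow>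
    (\<And>e b. e < m M \<Longrightarrow> walk M h e b \<le> r * h e b) \<Longrightarrow> IP M (kern M n x bx) h \<le> r ^ n * h x bx"
proof (induction n)
  case 0 then show ?case by (simp add: kern_0 IP_delta)
next
  case (Suc n)
  have "IP M (kern M (Suc n) x bx) h = IP M (walk M h) (kern M n x bx)"
    unfolding kern_Suc using walk_adj[OF cons_kern Suc.prems(1)] by (simp add: IP_commute)
  also have "\<dots> \<le> IP M (\<lambda>e b. r * h e b) (kern M n x bx)"
    by (rule IP_mono) (use Suc.prems kern_nonneg in auto)
  also have "\<dots> = r * IP M (kern M n x bx) h" by (simp add: IP_cmult_left IP_commute)
  also have "\<dots> \<le> r * (r ^ n * h x bx)" using Suc by (intro mult_left_mono) auto
  finally show ?case by simp
qed

text \<open>One step can change the weight \<open>2 powr (d / 2 ^ l)\<close> by a factor of about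
  \<open>1 + 1 / 2 ^ l\<close>, which is the wrong time scale. So the weight is sampled at block
  ends only and interpolated, and it then grows by at most \<open>1 + 1 / t l\<close> per step. The
  price is a factor two at the starting point and a factor two at the target.\<close>

lemma kern_tail: assumes lM: "l \<le> M" and X: "X < m M"
  shows "HS M (\<lambda>e b. if R \<le> real (ds M X bX e b) then kern M n X bX e b else 0)
     \<le> 4 * exp (real n / t l) * 2 powr (- R / 2 ^ l)"
proof -
  have t0: "real (t l) > 0" using t_pos by simp
  let ?q = "\<lambda>c B. zr l c + m l * B"
  let ?d = "\<lambda>c B. ds M X bX (?q c B) (bz l c)"
  define al be where "al B = 2 powr (real (?d False B) / 2 ^ l)" and "be B = 2 powr (real (?d True B) / 2 ^ l)" for B
  define h where "h e b = (let B = e div m l; z = e mod m l in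
      if al B \<le> be B then al B + (be B - al B) * pot l False z b else be B + (al B - be B) * pot l True z b)" for e b
  have BM: "z + m l * B < m M" if "B < m M div m l" "z < m l" for B z
  proof -
    have "m l * (B + 1) \<le> m l * (m M div m l)" using that by (intro mult_le_mono) auto
    then show ?thesis using that m_dvd[OF lM] by simp
  qed
  have step: "2 powr (real d / 2 ^ l) \<le> 2 powr 1 * 2 powr (real d' / 2 ^ l)" if "d \<le> d' + 2 ^ l" for d d' :: nat
  proof -
    have "real d \<le> real (d' + 2 ^ l)" using that by (rule of_nat_mono)
    then have "real d / 2 ^ l \<le> 1 + real d' / 2 ^ l" by (simp add: field_simps)
    then have "2 powr (real d / 2 ^ l) \<le> 2 powr (1 + real d' / 2 ^ l)" by (intro powr_mono) auto
    then show ?thesis by (simp add: powr_add)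
  qed
  have toend: "ds M X bX Y bY \<le> ?d c (Y div m l) + 2 ^ l \<and> ?d c (Y div m l) \<le> ds M X bX Y bY + 2 ^ l" if Y: "Y < m M" for Y bY c
  proof -
    have q: "?q c (Y div m l) < m M" by (rule block_in[OF lM Y zr_lt])
    obtain k where k: "k \<le> 2 ^ l" "(vert Y bY, vert (?q c (Y div m l)) (bz l c)) \<in> EE M ^^ k"
      using block_dist_M[OF lM Y zr_lt[of l c] isE_zr[of l c], of bY] by blast
    from k(2) have k': "(vert (?q c (Y div m l)) (bz l c), vert Y bY) \<in> EE M ^^ k"
      unfolding EE_def by (rule relpow_sym[OF sym_ES])
    show ?thesis using ds_tri[OF X q k', of bX] ds_tri[OF X Y k(2), of bX] k(1) by auto
  qed
  have ends: "?d c B \<le> ?d (\<not> c) B + 2 ^ l" if B: "B < m M div m l" for B c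
    using toend[OF BM[OF B zr_lt[of l "\<not> c"]], of "bz l (\<not> c)" c] zr_lt[of l "\<not> c"] by simp
  have dc: "?d c B' = ?d c B" if B': "B' \<in> CB M l c B" and B: "B < m M div m l" for c B B'
  proof -
    have "?q c B' \<in> Cl M (?q c B) (bz l c)" unfolding Cl_end[OF isE_zr[of l c] zr_lt[of l c]] using B' by (rule imageI)
    then have "vert (?q c B) (bz l c) = vert (?q c B') (bz l c)"
      using vert_eq_Cl[OF BM[OF B zr_lt], of "?q c B'" c "bz l c" "bz l c"] BM[OF CB_lt[OF lM B B'] zr_lt] by simp
    then show ?thesis by (simp add: ds_def)
  qed
  note sup = interpolation_superharmonic[OF lM, of al be h]
  have a1: "al B' = al B" if "B' \<in> CB M l False B" "B < m M div m l" for B B'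
    using dc[OF that] by (simp add: al_def)
  have a2: "be B' = be B" if "B' \<in> CB M l True B" "B < m M div m l" for B B'
    using dc[OF that] by (simp add: be_def)
  have a3: "0 < al B \<and> 0 < be B \<and> al B \<le> 2 * be B \<and> be B \<le> 2 * al B" if "B < m M div m l" for B
    using step[OF ends[OF that, of False]] step[OF ends[OF that, of True]] by (simp add: al_def be_def)
  have a4: "h (z + m l * B) b = (if al B \<le> be B then al B + (be B - al B) * pot l False z b else be B + (al B - be B) * pot l True z b)"
    if "z < m l" for z B b using that by (simp add: h_def)
  have hc: "cons M h" by (rule sup(1)[OF a1 a2 a3 a4])
  have hs: "walk M h e b \<le> (1 + 1 / t l) * h e b" if "e < m M" for e b by (rule sup(2)[OF a1 a2 a3 a4 that])
  have between: "min (al B) (be B) \<le> h e b \<and> h e b \<le> max (al B) (be B)" if "B = e div m l" for e b B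
  proof -
    have "x + (y - x) * g \<le> y \<and> x \<le> x + (y - x) * g" if "x \<le> y" "0 \<le> g" "g \<le> 1" for x y g :: real
      using that mult_left_mono[of g 1 "y - x"] by auto
    then show ?thesis using that pot_bounds unfolding h_def Let_def by (auto simp: min_def max_def)
  qed
  have h0: "0 < h e b" for e b
    using between[of "e div m l" e b] by (auto simp: al_def be_def min_def split: if_splits intro: less_le_trans[rotated])
  have hX: "h X bX \<le> 2"
  proof -
    have "ds M X bX X bX = 0" using ds_le[of X bX X bX 0 M] by simp
    then have "?d c (X div m l) \<le> 0 + 2 ^ l" for c using toend[OF X, of bX c] by simp
    then have "2 powr (real (?d c (X div m l)) / 2 ^ l) \<le> 2 powr 1 * 2 powr (real 0 / 2 ^ l)" for c
      by (rule step)
    then have "al (X div m l) \<le> 2" "be (X div m l) \<le> 2" by (simp_all add: al_def be_def)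
    then have "max (al (X div m l)) (be (X div m l)) \<le> 2" by simp
    then show ?thesis using between[of "X div m l" X bX] by linarith
  qed
  have far: "2 powr (R / 2 ^ l) / 2 \<le> h e b" if e: "e < m M" and R: "R \<le> real (ds M X bX e b)" for e b
  proof -
    have "2 powr (R / 2 ^ l) \<le> 2 powr (real (ds M X bX e b) / 2 ^ l)"
      using R by (intro powr_mono divide_right_mono) auto
    also have "\<dots> \<le> 2 * 2 powr (real (?d c (e div m l)) / 2 ^ l)" for c
      using step[of "ds M X bX e b" "?d c (e div m l)"] toend[OF e, of b c] by simp
    finally have f: "2 powr (R / 2 ^ l) \<le> 2 * 2 powr (real (?d c (e div m l)) / 2 ^ l)" for c .
    have "2 powr (R / 2 ^ l) / 2 \<le> 2 powr (real (?d c (e div m l)) / 2 ^ l)" for c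
      using f[of c] by linarith
    then have "2 powr (R / 2 ^ l) / 2 \<le> al (e div m l)" "2 powr (R / 2 ^ l) / 2 \<le> be (e div m l)"
      by (simp_all only: al_def be_def)
    then have "2 powr (R / 2 ^ l) / 2 \<le> min (al (e div m l)) (be (e div m l))" by simp
    then show ?thesis using between[of "e div m l" e b] by linarith
  qed
  let ?T = "HS M (\<lambda>e b. if R \<le> real (ds M X bX e b) then kern M n X bX e b else 0)"
  have "2 powr (R / 2 ^ l) / 2 * ?T \<le> IP M (kern M n X bX) h"
    unfolding HS_cmult[symmetric] IP_def
  proof (rule HS_mono)
    fix e b assume e: "e < m M"
    show "2 powr (R / 2 ^ l) / 2 * (if R \<le> real (ds M X bX e b) then kern M n X bX e b else 0) \<le> kern M n X bX e b * h e b"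
      using mult_right_mono[OF far[OF e, of b] kern_nonneg[OF e, of n X bX b]] kern_nonneg[OF e, of n X bX b] h0[of e b]
      by (auto simp: mult.commute)
  qed
  also have "\<dots> \<le> (1 + 1 / t l) ^ n * h X bX"
    by (rule kern_pairing[OF hc X]) (use h0 hs t0 in \<open>auto intro: less_imp_le\<close>)
  also have "\<dots> \<le> exp (real n / t l) * 2"
  proof (intro mult_mono hX)
    have "(1 + 1 / real (t l)) ^ n \<le> exp (1 / t l) ^ n"
      using exp_ge_add_one_self[of "1 / real (t l)"] t0 by (intro power_mono) auto
    then show "(1 + 1 / real (t l)) ^ n \<le> exp (real n / t l)" by (simp add: exp_of_nat_mult[symmetric])
  qed (use h0 in \<open>auto intro: less_imp_le\<close>)
  finally have "?T \<le> exp (real n / t l) * 2 / (2 powr (R / 2 ^ l) / 2)"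
    by (simp add: pos_le_divide_eq mult.commute)
  also have "\<dots> = 4 * exp (real n / t l) * 2 powr (- R / 2 ^ l)" by (simp add: powr_minus field_simps)
  finally show ?thesis .
qed

section \<open>Pointwise upper bounds\<close>

lemma kern_le_1: "y < m M \<Longrightarrow> kern M n x bx y by \<le> 1"
proof (induction n arbitrary: y "by")
  case 0
  then show ?case using card_Cl_pos[of M x bx] by (auto simp: kern_0 delta_def)
next
  case (Suc n)
  have "walk M (kern M n x bx) y by \<le> walk M (\<lambda>_ _. 1) y by" by (rule walk_mono) (use Suc in auto)
  then show ?case by (simp add: kern_Suc)
qed

lemma kern_le_fold: assumes "k \<le> M" "x < m M" "y < m M" "2 * mix_const * t k + 1 \<le> n"
  shows "kern M n x bx y by \<le> 3 / (2 * m k)"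
  by (rule order_trans[OF kern_fold_le[OF assms(1,3)] kern_le_mix]) (use m_pos assms in auto)

text \<open>Every intermediate vertex is at least half the distance away from one of the two
  endpoints; the kernel from that endpoint is summed by \<open>kern_tail\<close>, the other one is
  bounded by \<open>S\<close>.\<close>

lemma kern_off_even:
  assumes lM: "l \<le> M" and X: "X < m M" and Y: "Y < m M"
    and S: "\<And>x y bx by. x < m M \<Longrightarrow> y < m M \<Longrightarrow> kern M n x bx y by \<le> S"
  shows "kern M (n + n) X bX Y bY \<le> 8 * S * exp (real n / t l) * 2 powr (- real (ds M X bX Y bY) / (2 * 2 ^ l))"
proof -
  let ?R = "real (ds M X bX Y bY) / 2"
  let ?T = "4 * exp (real n / t l) * 2 powr (- ?R / 2 ^ l)"
  have S0: "0 \<le> S" using S[OF X Y, of bX bY] kern_nonneg[OF Y, of n X bX bY] by linarith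
  have "kern M (n + n) X bX Y bY = IP M (kern M n Y bY) (kern M n X bX)" by (rule kern_eq_IP) fact
  also have "\<dots> \<le> HS M (\<lambda>e b. S * (if ?R \<le> real (ds M X bX e b) then kern M n X bX e b else 0)
      + S * (if ?R \<le> real (ds M Y bY e b) then kern M n Y bY e b else 0))"
    unfolding IP_def
  proof (rule HS_mono)
    fix e b assume e: "e < m M"
    have "ds M X bX Y bY \<le> ds M X bX e b + ds M e b Y bY" by (rule ds_tri[OF X e ds_path[OF e Y]])
    also have "ds M e b Y bY = ds M Y bY e b" by (rule ds_sym[OF e Y])
    finally have "real (ds M X bX Y bY) \<le> real (ds M X bX e b) + real (ds M Y bY e b)" by linarith
    then have far: "?R \<le> real (ds M X bX e b) \<or> ?R \<le> real (ds M Y bY e b)" by linarith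
    have k: "0 \<le> kern M n Y bY e b" "0 \<le> kern M n X bX e b" using kern_nonneg[OF e] by auto
    have "kern M n Y bY e b * kern M n X bX e b \<le> S * kern M n X bX e b"
      by (rule mult_right_mono[OF S[OF Y e] k(2)])
    moreover have "kern M n Y bY e b * kern M n X bX e b \<le> S * kern M n Y bY e b"
      using mult_left_mono[OF S[OF X e] k(1)] by (simp add: mult.commute)
    moreover have "0 \<le> S * kern M n Y bY e b" "0 \<le> S * kern M n X bX e b" using k S0 by auto
    ultimately show "kern M n Y bY e b * kern M n X bX e b \<le> S * (if ?R \<le> real (ds M X bX e b) then kern M n X bX e b else 0)
      + S * (if ?R \<le> real (ds M Y bY e b) then kern M n Y bY e b else 0)"
      using far by (auto split: if_splits)
  qed
  also have "\<dots> = S * HS M (\<lambda>e b. if ?R \<le> real (ds M X bX e b) then kern M n X bX e b else 0)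
      + S * HS M (\<lambda>e b. if ?R \<le> real (ds M Y bY e b) then kern M n Y bY e b else 0)"
    by (simp only: HS_add HS_cmult)
  also have "\<dots> \<le> S * ?T + S * ?T"
    by (intro add_mono mult_left_mono kern_tail lM X Y S0)
  finally show ?thesis by simp
qed

text \<open>At an odd time a last step is averaged. It changes the distance by at most one, and
  hence the weight by at most the factor two that raises 8 to 16.\<close>

lemma kern_off:
  assumes lM: "l \<le> M" and X: "X < m M" and Y: "Y < m M"
    and S: "\<And>x y bx by. x < m M \<Longrightarrow> y < m M \<Longrightarrow> kern M (n div 2) x bx y by \<le> S"
  shows "kern M n X bX Y bY \<le> 16 * S * exp (real n / t l) * 2 powr (- real (ds M X bX Y bY) / (2 * 2 ^ l))"
proof -
  let ?n = "n div 2" and ?d = "real (ds M X bX Y bY)"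
  have S0: "0 \<le> S" using S[OF X Y, of bX bY] kern_nonneg[OF Y, of ?n X bX bY] by linarith
  have ex: "exp (real ?n / t l) \<le> exp (real n / t l)"
    using t_pos[of l] by (simp add: divide_right_mono)
  have ev: "kern M (?n + ?n) X bX e b \<le> 16 * S * exp (real n / t l) * 2 powr (- ?d / (2 * 2 ^ l))"
    if e: "e < m M" and d: "ds M X bX Y bY \<le> ds M X bX e b + 1" for e b
  proof -
    have "?d \<le> real (ds M X bX e b) + 1" using d by linarith
    then have "- real (ds M X bX e b) / (2 * 2 ^ l) \<le> 1 / (2 * 2 ^ l) + - ?d / (2 * 2 ^ l)"
      unfolding add_divide_distrib[symmetric] by (intro divide_right_mono) auto
    also have "(1::real) / (2 * 2 ^ l) \<le> 1"
    proof -
      have "(1::real) \<le> 2 ^ Suc l" by (rule one_le_power) simp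
      then show ?thesis by (simp add: divide_le_eq)
    qed
    finally have "2 powr (- real (ds M X bX e b) / (2 * 2 ^ l)) \<le> 2 powr (1 + - ?d / (2 * 2 ^ l))"
      by (intro powr_mono) auto
    also have "\<dots> = 2 * 2 powr (- ?d / (2 * 2 ^ l))" unfolding powr_add by simp
    finally have p: "2 powr (- real (ds M X bX e b) / (2 * 2 ^ l)) \<le> 2 * 2 powr (- ?d / (2 * 2 ^ l))" .
    have "kern M (?n + ?n) X bX e b \<le> 8 * S * exp (real ?n / t l) * 2 powr (- real (ds M X bX e b) / (2 * 2 ^ l))"
      by (rule kern_off_even[OF lM X e S])
    also have "\<dots> \<le> 8 * S * exp (real n / t l) * (2 * 2 powr (- ?d / (2 * 2 ^ l)))"
      using S0 by (intro mult_mono ex p mult_nonneg_nonneg) auto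
    finally show ?thesis by simp
  qed
  show ?thesis
  proof (cases "even n")
    case True
    then have "n = ?n + ?n" by presburger
    then show ?thesis using ev[OF Y, of bY] by simp
  next
    case False
    then have n: "n = Suc (?n + ?n)" by presburger
    have "walk M (kern M (?n + ?n) X bX) Y bY \<le> 16 * S * exp (real n / t l) * 2 powr (- ?d / (2 * 2 ^ l))"
      unfolding walk_def
    proof (rule av_le_const)
      fix e assume e: "e \<in> Cl M Y bY"
      have el: "e < m M" by (rule Cl_lt[OF Y e])
      have v: "vert Y bY = vert e bY" using vert_eq_Cl[OF Y el, of bY bY] e by simp
      have "(vert e (\<not> bY), vert Y bY) \<in> EE M ^^ 1"
        unfolding v EE_def ES_def relpow_1 using el by (auto intro!: exI[of _ e] exI[of _ "\<not> bY"])
      from ds_tri[OF X el this, of bX]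
      show "kern M (?n + ?n) X bX e (\<not> bY) \<le> 16 * S * exp (real n / t l) * 2 powr (- ?d / (2 * 2 ^ l))"
        by (rule ev[OF el])
    qed auto
    moreover have "kern M n X bX Y bY = walk M (kern M (?n + ?n) X bX) Y bY"
      by (subst n) (simp add: kern_Suc)
    ultimately show ?thesis by simp
  qed
qed

end

section \<open>Random walk, closed balls and the infinite graph\<close>

lemma measure_graph_measure: assumes "S \<subseteq> X" "finite S"
  shows "measure (graph_measure X E) S = (\<Sum>v\<in>S. real (deg E v))"
proof -
  have "emeasure (graph_measure X E) S = (\<Sum>v\<in>S. of_nat (deg E v))"
    unfolding graph_measure_def by (rule emeasure_point_measure_finite2) fact+
  also have "\<dots> = ennreal (\<Sum>v\<in>S. real (deg E v))"
    by (simp add: ennreal_of_nat_eq_real_of_nat)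
  finally show ?thesis by (simp add: measure_def sum_nonneg)
qed

lemma pmf_of_set_nbr: assumes "finite (E `` {z})" "E `` {z} \<noteq> {}" "sym E"
  shows "pmf (pmf_of_set (E `` {z})) y = (if z \<in> E `` {y} then 1 / real (deg E z) else 0)"
  using assms by (auto simp: pmf_of_set deg_def indicator_def dest: symD)

lemma srw_path: assumes "\<And>z. z \<in> X \<Longrightarrow> finite (E `` {z}) \<and> E `` {z} \<noteq> {}" "E \<subseteq> X \<times> X" "x \<in> X"
  shows "y \<in> set_pmf (srw E n x) \<Longrightarrow> y \<in> X \<and> (x, y) \<in> E ^^ n"
proof (induction n arbitrary: y)
  case (Suc n)
  then obtain z where z: "z \<in> set_pmf (srw E n x)" "y \<in> set_pmf (pmf_of_set (E `` {z}))" by auto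
  have "z \<in> X" "(x, z) \<in> E ^^ n" using Suc.IH[OF z(1)] by auto
  moreover from this have "(z, y) \<in> E" using z(2) assms(1)[of z] by (auto simp: set_pmf_of_set)
  ultimately show ?case using assms(2) by auto
qed (use assms in auto)

context glued_blocks begin

section \<open>Degree measure and heat kernel of the block graphs\<close>

lemma XX_iff: "v \<in> XX M \<longleftrightarrow> (\<exists>e<m M. \<exists>b. v = vert e b)" by (auto simp: XX_def XS_def)
lemma finite_XX: "finite (XX M)"
proof -
  have "XX M = (\<lambda>(e, b). vert e b) ` ({..<m M} \<times> UNIV)" by (auto simp: XX_def XS_def)
  then show ?thesis by simp
qed

lemma nbrs_fin: "z \<in> XX M \<Longrightarrow> finite (EE M `` {z}) \<and> EE M `` {z} \<noteq> {}"
  by (auto simp: XX_iff nbrs_M)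
lemma EE_sub: "EE M \<subseteq> XX M \<times> XX M" unfolding EE_def XX_def by (rule ES_XS)
lemma sym_EE: "sym (EE M)" unfolding EE_def by (rule sym_ES)

lemma sum_deg: assumes "S \<subseteq> XX M"
  shows "(\<Sum>v\<in>S. real (deg (EE M) v)) = HS M (\<lambda>e b. if vert e b \<in> S then 1 else 0)"
proof -
  let ?H = "{..<m M} \<times> (UNIV :: bool set)"
  let ?g = "\<lambda>(e, b). vert e b"
  have finS: "finite S" using assms finite_XX finite_subset by blast
  have "HS M (\<lambda>e b. if vert e b \<in> S then 1 else 0) = (\<Sum>p\<in>?H. if ?g p \<in> S then 1 else 0 :: real)"
    unfolding HS_def sum.cartesian_product' by (simp add: UNIV_bool case_prod_beta add.commute)
  also have "\<dots> = (\<Sum>p\<in>?H \<inter> {p. ?g p \<in> S}. 1)" by (subst sum.inter_restrict) auto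
  also have "\<dots> = (\<Sum>v\<in>S. \<Sum>p\<in>{p \<in> ?H \<inter> {p. ?g p \<in> S}. ?g p = v}. 1)"
    by (rule sum.group[symmetric]) (use finS in auto)
  also have "\<dots> = (\<Sum>v\<in>S. real (deg (EE M) v))"
  proof (rule sum.cong[OF refl])
    fix v assume v: "v \<in> S"
    then obtain e b where e: "e < m M" "v = vert e b" using assms XX_iff by blast
    have "{p \<in> ?H \<inter> {p. ?g p \<in> S}. ?g p = v} = Cl M e b \<times> {b}"
    proof (intro set_eqI iffI)
      fix p assume p: "p \<in> {p \<in> ?H \<inter> {p. ?g p \<in> S}. ?g p = v}"
      then obtain e' b' where "p = (e', b')" "e' < m M" "vert e b = vert e' b'" using e by auto
      then show "p \<in> Cl M e b \<times> {b}" using vert_eq_Cl[OF e(1), of e' b b'] by auto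
    next
      fix p assume "p \<in> Cl M e b \<times> {b}"
      then obtain e' where e': "p = (e', b)" "e' \<in> Cl M e b" by auto
      have "e' < m M" by (rule Cl_lt[OF e(1) e'(2)])
      then show "p \<in> {p \<in> ?H \<inter> {p. ?g p \<in> S}. ?g p = v}"
        using vert_eq_Cl[OF e(1), of e' b b] e' e v by auto
    qed
    then show "(\<Sum>p\<in>{p \<in> ?H \<inter> {p. ?g p \<in> S}. ?g p = v}. 1) = real (deg (EE M) v)"
      using deg_M[OF e(1), of b] e(2) by simp
  qed
  finally show ?thesis by simp
qed

lemma measure_M: "S \<subseteq> XX M \<Longrightarrow> measure (graph_measure (XX M) (EE M)) S = (\<Sum>v\<in>S. real (deg (EE M) v))"
  by (rule measure_graph_measure) (use finite_XX finite_subset in auto)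

lemma measure_ball_M: "measure (graph_measure (XX M) (EE M)) (graph_ball (XX M) (EE M) (vert X bX) r) = Vol M X bX r"
proof -
  have sub: "graph_ball (XX M) (EE M) (vert X bX) r \<subseteq> XX M" by (auto simp: graph_ball_def)
  show ?thesis unfolding measure_M[OF sub] sum_deg[OF sub] Vol_def
    by (rule HS_cong) (auto simp: graph_ball_def ds_def XX_iff)
qed

text \<open>The transition from \<open>z\<close> divides by the degree of \<open>z\<close>, which
  turns the law at \<open>z\<close> into the density at \<open>z\<close>. Division by the degree of
  the target then yields the average over its neighbours, that is \<open>walk\<close>.\<close>

lemma heat_kernel_M: assumes X: "X < m M"
  shows "Y < m M \<Longrightarrow> heat_kernel (XX M) (EE M) n (vert X bX) (vert Y bY) = kern M n X bX Y bY"
proof (induction n arbitrary: Y bY)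
  case 0
  have "measure (graph_measure (XX M) (EE M)) {vert Y bY} = card (Cl M Y bY)"
    using 0 by (subst measure_M) (auto simp: XX_iff deg_M)
  moreover have "card (Cl M Y bY) = card (Cl M X bX)" if "bY = bX" "Y \<in> Cl M X bX"
    using Cl_eq[OF that(2)] that(1) by simp
  moreover have "vert X bX = vert Y bY \<longleftrightarrow> bY = bX \<and> Y \<in> Cl M X bX"
    using vert_eq_Cl[OF X 0, of bX bY] by auto
  ultimately show ?case by (simp add: heat_kernel_def kern_0 delta_def indicator_def)
next
  case (Suc n)
  let ?E = "EE M" and ?y = "vert Y bY" and ?p = "srw (EE M) n (vert X bX)"
  have yX: "?y \<in> XX M" using Suc.prems by (auto simp: XX_iff)
  have xX: "vert X bX \<in> XX M" using X by (auto simp: XX_iff)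
  have supp: "z \<in> XX M" if "z \<in> set_pmf ?p" for z
    using srw_path[OF nbrs_fin EE_sub xX that] by blast
  have dM: "measure (graph_measure (XX M) ?E) {v} = real (deg ?E v)" if "v \<in> XX M" for v
    using that by (subst measure_M) auto
  have "pmf (srw ?E (Suc n) (vert X bX)) ?y = measure_pmf.expectation ?p (\<lambda>z. pmf (pmf_of_set (?E `` {z})) ?y)"
    by (simp add: pmf_bind)
  also have "\<dots> = (\<Sum>z\<in>?E `` {?y}. pmf (pmf_of_set (?E `` {z})) ?y * pmf ?p z)"
  proof (rule integral_measure_pmf_real)
    show "finite (?E `` {?y})" using nbrs_fin[OF yX] by simp
    fix z assume z: "z \<in> set_pmf ?p" "pmf (pmf_of_set (?E `` {z})) ?y \<noteq> 0"
    show "z \<in> ?E `` {?y}"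
      using z(2) pmf_of_set_nbr[of ?E z ?y] nbrs_fin[OF supp[OF z(1)]] sym_EE by (auto split: if_splits)
  qed
  also have "\<dots> = (\<Sum>z\<in>?E `` {?y}. heat_kernel (XX M) ?E n (vert X bX) z)"
  proof (rule sum.cong[OF refl])
    fix z assume z: "z \<in> ?E `` {?y}"
    then have zX: "z \<in> XX M" using EE_sub by blast
    show "pmf (pmf_of_set (?E `` {z})) ?y * pmf ?p z = heat_kernel (XX M) ?E n (vert X bX) z"
      using pmf_of_set_nbr[of ?E z ?y] nbrs_fin[OF zX] sym_EE z dM[OF zX] by (simp add: heat_kernel_def)
  qed
  also have "\<dots> = (\<Sum>e'\<in>Cl M Y bY. heat_kernel (XX M) ?E n (vert X bX) (vert e' (\<not> bY)))"
    unfolding nbrs_M[OF Suc.prems] by (rule sum.reindex[OF nbr_inj_M[OF Suc.prems], unfolded o_def])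
  also have "\<dots> = (\<Sum>e'\<in>Cl M Y bY. kern M n X bX e' (\<not> bY))"
    by (intro sum.cong refl Suc.IH) (use Cl_lt Suc.prems in blast)
  finally show ?case
    using dM[OF yX] deg_M[OF Suc.prems, of bY] by (simp add: heat_kernel_def kern_Suc walk_def av_def)
qed

section \<open>The infinite graph and its balls around the root\<close>

definition Xinf :: "nat set" where "Xinf = XS UNIV"
definition Einf :: "(nat \<times> nat) set" where "Einf = ES UNIV"
definition root :: nat where "root = vert 0 False"

lemma Xinf_iff: "v \<in> Xinf \<longleftrightarrow> (\<exists>e b. v = vert e b)" by (auto simp: Xinf_def XS_def)
lemma Einf_sub: "Einf \<subseteq> Xinf \<times> Xinf" unfolding Einf_def Xinf_def by (rule ES_XS)
lemma sym_Einf: "sym Einf" unfolding Einf_def by (rule sym_ES)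
lemma EE_Einf: "EE M \<subseteq> Einf" unfolding EE_def Einf_def by (rule ES_mono) simp
lemma Xinf_XX: "v \<in> Xinf \<Longrightarrow> \<exists>M0. \<forall>M\<ge>M0. v \<in> XX M"
proof -
  assume "v \<in> Xinf"
  then obtain e b where "v = vert e b" by (auto simp: Xinf_iff)
  then have "v \<in> XX M" if "M \<ge> e" for M
    using less_le_trans[OF lt_m[of e] m_mono[OF that]] XX_iff by blast
  then show ?thesis by blast
qed
lemma XX_Xinf: "XX M \<subseteq> Xinf" using XX_iff Xinf_iff by blast
lemma Einf_nbrs: "Einf `` {vert e b} = (\<lambda>e'. vert e' (\<not> b)) ` Cw e b"
  unfolding Einf_def nbrs by simp
lemma Einf_fin: "z \<in> Xinf \<Longrightarrow> finite (Einf `` {z}) \<and> Einf `` {z} \<noteq> {}"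
proof -
  assume "z \<in> Xinf"
  then obtain e b where z: "z = vert e b" using Xinf_iff by blast
  have "Cw e b \<noteq> {}" using Cw_refl by blast
  then show ?thesis by (simp add: z Einf_nbrs)
qed

lemma root_path: "e < m M \<Longrightarrow> \<exists>n\<le>2 ^ M. (root, vert e b) \<in> Einf ^^ n"
proof -
  assume e: "e < m M"
  have "isE M False 0 False" by (simp add: isE_def isP_def arm_def digit_def)
  from block_dist[OF _ e m_pos this, of 0 UNIV b] obtain n where
    "n \<le> 2 ^ M" "(vert e b, root) \<in> Einf ^^ n" by (auto simp: Einf_def root_def)
  then show ?thesis using relpow_sym[OF sym_Einf] by blast
qed

text \<open>\<open>height\<close> changes by at most one per step. The first block of level
  \<open>M\<close> can be left at its Q-end only, where the height is \<open>2 ^ M\<close>, because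
  its P-end belongs to the P-ends of all higher blocks. So paths of length at most
  \<open>2 ^ M\<close> stay in it.\<close>

lemma root_ball_lower: "n \<le> 2 ^ M \<Longrightarrow> (root, vert e b) \<in> Einf ^^ n \<Longrightarrow> \<exists>e'\<in>Cw e b. e' < m M \<and> height M e' b \<le> n"
proof (induction n arbitrary: e b)
  case 0
  then have v: "vert 0 False = vert e b" by (simp add: root_def)
  then have "b = False" "0 \<in> Cw e b" using vert_eq[of e b 0 False] by auto
  moreover have "isP M 0 False" by (simp add: isP_def arm_def digit_def)
  ultimately show ?case using height_P[of M 0 False] m_pos by (intro bexI[of _ 0]) auto
next
  case (Suc n)
  then obtain w where w: "(root, w) \<in> Einf ^^ n" "(w, vert e b) \<in> Einf" by auto
  then obtain e1 b1 where e1: "w = vert e1 b1" "vert e b = vert e1 (\<not> b1)" by (auto simp: Einf_def ES_def)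
  then have b: "b = (\<not> b1)" and e1C: "e1 \<in> Cw e b" by (auto simp: vert_eq)
  obtain e' where e': "e' \<in> Cw e1 b1" "e' < m M" "height M e' b1 \<le> n" using Suc.IH[of e1 b1] Suc.prems(1) w(1) e1(1) by auto
  have "e1 < m M \<and> height M e1 b1 \<le> n"
  proof -
    have e1': "e1 \<in> Cw e' b1" using Cw_eq[OF e'(1)] by simp
    show ?thesis
    proof (cases "e1 \<in> Cl M e' b1")
      case True
      then show ?thesis using Cl_lt[OF e'(2) True] consD[OF cons_height e'(2) True] e'(3) by simp
    next
      case False
      then obtain k d where k: "\<not> k < M" "isQ k e' b1" "d < N k" "e1 = upd k d e'"
        using e1' unfolding Cw_def Cl_def by blast
      \<comment> \<open>Gluing at a level above \<open>M\<close> would need a higher digit in arm 1,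
        but all higher digits are zero in the first block.\<close>
      have "k = M"
      proof (rule ccontr)
        assume "k \<noteq> M"
        then have "k > M" using k(1) by simp
        then obtain j where j: "k = Suc j" "M \<le> j" by (cases k) auto
        then have "arm j e' = 1" using k(2) by simp
        moreover have "arm j e' = 0" using digit_ge[OF e'(2) j(2)] by (simp add: arm_def)
        ultimately show False by simp
      qed
      then have "height M e' b1 = 2 ^ M" using k(2) height_Q by blast
      then have "(2::real) ^ M \<le> real n" using e'(3) by simp
      then have "real (2 ^ M) \<le> real n" by simp
      then have "2 ^ M \<le> n" by (simp only: of_nat_le_iff)
      then show ?thesis using Suc.prems(1) by simp
    qed
  qed
  then show ?case using e1C height_lip[of M e1 b1 b] b by (intro bexI[of _ e1]) auto
qed

lemma sub_verts_eq: "sub_verts Xinf Einf root M = XX M"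
proof (intro set_eqI iffI)
  fix x assume "x \<in> sub_verts Xinf Einf root M"
  then have x: "x \<in> Xinf" "graph_dist Einf root x \<le> 2 ^ M" by (auto simp: sub_verts_def)
  obtain e b where e: "x = vert e b" using x(1) Xinf_iff by blast
  obtain n where "(root, x) \<in> Einf ^^ n" using root_path[OF lt_m, of e b] e by blast
  then have p: "(root, vert e b) \<in> Einf ^^ graph_dist Einf root x" unfolding e by (rule graph_dist_path)
  obtain e' where e': "e' \<in> Cw e b" "e' < m M" using root_ball_lower[OF x(2) p] by blast
  then have "x = vert e' b" by (simp add: vert_eq e)
  then show "x \<in> XX M" using e'(2) XX_iff by blast
next
  fix x assume "x \<in> XX M"
  then obtain e b where e: "e < m M" "x = vert e b" by (auto simp: XX_iff)
  obtain n where n: "n \<le> 2 ^ M" "(root, x) \<in> Einf ^^ n" using root_path[OF e(1), of b] e(2) by blast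
  have "graph_dist Einf root x \<le> 2 ^ M" using order_trans[OF graph_dist_le[OF n(2)] n(1)] .
  moreover have "x \<in> Xinf" using e Xinf_iff by blast
  ultimately show "x \<in> sub_verts Xinf Einf root M" by (simp add: sub_verts_def)
qed

text \<open>The induced subgraph has no additional edges: a vertex of side \<open>True\<close> is
  glued at level 0 only, so for \<open>M \<ge> 1\<close> all its edges belong to the block.\<close>

lemma sub_edges_eq: assumes "M \<ge> 1" shows "sub_edges Xinf Einf root M = EE M"
proof -
  have "e < m M" if v: "vert e True \<in> XX M" for e
  proof -
    obtain e1 where e1: "e1 < m M" "e1 \<in> Cw e True" using v by (auto simp: XX_iff vert_eq)
    have "digit j e = digit j e1" if "j \<ge> 1" for j
    proof (cases "e1 = e")
      case False
      then obtain k d where k: "isQ k e True" "d < N k" "e1 = upd k d e" using e1(2) by (auto simp: Cw_def)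
      then have "k = 0" by (cases k) (auto simp: isP_def)
      then show ?thesis using k digit_upd[OF k(2), of j e] that by simp
    qed simp
    then show ?thesis using e1(1) assms unfolding lt_m_iff by auto
  qed
  then have "e < m M" if "vert e b \<in> XX M" "vert e (\<not> b) \<in> XX M" for e b using that by (cases b) auto
  then have "Restr Einf (XX M) \<subseteq> EE M" unfolding Einf_def EE_def ES_def by blast
  then show ?thesis unfolding sub_edges_def sub_verts_eq using EE_sub EE_Einf by blast
qed

lemma Restr_Einf: "M \<ge> 1 \<Longrightarrow> Restr Einf (XX M) = EE M"
  using sub_edges_eq[of M] by (simp add: sub_edges_def sub_verts_eq)

lemma infinite_Xinf: "infinite Xinf"
proof
  let ?v = "\<lambda>x. vert (N 0 * x) True"
  assume "finite Xinf"
  moreover have "range ?v \<subseteq> Xinf" using Xinf_iff by blast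
  ultimately have "finite (range ?v)" using finite_subset by blast
  moreover have "inj ?v"
  proof (rule injI)
    fix x y assume "?v x = ?v y"
    then have "N 0 * y \<in> Cw (N 0 * x) True" using vert_eq by blast
    then consider "N 0 * y = N 0 * x" | k d where "isQ k (N 0 * x) True" "d < N k" "N 0 * y = upd k d (N 0 * x)"
      unfolding Cw_def by blast
    then show "x = y"
    proof cases
      case 1 then show ?thesis using N_pos[of 0] by simp
    next
      case (2 k d)
      then have "k = 0" by (cases k) (auto simp: isP_def)
      moreover have "m (Suc 0) = N 0" by (simp add: m_def)
      ultimately have d: "N 0 * y = d + N 0 * x" "d < N 0" using 2 N_pos[of 0] by (auto simp: upd_def)
      have "y = (N 0 * y) div N 0" using N_pos[of 0] by simp
      also have "\<dots> = x" unfolding d(1) using d(2) by simp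
      finally show ?thesis by simp
    qed
  qed
  ultimately show False using finite_imageD infinite_UNIV_nat by blast
qed

lemma connected_graph_inf: "connected_graph Xinf Einf"
proof -
  have "(x, y) \<in> Einf\<^sup>*" if "x \<in> Xinf" "y \<in> Xinf" for x y
  proof -
    have r: "(root, z) \<in> Einf\<^sup>*" if z: "z \<in> Xinf" for z
    proof -
      obtain e b where "z = vert e b" using z Xinf_iff by blast
      then obtain n where "(root, z) \<in> Einf ^^ n" using root_path[OF lt_m, of e b] by blast
      then show ?thesis by (rule relpow_imp_rtrancl)
    qed
    then have "(x, root) \<in> Einf\<^sup>*" using that sym_Einf sym_rtrancl symD by metis
    then show ?thesis using r[OF that(2)] by (rule rtrancl_trans)
  qed
  moreover have "Xinf \<noteq> {}" using Xinf_iff by blast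
  moreover have "irrefl Einf" unfolding Einf_def by (rule irrefl_ES)
  ultimately show ?thesis
    unfolding connected_graph_def using Einf_sub sym_Einf Einf_fin by simp
qed

text \<open>Within distance \<open>R\<close> of \<open>XX M0\<close> the infinite graph looks like the \<open>M\<close>-th block.\<close>

context fixes M0 M R :: nat and x :: nat
  assumes x: "x \<in> XX M0" and big: "2 ^ M0 + R < 2 ^ M" and M1: "M \<ge> 1"
begin

lemma loc_nbrs: "(x, z) \<in> Einf ^^ n \<Longrightarrow> n \<le> R \<Longrightarrow> z \<in> XX M \<and> Einf `` {z} = EE M `` {z}"
proof -
  assume z: "(x, z) \<in> Einf ^^ n" "n \<le> R"
  obtain e b where e: "e < m M0" "x = vert e b" using x XX_iff by blast
  obtain k where k: "k \<le> 2 ^ M0" "(root, x) \<in> Einf ^^ k" using root_path[OF e(1), of b] e(2) by blast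
  have rz: "(root, z) \<in> Einf ^^ (k + n)" using k z unfolding relpow_add by (intro relcompI)
  have near: "y \<in> XX M" if "(root, y) \<in> Einf ^^ j" "j \<le> 2 ^ M" for y j
  proof -
    have "y \<in> Xinf"
    proof (cases j)
      case 0 then show ?thesis using that by (auto simp: root_def Xinf_iff)
    next
      case (Suc i) then show ?thesis using that Einf_sub by auto
    qed
    moreover have "graph_dist Einf root y \<le> 2 ^ M" using graph_dist_le[OF that(1)] that(2) by simp
    ultimately show ?thesis unfolding sub_verts_eq[symmetric] by (simp add: sub_verts_def)
  qed
  have zM: "z \<in> XX M" by (rule near[OF rz]) (use k z big in linarith)
  have "y \<in> XX M" if "(z, y) \<in> Einf" for y
    by (rule near[of y "Suc (k + n)"]) (use rz that k z big in auto)
  then show ?thesis using zM Restr_Einf[OF M1] EE_Einf[of M] by blast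
qed

lemma loc_path: "n \<le> Suc R \<Longrightarrow> (x, z) \<in> Einf ^^ n \<longleftrightarrow> (x, z) \<in> EE M ^^ n"
proof (induction n arbitrary: z)
  case (Suc n)
  show ?case
  proof
    assume "(x, z) \<in> Einf ^^ Suc n"
    then obtain y where y: "(x, y) \<in> Einf ^^ n" "(y, z) \<in> Einf" by auto
    then have "(y, z) \<in> EE M" using loc_nbrs[OF y(1)] Suc.prems by auto
    then show "(x, z) \<in> EE M ^^ Suc n" using Suc.IH[of y] Suc.prems y by auto
  next
    assume "(x, z) \<in> EE M ^^ Suc n"
    then show "(x, z) \<in> Einf ^^ Suc n" using relpowp_mono EE_Einf[of M] Suc.IH Suc.prems by auto
  qed
qed simp

lemma loc_dist: assumes "(x, z) \<in> Einf ^^ n" "n \<le> R" shows "graph_dist Einf x z = graph_dist (EE M) x z"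
proof (rule le_antisym)
  have "(x, z) \<in> EE M ^^ n" using loc_path[of n z] assms by simp
  then have 1: "(x, z) \<in> EE M ^^ graph_dist (EE M) x z" "graph_dist (EE M) x z \<le> n"
    by (rule graph_dist_path, rule graph_dist_le)
  have 2: "(x, z) \<in> Einf ^^ graph_dist Einf x z" "graph_dist Einf x z \<le> n"
    using assms(1) by (rule graph_dist_path, intro graph_dist_le)
  show "graph_dist Einf x z \<le> graph_dist (EE M) x z"
    by (rule graph_dist_le) (use 1 assms loc_path in auto)
  show "graph_dist (EE M) x z \<le> graph_dist Einf x z"
    by (rule graph_dist_le) (use 2 assms loc_path in auto)
qed

lemma loc_deg: "(x, z) \<in> Einf ^^ n \<Longrightarrow> n \<le> R \<Longrightarrow> deg Einf z = deg (EE M) z"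
  unfolding deg_def using loc_nbrs by metis

lemma x_path: "z \<in> Xinf \<Longrightarrow> (x, z) \<in> Einf ^^ graph_dist Einf x z"
proof -
  assume "z \<in> Xinf"
  moreover have "x \<in> Xinf" using x XX_Xinf by blast
  ultimately have "(x, z) \<in> Einf\<^sup>*" using connected_graph_inf by (auto simp: connected_graph_def)
  then obtain n where "(x, z) \<in> Einf ^^ n" using rtrancl_imp_relpow by blast
  then show ?thesis by (rule graph_dist_path)
qed

lemma x_path_M: "z \<in> XX M \<Longrightarrow> (x, z) \<in> EE M ^^ graph_dist (EE M) x z"
proof -
  assume z: "z \<in> XX M"
  have "m M0 \<le> m M"
  proof (rule m_mono)
    have "(2::nat) ^ M0 < 2 ^ M" using big by linarith
    then show "M0 \<le> M" by simp
  qed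
  then have "x \<in> XX M" using x by (auto simp: XX_iff dest: less_le_trans)
  then show ?thesis using z ds_path by (auto simp: XX_iff ds_def)
qed

lemma loc_ball: assumes "r \<le> real R"
  shows "measure (graph_measure Xinf Einf) (graph_ball Xinf Einf x r) = measure (graph_measure (XX M) (EE M)) (graph_ball (XX M) (EE M) x r)"
proof -
  have eq: "graph_ball Xinf Einf x r = graph_ball (XX M) (EE M) x r"
  proof (intro set_eqI iffI)
    fix z assume "z \<in> graph_ball Xinf Einf x r"
    then have z: "z \<in> Xinf" "real (graph_dist Einf x z) < r" by (auto simp: graph_ball_def)
    have p: "(x, z) \<in> Einf ^^ graph_dist Einf x z" by (rule x_path[OF z(1)])
    have R: "graph_dist Einf x z \<le> R" using z(2) assms by linarith
    show "z \<in> graph_ball (XX M) (EE M) x r"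
      using loc_nbrs[OF p R] loc_dist[OF p R] z(2) by (simp add: graph_ball_def)
  next
    fix z assume "z \<in> graph_ball (XX M) (EE M) x r"
    then have z: "z \<in> XX M" "real (graph_dist (EE M) x z) < r" by (auto simp: graph_ball_def)
    have R: "graph_dist (EE M) x z \<le> R" using z(2) assms by linarith
    have p: "(x, z) \<in> Einf ^^ graph_dist (EE M) x z" using x_path_M[OF z(1)] loc_path R by simp
    show "z \<in> graph_ball Xinf Einf x r"
      using loc_dist[OF p R] z XX_Xinf by (auto simp: graph_ball_def)
  qed
  have sub: "graph_ball (XX M) (EE M) x r \<subseteq> XX M" by (auto simp: graph_ball_def)
  have "measure (graph_measure Xinf Einf) (graph_ball (XX M) (EE M) x r) = (\<Sum>v\<in>graph_ball (XX M) (EE M) x r. real (deg Einf v))"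
    using sub XX_Xinf finite_subset[OF sub finite_XX] by (intro measure_graph_measure) blast+
  also have "\<dots> = (\<Sum>v\<in>graph_ball (XX M) (EE M) x r. real (deg (EE M) v))"
  proof (rule sum.cong[OF refl])
    fix v assume "v \<in> graph_ball (XX M) (EE M) x r"
    then have v: "v \<in> Xinf" "real (graph_dist Einf x v) < r" unfolding eq[symmetric] by (auto simp: graph_ball_def)
    have R: "graph_dist Einf x v \<le> R" using v(2) assms by linarith
    show "real (deg Einf v) = real (deg (EE M) v)" using loc_deg[OF x_path[OF v(1)] R] by simp
  qed
  finally show ?thesis unfolding eq measure_M[OF sub] .
qed

lemma loc_srw: "n \<le> R \<Longrightarrow> srw Einf n x = srw (EE M) n x"
proof (induction n)
  case (Suc n)
  have xi: "x \<in> Xinf" using x XX_Xinf by blast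
  have "bind_pmf (srw Einf n x) (\<lambda>z. pmf_of_set (Einf `` {z})) = bind_pmf (srw Einf n x) (\<lambda>z. pmf_of_set (EE M `` {z}))"
  proof (rule bind_pmf_cong[OF refl])
    fix z assume "z \<in> set_pmf (srw Einf n x)"
    then have "(x, z) \<in> Einf ^^ n" using srw_path[OF Einf_fin Einf_sub xi] by blast
    then show "pmf_of_set (Einf `` {z}) = pmf_of_set (EE M `` {z})" using loc_nbrs[of z n] Suc.prems by simp
  qed
  then show ?case using Suc by simp
qed simp

lemma loc_heat: assumes "n \<le> R" "(x, y) \<in> Einf ^^ k" "k \<le> R"
  shows "heat_kernel Xinf Einf n x y = heat_kernel (XX M) (EE M) n x y"
proof -
  have "y \<in> XX M" using loc_nbrs[OF assms(2,3)] by simp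
  then have "measure (graph_measure Xinf Einf) {y} = real (deg Einf y)" "measure (graph_measure (XX M) (EE M)) {y} = real (deg (EE M) y)"
    using XX_Xinf by (subst measure_graph_measure, auto)+
  then show ?thesis using loc_srw[OF assms(1)] loc_deg[OF assms(2,3)] by (simp add: heat_kernel_def)
qed

end

section \<open>Transfer of the estimates to the infinite graph\<close>

lemma choose_M: "x \<in> Xinf \<Longrightarrow> \<exists>M0 M. x \<in> XX M0 \<and> 2 ^ M0 + (R::nat) < 2 ^ M \<and> M \<ge> (1::nat)"
proof -
  assume "x \<in> Xinf"
  then obtain M0 where M0: "x \<in> XX M0" using Xinf_XX by blast
  have "2 ^ M0 + R < 2 ^ (2 ^ M0 + R)" by (rule less_exp)
  moreover have "2 ^ M0 + R \<ge> 1" using one_le_power[of "2::nat" M0] by linarith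
  ultimately show ?thesis using M0 by blast
qed

text \<open>For fixed points and a fixed time both bounds depend on a bounded neighbourhood only,
  which is isometric to a part of a large block; the constants do not depend on that block.\<close>

lemma HKE_inf: assumes H: "\<And>M. M \<ge> 1 \<Longrightarrow> HKE_bounds_with C1 c1 c2 c3 C4 C5 \<Psi> (XX M) (EE M)"
  shows "HKE_bounds_with C1 c1 c2 c3 C4 C5 \<Psi> Xinf Einf"
proof -
  have tr: "\<exists>M\<ge>1. x \<in> XX M \<and> y \<in> XX M \<and> graph_dist Einf x y = graph_dist (EE M) x y \<and>
      heat_kernel Xinf Einf n x y = heat_kernel (XX M) (EE M) n x y \<and>
      heat_kernel Xinf Einf (n + 1) x y = heat_kernel (XX M) (EE M) (n + 1) x y \<and>
      measure (graph_measure Xinf Einf) (graph_ball Xinf Einf x r) = measure (graph_measure (XX M) (EE M)) (graph_ball (XX M) (EE M) x r)"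
    if x: "x \<in> Xinf" and y: "y \<in> Xinf" for x y n r
  proof -
    \<comment> \<open>The radius covers the walk up to time \<open>n + 1\<close>, the ball in the
      denominator and the distance of the two points.\<close>
    let ?R = "max (n + 1) (max (nat \<lceil>r\<rceil>) (graph_dist Einf x y))"
    obtain M0 M where M: "x \<in> XX M0" "2 ^ M0 + ?R < 2 ^ M" "M \<ge> 1" using choose_M[OF x] by blast
    have p: "(x, y) \<in> Einf ^^ graph_dist Einf x y" by (rule x_path[OF M y])
    have p0: "(x, x) \<in> Einf ^^ 0" by simp
    have dR: "graph_dist Einf x y \<le> ?R" by simp
    have "x \<in> XX M" using loc_nbrs[OF M p0] by simp
    moreover have "y \<in> XX M" using loc_nbrs[OF M p dR] by simp
    moreover have "r \<le> real ?R" by linarith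
    ultimately show ?thesis
      using M(3) loc_dist[OF M p dR] loc_heat[OF M _ p dR, of n] loc_heat[OF M _ p dR, of "n + 1"] loc_ball[OF M, of r]
      by (intro exI[of _ M]) auto
  qed
  show ?thesis unfolding HKE_bounds_with_def
  proof (intro conjI allI ballI impI)
    fix n :: nat and x y assume n: "1 \<le> n" and x: "x \<in> Xinf" and y: "y \<in> Xinf"
    let ?r = "inv_into {1..} \<Psi> (real n)"
    obtain M where M: "M \<ge> 1" "x \<in> XX M" "y \<in> XX M" "graph_dist Einf x y = graph_dist (EE M) x y"
      "heat_kernel Xinf Einf n x y = heat_kernel (XX M) (EE M) n x y"
      "heat_kernel Xinf Einf (n + 1) x y = heat_kernel (XX M) (EE M) (n + 1) x y"
      "measure (graph_measure Xinf Einf) (graph_ball Xinf Einf x ?r) = measure (graph_measure (XX M) (EE M)) (graph_ball (XX M) (EE M) x ?r)"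
      using tr[OF x y, of n ?r] by blast
    show "heat_kernel Xinf Einf n x y \<le> C1 / measure (graph_measure Xinf Einf) (graph_ball Xinf Einf x ?r)
             * exp (- c1 * real n * Phi_d \<Psi> (c2 * (real (graph_dist Einf x y) / real n)))"
      using H[OF M(1)] n M unfolding HKE_bounds_with_def by simp
    assume "graph_dist Einf x y \<le> n + 1"
    then show "c3 / measure (graph_measure Xinf Einf) (graph_ball Xinf Einf x ?r)
             * exp (- C4 * real n * Phi_d \<Psi> (C5 * (real (graph_dist Einf x y) / real n)))
        \<le> heat_kernel Xinf Einf n x y + heat_kernel Xinf Einf (n + 1) x y"
      using H[OF M(1)] n M(2,3) unfolding HKE_bounds_with_def M(4-7) by simp
  qed
qed

lemma Vol_inf: assumes "x \<in> Xinf"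
  shows "\<exists>M0. \<exists>M\<ge>M0. \<exists>X bX. X < m M \<and> measure (graph_measure Xinf Einf) (graph_ball Xinf Einf x r) = Vol M X bX r \<and> 2 ^ M0 + r < 2 ^ M"
proof -
  obtain M0 M where M: "x \<in> XX M0" "2 ^ M0 + nat \<lceil>r\<rceil> < 2 ^ M" "M \<ge> 1" using choose_M[OF assms] by blast
  have p0: "(x, x) \<in> Einf ^^ 0" by simp
  obtain X bX where X: "X < m M" "x = vert X bX" using loc_nbrs[OF M p0] by (auto simp: XX_iff)
  have "r \<le> real (nat \<lceil>r\<rceil>)" by linarith
  then have "measure (graph_measure Xinf Einf) (graph_ball Xinf Einf x r) = Vol M X bX r"
    using loc_ball[OF M] measure_ball_M[of M X bX r] X by simp
  moreover have "(2::nat) ^ M0 < 2 ^ M" using M(2) by linarith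
  then have "M0 \<le> M" by simp
  moreover have "2 ^ M0 + r < 2 ^ M"
  proof -
    have "real (2 ^ M0 + nat \<lceil>r\<rceil>) < real (2 ^ M)" using M(2) by (simp only: of_nat_less_iff)
    then show ?thesis using \<open>r \<le> real (nat \<lceil>r\<rceil>)\<close> by simp
  qed
  ultimately show ?thesis using X by blast
qed

lemma EE_diam: "graph_diam (XX M) (EE M) \<le> ereal (2 * 2 ^ M)"
  unfolding graph_diam_def
proof (intro SUP_least)
  fix x y assume "x \<in> XX M" "y \<in> XX M"
  then obtain X bX Y bY where "X < m M" "Y < m M" "x = vert X bX" "y = vert Y bY" by (auto simp: XX_iff)
  then have "graph_dist (EE M) x y \<le> 2 * 2 ^ M" using ds_diam[of X M Y bX bY] by (simp add: ds_def)
  then have "real (graph_dist (EE M) x y) \<le> real (2 * 2 ^ M)" by (simp only: of_nat_le_iff)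
  then show "ereal (real (graph_dist (EE M) x y)) \<le> ereal (2 * 2 ^ M)" by simp
qed

end

section \<open>Heat kernel bounds in terms of volume and time scale\<close>

locale scaled_blocks = glued_blocks +
  fixes V \<Psi> :: "real \<Rightarrow> real" and cV cP CV CP c0 :: real
  assumes V_mono: "1 \<le> r \<Longrightarrow> r \<le> R \<Longrightarrow> V r \<le> V R" and V_1: "V 1 = 1"
    and P_mono: "1 \<le> r \<Longrightarrow> r < R \<Longrightarrow> \<Psi> r < \<Psi> R" and P_1: "\<Psi> 1 = 1"
    and P_surj: "1 \<le> y \<Longrightarrow> \<exists>x\<ge>1. \<Psi> x = y"
    and V_dbl: "1 \<le> r \<Longrightarrow> V (2 * r) \<le> CV * V r" and P_dbl: "1 \<le> r \<Longrightarrow> \<Psi> (2 * r) \<le> CP * \<Psi> r"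
    and P_low: "1 \<le> r \<Longrightarrow> r \<le> R \<Longrightarrow> c0 * (R / r)\<^sup>2 * \<Psi> r \<le> \<Psi> R"
    and cst: "1 \<le> cV" "1 \<le> cP" "1 \<le> CV" "1 \<le> CP" "0 < c0"
    and m_le: "real (m k) \<le> cV * V (2 ^ k)" and V_le: "V (2 ^ k) \<le> cV * real (m k)"
    and t_le: "real (t k) \<le> cP * \<Psi> (2 ^ k)" and P_le: "\<Psi> (2 ^ k) \<le> cP * real (t k)"
begin

section \<open>Comparison of the blocks with the given scales\<close>

lemma P_mono_le: "1 \<le> r \<Longrightarrow> r \<le> R \<Longrightarrow> \<Psi> r \<le> \<Psi> R"
  using P_mono[of r R] by (cases "r = R") auto
lemma V_ge1: "1 \<le> r \<Longrightarrow> 1 \<le> V r" using V_mono[of 1 r] V_1 by simp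
lemma P_ge1: "1 \<le> r \<Longrightarrow> 1 \<le> \<Psi> r" using P_mono_le[of 1 r] P_1 by simp

definition rho :: "nat \<Rightarrow> real" where "rho n = inv_into {1..} \<Psi> (real n)"

lemma rho: assumes "1 \<le> n" shows "1 \<le> rho n" "\<Psi> (rho n) = real n"
proof -
  obtain x where "1 \<le> x" "\<Psi> x = real n" using P_surj[of "real n"] assms by auto
  then have "real n \<in> \<Psi> ` {1..}" by (metis atLeast_iff imageI)
  then show "1 \<le> rho n" "\<Psi> (rho n) = real n"
    unfolding rho_def using inv_into_into[of "real n" \<Psi> "{1..}"] f_inv_into_f[of "real n" \<Psi> "{1..}"] by auto
qed

lemma pow2_ge1: "1 \<le> (2::real) ^ k" by simp

lemma V_dbl_pow: "1 \<le> r \<Longrightarrow> V (2 ^ j * r) \<le> CV ^ j * V r"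
proof (induction j)
  case (Suc j)
  have "1 \<le> 2 ^ j * r" using mult_mono[of 1 "2 ^ j" 1 r] Suc.prems by simp
  then have "V (2 * (2 ^ j * r)) \<le> CV * V (2 ^ j * r)" by (rule V_dbl)
  also have "\<dots> \<le> CV * (CV ^ j * V r)" using Suc cst by (intro mult_left_mono) auto
  finally show ?case by (simp add: mult.assoc)
qed simp

lemma P_low_pow: "1 \<le> r \<Longrightarrow> c0 * 4 ^ j * \<Psi> r \<le> \<Psi> (2 ^ j * r)"
proof -
  assume r: "1 \<le> r"
  have "r \<le> 2 ^ j * r" using mult_right_mono[of 1 "2 ^ j" r] r by simp
  from P_low[OF r this] have "c0 * (2 ^ j)\<^sup>2 * \<Psi> r \<le> \<Psi> (2 ^ j * r)" using r by simp
  moreover have "((2::real) ^ j)\<^sup>2 = 4 ^ j" by (simp add: power2_eq_square power_mult_distrib[symmetric])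
  ultimately show ?thesis by simp
qed

text \<open>Since \<Psi> grows at least quadratically, a constant multiple of \<open>t k\<close>
  moves \<open>rho n\<close> beyond \<open>2 ^ k\<close> by boundedly many doublings, which
  \<open>V\<close> absorbs.\<close>

lemma rho_up: "\<exists>C>0. \<forall>n\<ge>1. \<forall>k. real n \<le> Q * real (t k) \<longrightarrow> V (rho n) \<le> C * real (m k)"
proof -
  obtain j where j: "\<bar>Q\<bar> * cP / c0 < 4 ^ j" using real_arch_pow[of "4::real"] by auto
  have "V (rho n) \<le> CV ^ j * cV * real (m k)" if n: "1 \<le> n" and Q: "real n \<le> Q * real (t k)" for n k
  proof -
    have "rho n \<le> 2 ^ j * 2 ^ k"
    proof (rule ccontr)
      assume nle: "\<not> rho n \<le> 2 ^ j * 2 ^ k"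
      have "1 \<le> (2::real) ^ j * 2 ^ k" using mult_mono[of 1 "(2::real) ^ j" 1 "2 ^ k"] by simp
      then have "\<Psi> (2 ^ j * 2 ^ k) < real n" using P_mono[of "2 ^ j * 2 ^ k" "rho n"] nle rho[OF n] by simp
      moreover have "c0 * 4 ^ j * \<Psi> (2 ^ k) \<le> \<Psi> (2 ^ j * 2 ^ k)" by (rule P_low_pow) simp
      moreover have "real n \<le> \<bar>Q\<bar> * cP * \<Psi> (2 ^ k)"
      proof -
        have "real n \<le> \<bar>Q\<bar> * real (t k)" using Q by (rule order_trans) (intro mult_right_mono, auto)
        also have "\<dots> \<le> \<bar>Q\<bar> * (cP * \<Psi> (2 ^ k))" by (intro mult_left_mono t_le) auto
        finally show ?thesis by (simp add: mult.assoc)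
      qed
      moreover have "\<bar>Q\<bar> * cP * \<Psi> (2 ^ k) \<le> c0 * 4 ^ j * \<Psi> (2 ^ k)"
        using j cst P_ge1[of "2 ^ k"] by (intro mult_right_mono) (auto simp: field_simps)
      ultimately show False by linarith
    qed
    then have "V (rho n) \<le> V (2 ^ j * 2 ^ k)" using rho[OF n] by (intro V_mono) auto
    also have "\<dots> \<le> CV ^ j * V (2 ^ k)" by (rule V_dbl_pow) simp
    also have "\<dots> \<le> CV ^ j * (cV * real (m k))" using cst by (intro mult_left_mono V_le) auto
    finally show ?thesis by simp
  qed
  moreover have "0 < CV ^ j * cV" using cst by (intro mult_pos_pos zero_less_power) auto
  ultimately show ?thesis by blast
qed

lemma rho_lo: "\<exists>C>0. \<forall>n k. t k \<le> n \<longrightarrow> real (m k) \<le> C * V (rho n)"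
proof -
  obtain j where j: "cP / c0 < 4 ^ j" using real_arch_pow[of "4::real"] by auto
  have "real (m k) \<le> (cV * CV ^ j) * V (rho n)" if k: "t k \<le> n" for n k
  proof -
    have n: "1 \<le> n" using k t_pos[of k] by linarith
    note r = rho[OF n]
    have "2 ^ k \<le> 2 ^ j * rho n"
    proof (rule ccontr)
      assume c: "\<not> 2 ^ k \<le> 2 ^ j * rho n"
      have "1 \<le> 2 ^ j * rho n" using mult_mono[of 1 "2 ^ j" 1 "rho n"] r by simp
      then have "\<Psi> (2 ^ j * rho n) < \<Psi> (2 ^ k)" using c by (intro P_mono) auto
      moreover have "c0 * 4 ^ j * \<Psi> (rho n) \<le> \<Psi> (2 ^ j * rho n)" by (rule P_low_pow[OF r(1)])
      moreover have "\<Psi> (2 ^ k) \<le> cP * real n"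
        by (rule order_trans[OF P_le]) (use k cst in \<open>auto intro!: mult_left_mono\<close>)
      moreover have "cP * real n < c0 * 4 ^ j * \<Psi> (rho n)"
        using j cst n unfolding r(2) by (intro mult_strict_right_mono) (auto simp: field_simps)
      ultimately show False by linarith
    qed
    then have "V (2 ^ k) \<le> V (2 ^ j * rho n)" by (intro V_mono) auto
    also have "\<dots> \<le> CV ^ j * V (rho n)" by (rule V_dbl_pow[OF r(1)])
    finally have "cV * V (2 ^ k) \<le> cV * (CV ^ j * V (rho n))" using cst by (intro mult_left_mono) auto
    then show ?thesis using m_le[of k] by simp
  qed
  moreover have "0 < cV * CV ^ j" using cst by (intro mult_pos_pos zero_less_power) auto
  ultimately show ?thesis by blast
qed

section \<open>Ball volumes and the function \<open>V\<close>\<close>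

lemma Vol_ge1: assumes "X < m M" "0 < r" shows "1 \<le> Vol M X bX r"
proof -
  have "1 = HS M (delta M X bX)" by (rule HS_delta[OF assms(1), symmetric])
  also have "\<dots> \<le> Vol M X bX r"
    unfolding Vol_def
  proof (rule HS_mono)
    fix e b assume e: "e < m M"
    show "delta M X bX e b \<le> (if real (ds M X bX e b) < r then 1 else 0)"
    proof (cases "b = bX \<and> e \<in> Cl M X bX")
      case True
      then have "vert X bX = vert e b" using vert_eq_Cl[OF assms(1) e, of bX b] by simp
      then have "ds M X bX e b = 0" using ds_le[of X bX e b 0 M] by simp
      then show ?thesis using True assms card_Cl_pos[of M X bX] by (simp add: delta_def)
    next
      case False then show ?thesis by (auto simp: delta_def)
    qed
  qed
  finally show ?thesis .
qed

lemma dyadic: assumes "1 \<le> (r::real)" obtains l where "2 ^ l \<le> r" "r < 2 ^ Suc l"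
proof -
  obtain n where n: "r < 2 ^ n" using real_arch_pow[of "2::real" r] by auto
  let ?n = "LEAST n. r < 2 ^ n"
  have 1: "r < 2 ^ ?n" using n by (rule LeastI)
  have "?n \<noteq> 0" using 1 assms by (cases "?n") auto
  then obtain l where l: "?n = Suc l" by (cases ?n) auto
  then have "\<not> r < 2 ^ l" using not_less_Least[of l "\<lambda>n. r < 2 ^ n"] by simp
  then show ?thesis using that[of l] 1 l by simp
qed

lemma Vol_le_V: assumes "X < m M" "1 \<le> r" shows "Vol M X bX r \<le> 2 * real (D ^ 3) * cV * CV * V r"
proof -
  obtain l where l: "2 ^ l \<le> r" "r < 2 ^ Suc l" using dyadic[OF assms(2)] by blast
  have Dge: "1 \<le> real (D ^ 3)" using D_ge2 one_le_power[of "real D" 3] by simp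
  show ?thesis
  proof (cases "Suc l \<le> M")
    case True
    have "Vol M X bX r \<le> 2 * real (D ^ 3) * m (Suc l)" by (rule Vol_upper[OF True assms(1)]) (use l in simp)
    also have "\<dots> \<le> 2 * real (D ^ 3) * (cV * V (2 ^ Suc l))" by (intro mult_left_mono m_le) simp
    also have "\<dots> \<le> 2 * real (D ^ 3) * (cV * (CV * V r))"
    proof -
      have "V (2 ^ Suc l) \<le> V (2 * r)" using V_mono[OF pow2_ge1[of "Suc l"], of "2 * r"] l by simp
      also have "V (2 * r) \<le> CV * V r" by (rule V_dbl) fact
      finally show ?thesis using cst by (intro mult_left_mono) auto
    qed
    finally show ?thesis by (simp add: mult.assoc)
  next
    case False
    then have "M \<le> l" by simp
    then have "(2::real) ^ M \<le> 2 ^ l" by (intro power_increasing) auto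
    from order_trans[OF this l(1)] have "V (2 ^ M) \<le> V r" by (intro V_mono) auto
    have "Vol M X bX r \<le> 2 * m M" by (rule Vol_le)
    also have "\<dots> \<le> 2 * (cV * V (2 ^ M))" using m_le[of M] by simp
    also have "\<dots> \<le> 2 * (cV * V r)" using \<open>V (2 ^ M) \<le> V r\<close> cst by (intro mult_left_mono) auto
    also have "\<dots> \<le> (2 * (cV * V r)) * (real (D ^ 3) * CV)"
    proof -
      have "1 * 1 \<le> real (D ^ 3) * CV" using Dge cst by (intro mult_mono) auto
      moreover have "0 \<le> 2 * (cV * V r)" using cst V_ge1[OF assms(2)] by simp
      ultimately show ?thesis using mult_left_mono[of 1 "real (D ^ 3) * CV" "2 * (cV * V r)"] by simp
    qed
    finally show ?thesis by (simp add: algebra_simps)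
  qed
qed

lemma V_le_Vol: assumes X: "X < m M" and r: "1 \<le> r" "r \<le> 2 * 2 ^ M"
  shows "V r \<le> cV * CV ^ 2 * Vol M X bX r"
proof (cases "r \<le> 2")
  case True
  have "V r \<le> V (2 ^ 1 * 1)" using r True by (intro V_mono) auto
  also have "\<dots> \<le> CV ^ 1 * V 1" by (rule V_dbl_pow) simp
  also have "\<dots> \<le> cV * CV ^ 2 * 1"
    using cst mult_mono[of 1 "cV * CV" CV CV] mult_mono[of 1 cV 1 CV] by (simp add: V_1 power2_eq_square mult.assoc)
  also have "\<dots> \<le> cV * CV ^ 2 * Vol M X bX r"
    using cst r by (intro mult_left_mono Vol_ge1 X) auto
  finally show ?thesis .
next
  case False
  have "1 \<le> r / 2" using False by simp
  obtain l where l: "2 ^ l \<le> r / 2" "r / 2 < 2 ^ Suc l" using dyadic[OF \<open>1 \<le> r / 2\<close>] by blast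
  \<comment> \<open>\<open>Vol_lower\<close> requires \<open>2 * 2 ^ l < r\<close> strictly, so in
    the case of equality the next smaller level is used.\<close>
  show ?thesis
  proof (cases "2 ^ l = r / 2")
    case False
    have "(2::real) ^ l \<le> 2 ^ M" using l r by linarith
    then have lM: "l \<le> M" by simp
    have "V r \<le> V (2 ^ 2 * 2 ^ l)" using r l by (intro V_mono) auto
    also have "\<dots> \<le> CV ^ 2 * V (2 ^ l)" by (rule V_dbl_pow) simp
    also have "\<dots> \<le> CV ^ 2 * (cV * m l)" by (intro mult_left_mono V_le) simp
    also have "\<dots> \<le> CV ^ 2 * (cV * Vol M X bX r)"
      using Vol_lower[OF lM X, of r bX] l False cst by (intro mult_left_mono) auto
    finally show ?thesis by (simp add: algebra_simps)
  next
    case True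
    then obtain l' where l': "l = Suc l'" using \<open>\<not> r \<le> 2\<close> by (cases l) auto
    have "(2::real) ^ l \<le> 2 ^ M" using l r by linarith
    then have "l \<le> M" by simp
    then have lM: "l' \<le> M" using l' by simp
    have "V r = V (2 ^ 2 * 2 ^ l')" using True l' by (intro arg_cong[of _ _ V]) simp
    also have "\<dots> \<le> CV ^ 2 * V (2 ^ l')" by (rule V_dbl_pow) simp
    also have "\<dots> \<le> CV ^ 2 * (cV * m l')" by (intro mult_left_mono V_le) simp
    also have "\<dots> \<le> CV ^ 2 * (cV * Vol M X bX r)"
      using Vol_lower[OF lM X, of r bX] True l' cst by (intro mult_left_mono) auto
    finally show ?thesis by (simp add: algebra_simps)
  qed
qed

text \<open>On a finite block \<open>rho n\<close> may exceed the diameter; then the ball is the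
  whole block, whose volume dominates \<open>m k\<close>.\<close>

lemma Vol_rho: "\<exists>C>0. \<forall>n k M X bX. t k \<le> n \<longrightarrow> k \<le> M \<longrightarrow> X < m M \<longrightarrow> real (m k) \<le> C * Vol M X bX (rho n)"
proof -
  obtain C where C: "0 < C" "\<And>n k. t k \<le> n \<Longrightarrow> real (m k) \<le> C * V (rho n)" using rho_lo by blast
  let ?C = "C * (cV * CV ^ 2) + 1"
  have "real (m k) \<le> ?C * Vol M X bX (rho n)" if k: "t k \<le> n" "k \<le> M" "X < m M" for n k M X bX
  proof -
    have n: "1 \<le> n" using k t_pos[of k] by linarith
    have V0: "0 \<le> Vol M X bX (rho n)" using Vol_ge1[OF k(3), of "rho n" bX] rho(1)[OF n] by simp
    have c: "0 \<le> C * (cV * CV ^ 2)" using C cst by simp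
    show ?thesis
    proof (cases "rho n \<le> 2 * 2 ^ M")
      case True
      have "real (m k) \<le> C * V (rho n)" by (rule C(2)[OF k(1)])
      also have "\<dots> \<le> C * (cV * CV ^ 2 * Vol M X bX (rho n))"
        using C V_le_Vol[OF k(3) rho(1)[OF n] True] by (intro mult_left_mono) auto
      finally show ?thesis using V0 by (simp add: algebra_simps)
    next
      case False
      have "real (2 * m M) \<le> Vol M X bX (rho n)" by (rule Vol_lower[OF order_refl k(3)]) (use False in simp)
      moreover have "real (m k) \<le> m M" using m_mono[OF k(2)] by simp
      ultimately have "real (m k) \<le> 1 * Vol M X bX (rho n)" by simp
      also have "\<dots> \<le> ?C * Vol M X bX (rho n)" using c V0 by (intro mult_right_mono) auto
      finally show ?thesis .
    qed
  qed
  moreover have "0 < ?C" using C cst by (intro add_nonneg_pos) auto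
  ultimately show ?thesis by blast
qed

section \<open>The function \<open>Phi_d\<close> and the upper estimate\<close>

lemma Phi_bdd: "0 \<le> s \<Longrightarrow> bdd_above ((\<lambda>r. s / r - 1 / \<Psi> r) ` {1..})"
proof (rule bdd_aboveI2)
  fix r :: real assume *: "0 \<le> s" "r \<in> {1..}"
  then have "s / r \<le> s" using divide_left_mono[of 1 r s] by simp
  moreover have "0 \<le> 1 / \<Psi> r" using P_ge1[of r] * by simp
  ultimately show "s / r - 1 / \<Psi> r \<le> s" by linarith
qed

lemma Phi_ge: "0 \<le> s \<Longrightarrow> 1 \<le> r \<Longrightarrow> s / r - 1 / \<Psi> r \<le> Phi_d \<Psi> s"
  unfolding Phi_d_def by (rule cSUP_upper[OF _ Phi_bdd]) auto

lemma Phi_le: "(\<And>r. 1 \<le> r \<Longrightarrow> s / r - 1 / \<Psi> r \<le> L) \<Longrightarrow> Phi_d \<Psi> s \<le> L"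
  unfolding Phi_d_def by (rule cSUP_least) auto

lemma Phi_nonneg: "0 \<le> s \<Longrightarrow> 0 \<le> Phi_d \<Psi> s"
proof (rule ccontr)
  assume s: "0 \<le> s" and n: "\<not> 0 \<le> Phi_d \<Psi> s"
  let ?y = "max 1 (1 / - Phi_d \<Psi> s)"
  have p: "0 < - Phi_d \<Psi> s" using n by simp
  have "1 / - Phi_d \<Psi> s \<le> ?y" by simp
  then have "1 \<le> ?y * - Phi_d \<Psi> s" by (simp only: pos_divide_le_eq[OF p])
  then have "1 / ?y \<le> - Phi_d \<Psi> s" by (subst pos_divide_le_eq) (auto simp: mult.commute)
  moreover have "1 \<le> 2 * ?y" using max.cobounded1[of 1 "1 / - Phi_d \<Psi> s"] by linarith
  then obtain r where r: "1 \<le> r" "\<Psi> r = 2 * ?y" using P_surj[of "2 * ?y"] by blast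
  have "0 - 1 / \<Psi> r \<le> Phi_d \<Psi> s"
    using Phi_ge[OF s r(1)] s r(1) divide_nonneg_nonneg[of s r] by linarith
  moreover have "1 / \<Psi> r < 1 / ?y" unfolding r(2) by (intro divide_strict_left_mono) auto
  ultimately show False by linarith
qed

lemma kern_sup_mono: assumes "\<And>y by. y < m M \<Longrightarrow> kern M n x bx y by \<le> S"
  shows "y < m M \<Longrightarrow> kern M (n + j) x bx y by \<le> S"
proof (induction j arbitrary: y "by")
  case (Suc j)
  have "walk M (kern M (n + j) x bx) y by \<le> walk M (\<lambda>_ _. S) y by"
    by (rule walk_mono[OF Suc.prems]) (rule Suc.IH)
  then show ?case by (simp add: kern_Suc)
qed (use assms in simp)

lemma t_Suc_le: "t (Suc k) \<le> 2 * D * t k"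
proof -
  have "a k * 1 \<le> a k * f k" using f_ge1[of k] by (intro mult_le_mono2)
  also have "\<dots> \<le> D" by (rule af_le)
  finally show ?thesis by (simp add: t_Suc)
qed

text \<open>\<open>S\<close> comes from folding onto the largest block that has mixed by half the
  time. By maximality \<open>n\<close> is at most a multiple of \<open>t k\<close>, so the ball of
  radius \<open>rho n\<close> has volume of order \<open>m k\<close>. Exceptions are times too short
  even for level 0, where \<open>S = 1\<close>, and the whole graph being mixed, where the ball has
  volume at most \<open>2 * m M\<close>.\<close>

lemma sup_bound: "\<exists>C>0. \<forall>M n. 1 \<le> n \<longrightarrow> (\<exists>S>0. (\<forall>x y bx by. x < m M \<longrightarrow> y < m M \<longrightarrow> kern M (n div 2) x bx y by \<le> S) \<and>
    (\<forall>X bX. X < m M \<longrightarrow> S * Vol M X bX (rho n) \<le> C))"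
proof -
  let ?K = "real ((4 * mix_const + 4) * (2 * D))"
  obtain C where C: "0 < C" "\<And>n k. 1 \<le> n \<Longrightarrow> real n \<le> ?K * real (t k) \<Longrightarrow> V (rho n) \<le> C * real (m k)"
    using rho_up[of ?K] by blast
  define E where "E = 2 * real (D ^ 3) * cV * CV"
  have "0 < E" using cst D_ge2 by (simp add: E_def)
  then have EC: "0 < E * C" "0 \<le> E" using C(1) by simp_all
  let ?C = "2 * (E * C) + 3"
  have "\<exists>S>0. (\<forall>x y bx by. x < m M \<longrightarrow> y < m M \<longrightarrow> kern M (n div 2) x bx y by \<le> S) \<and>
    (\<forall>X bX. X < m M \<longrightarrow> S * Vol M X bX (rho n) \<le> ?C)" if n: "1 \<le> n" for n M
  proof -
    have vol: "2 / real (m k) * Vol M X bX (rho n) \<le> ?C" if "real n \<le> ?K * real (t k)" "X < m M" for k X bX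
    proof -
      have "Vol M X bX (rho n) \<le> E * V (rho n)" unfolding E_def by (rule Vol_le_V[OF that(2) rho(1)[OF n]])
      also have "\<dots> \<le> E * (C * real (m k))" by (intro mult_left_mono C(2)[OF n that(1)] EC(2))
      finally have "2 / real (m k) * Vol M X bX (rho n) \<le> 2 / real (m k) * (E * (C * real (m k)))"
        by (intro mult_left_mono) auto
      also have "\<dots> = 2 * (E * C)" using m_pos[of k] by simp
      finally show ?thesis by simp
    qed
    show ?thesis
    proof (cases "2 * mix_const * t 0 + 1 \<le> n div 2")
      case False
      then have "n \<le> 4 * mix_const + 4" by simp
      also have "\<dots> \<le> (4 * mix_const + 4) * (2 * D)" using D_ge2 by simp
      finally have "real n \<le> real ((4 * mix_const + 4) * (2 * D))" by (rule of_nat_mono)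
      then have n0: "real n \<le> ?K * real (t 0)" by simp
      have "1 * Vol M X bX (rho n) \<le> ?C" if X: "X < m M" for X bX
      proof -
        have "0 \<le> Vol M X bX (rho n)" using Vol_ge1[OF X, of "rho n" bX] rho(1)[OF n] by simp
        then show ?thesis using vol[OF n0 X, of bX] by simp
      qed
      then show ?thesis using kern_le_1 by (intro exI[of _ 1]) auto
    next
      case True
      let ?Q = "\<lambda>k. k \<le> M \<and> 2 * mix_const * t k + 1 \<le> n div 2"
      let ?k = "GREATEST k. ?Q k"
      have k: "?Q ?k" by (rule GreatestI_nat[of ?Q 0 M]) (use True in auto)
      have gr: "?Q j \<Longrightarrow> j \<le> ?k" for j by (rule Greatest_le_nat[of ?Q j M]) auto
      have S: "kern M (n div 2) x bx y by \<le> 3 / (2 * m ?k)" if "x < m M" "y < m M" for x y bx "by"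
        by (rule kern_le_fold) (use k that in auto)
      have "3 / (2 * real (m ?k)) * Vol M X bX (rho n) \<le> ?C" if X: "X < m M" for X bX
      proof (cases "?k = M")
        case True
        have "3 / (2 * real (m M)) * Vol M X bX (rho n) \<le> 3 / (2 * real (m M)) * (2 * m M)"
          by (intro mult_left_mono Vol_le) simp
        also have "\<dots> = 3" using m_pos[of M] by simp
        also have "\<dots> \<le> ?C" using EC by linarith
        finally show ?thesis using True by simp
      next
        case False
        then have "Suc ?k \<le> M" using k by simp
        then have "\<not> 2 * mix_const * t (Suc ?k) + 1 \<le> n div 2" using gr[of "Suc ?k"] by auto
        then have "n \<le> 4 * mix_const * t (Suc ?k) + 4" by simp
        also have "\<dots> \<le> (4 * mix_const + 4) * t (Suc ?k)" using t_pos[of "Suc ?k"] by (simp add: algebra_simps)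
        also have "\<dots> \<le> (4 * mix_const + 4) * (2 * D * t ?k)" by (intro mult_left_mono t_Suc_le) simp
        finally have "n \<le> (4 * mix_const + 4) * (2 * D) * t ?k" by (simp add: mult.assoc)
        then have "real n \<le> real ((4 * mix_const + 4) * (2 * D) * t ?k)" by (rule of_nat_mono)
        then have "2 / real (m ?k) * Vol M X bX (rho n) \<le> ?C" by (intro vol X) simp
        moreover have "3 / (2 * real (m ?k)) * Vol M X bX (rho n) \<le> 2 / real (m ?k) * Vol M X bX (rho n)"
          using Vol_ge1[OF X, of "rho n" bX] rho(1)[OF n] m_pos[of ?k] by (intro mult_right_mono) (auto simp: field_simps)
        ultimately show ?thesis by linarith
      qed
      then show ?thesis using S m_pos[of ?k] by (intro exI[of _ "3 / (2 * real (m ?k))"]) auto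
    qed
  qed
  moreover have "0 < ?C" using EC by linarith
  ultimately show ?thesis by blast
qed

text \<open>As \<open>Phi_d\<close> is a supremum over \<open>r\<close>, a bound for each
  \<open>r\<close> separately suffices. For \<open>2 ^ l \<le> r < 2 ^ Suc l\<close> it is the
  off-diagonal bound at level \<open>l\<close>, where \<open>1 / t l \<le> q / \<Psi> r\<close> and
  the base 2 contributes \<open>ln 2 / 2\<close>. If \<open>l > M\<close>, the distance is at most
  \<open>2 * r\<close>, and the exponential is at least \<open>1 / 2\<close>.\<close>

lemma HKE_upper: "\<exists>C1>0. \<exists>c1>0. \<exists>c2>0. \<forall>M n X bX Y bY. 1 \<le> n \<longrightarrow> X < m M \<longrightarrow> Y < m M \<longrightarrow>
    kern M n X bX Y bY \<le> C1 / Vol M X bX (rho n) * exp (- c1 * real n * Phi_d \<Psi> (c2 * (real (ds M X bX Y bY) / real n)))"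
proof -
  obtain C where C: "0 < C" "\<And>M n. 1 \<le> n \<Longrightarrow> \<exists>S>0. (\<forall>x y bx by. x < m M \<longrightarrow> y < m M \<longrightarrow> kern M (n div 2) x bx y by \<le> S) \<and>
    (\<forall>X bX. X < m M \<longrightarrow> S * Vol M X bX (rho n) \<le> C)" using sup_bound by blast
  define q where "q = CP * cP"
  let ?c2 = "ln 2 / 2 / q"
  let ?C1 = "16 * C"
  have c1: "1 \<le> q" using cst mult_mono[of 1 CP 1 cP] by (simp add: q_def)
  have l2: "0 < ln (2::real)" by simp
  have cc: "q * ?c2 = ln 2 / 2" using c1 by simp
  have "kern M n X bX Y bY \<le> ?C1 / Vol M X bX (rho n) * exp (- q * real n * Phi_d \<Psi> (?c2 * (real (ds M X bX Y bY) / real n)))"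
    if n: "1 \<le> n" and X: "X < m M" and Y: "Y < m M" for M n X bX Y bY
  proof -
    let ?k = "kern M n X bX Y bY" and ?v = "Vol M X bX (rho n)" and ?d = "real (ds M X bX Y bY)"
    obtain S where S: "S > 0" "\<And>x y bx by. x < m M \<Longrightarrow> y < m M \<Longrightarrow> kern M (n div 2) x bx y by \<le> S"
      "S * ?v \<le> C" using C(2)[OF n, of M] X by blast
    have v1: "1 \<le> ?v" using Vol_ge1[OF X, of "rho n" bX] rho(1)[OF n] by simp
    have kS: "?k \<le> S"
    proof -
      have "kern M (n div 2 + (n - n div 2)) X bX Y bY \<le> S" by (rule kern_sup_mono[OF S(2)[OF X] Y])
      then show ?thesis by simp
    qed
    have key: "?v * ?k \<le> ?C1 * exp (- (q * real n * (?c2 * (?d / real n) / r - 1 / \<Psi> r)))" if r: "1 \<le> r" for r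
    proof -
      have e: "q * real n * (?c2 * (?d / real n) / r - 1 / \<Psi> r) = ln 2 / 2 * (?d / r) - q * (real n / \<Psi> r)"
      proof -
        have "q * real n * (?c2 * (?d / real n) / r - 1 / \<Psi> r) = (q * ?c2) * (real n / real n) * (?d / r) - q * (real n / \<Psi> r)"
          by (simp add: field_simps)
        then show ?thesis using n unfolding cc by simp
      qed
      obtain l where l: "2 ^ l \<le> r" "r < 2 ^ Suc l" using dyadic[OF r] by blast
      have P0: "0 < \<Psi> r" using P_ge1[OF r] by simp
      show ?thesis
      proof (cases "l \<le> M")
        case True
        have "\<Psi> r \<le> \<Psi> (2 * 2 ^ l)" using r l by (intro P_mono_le) auto
        also have "\<dots> \<le> CP * \<Psi> (2 ^ l)" by (rule P_dbl) simp
        also have "\<dots> \<le> CP * (cP * real (t l))" using cst by (intro mult_left_mono P_le) auto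
        finally have "\<Psi> r \<le> q * t l" by (simp add: q_def)
        then have n1: "real n / t l \<le> q * (real n / \<Psi> r)"
        proof -
          assume a: "\<Psi> r \<le> q * t l"
          have "real n / t l = q * real n / (q * t l)" using c1 by simp
          also have "\<dots> \<le> q * real n / \<Psi> r" using a P0 c1 t_pos[of l] by (intro divide_left_mono) auto
          finally show ?thesis by simp
        qed
        have d1: "?d / r \<le> ?d / 2 ^ l" using l by (intro divide_left_mono) auto
        have "?v * ?k \<le> ?v * (16 * S * exp (real n / t l) * 2 powr (- ?d / (2 * 2 ^ l)))"
          using v1 by (intro mult_left_mono kern_off[OF True X Y S(2)]) auto
        also have "\<dots> = 16 * (S * ?v) * (exp (real n / t l) * 2 powr (- ?d / (2 * 2 ^ l)))" by simp
        also have "\<dots> \<le> 16 * C * (exp (real n / t l) * 2 powr (- ?d / (2 * 2 ^ l)))"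
          using S by (intro mult_right_mono) auto
        also have "exp (real n / t l) * 2 powr (- ?d / (2 * 2 ^ l)) = exp (real n / t l - ln 2 / 2 * (?d / 2 ^ l))"
        proof -
          have "2 powr (- ?d / (2 * 2 ^ l)) = exp (- (ln 2 / 2 * (?d / 2 ^ l)))"
            by (simp add: powr_def mult.commute)
          then show ?thesis by (simp only: exp_add[symmetric]) simp
        qed
        also have "\<dots> \<le> exp (- (ln 2 / 2 * (?d / r) - q * (real n / \<Psi> r)))"
        proof -
          have "ln 2 / 2 * (?d / r) \<le> ln 2 / 2 * (?d / 2 ^ l)" by (rule mult_left_mono[OF d1]) simp
          then show ?thesis using n1 by simp
        qed
        finally show ?thesis unfolding e using C by (simp add: mult_left_mono)
      next
        case False
        then have "(2::real) ^ M \<le> 2 ^ l" by (intro power_increasing) auto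
        moreover have "?d \<le> real (2 * 2 ^ M)" using ds_diam[OF X Y, of bX bY] by (simp only: of_nat_le_iff)
        then have "?d \<le> 2 * 2 ^ M" by simp
        ultimately have "?d \<le> 2 * r" using l(1) by linarith
        then have "?d / r \<le> 2" using r by (simp add: divide_le_eq)
        then have "ln 2 / 2 * (?d / r) \<le> ln 2 / 2 * 2" by (rule mult_left_mono) simp
        moreover have "0 \<le> q * (real n / \<Psi> r)" using c1 P0 by simp
        ultimately have "- ln 2 \<le> - (ln 2 / 2 * (?d / r) - q * (real n / \<Psi> r))" by simp
        then have "exp (- ln 2) \<le> exp (- (ln 2 / 2 * (?d / r) - q * (real n / \<Psi> r)))" by simp
        then have h: "1 / 2 \<le> exp (- (ln 2 / 2 * (?d / r) - q * (real n / \<Psi> r)))" by (simp add: exp_minus)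
        have "?v * ?k \<le> ?v * S" using v1 kS by (intro mult_left_mono) auto
        also have "\<dots> \<le> C" using S by (simp add: mult.commute)
        also have "\<dots> \<le> ?C1 * (1 / 2)" using C by simp
        also have "\<dots> \<le> ?C1 * exp (- (ln 2 / 2 * (?d / r) - q * (real n / \<Psi> r)))" using C h by (intro mult_left_mono) auto
        finally show ?thesis unfolding e .
      qed
    qed
    show ?thesis
    proof (cases "?k = 0")
      case True then show ?thesis using v1 C by simp
    next
      case False
      then have k0: "0 < ?k" using kern_nonneg[OF Y, of n X bX bY] by simp
      \<comment> \<open>Logarithms turn the family of bounds over \<open>r\<close> into an upper
        bound of the set whose supremum is \<open>Phi_d\<close>; this needs a positive
        kernel.\<close>
      let ?L = "- ln (?v * ?k / ?C1)"
      have q0: "0 < ?v * ?k / ?C1" using v1 k0 C by simp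
      have cn: "0 < q * real n" using c1 n by simp
      have "?c2 * (?d / real n) / r - 1 / \<Psi> r \<le> ?L / (q * real n)" if r: "1 \<le> r" for r
      proof -
        have "?v * ?k / ?C1 \<le> exp (- (q * real n * (?c2 * (?d / real n) / r - 1 / \<Psi> r)))"
          using key[OF r] C by (simp add: divide_le_eq mult.commute)
        from iffD2[OF ln_le_cancel_iff[OF q0 exp_gt_zero] this]
        have "ln (?v * ?k / ?C1) \<le> - (q * real n * (?c2 * (?d / real n) / r - 1 / \<Psi> r))" by (simp only: ln_exp)
        then have "(?c2 * (?d / real n) / r - 1 / \<Psi> r) * (q * real n) \<le> ?L" by (simp only: mult.commute[of _ "q * real n"])
        then show ?thesis by (rule iffD2[OF pos_le_divide_eq[OF cn]])
      qed
      then have "Phi_d \<Psi> (?c2 * (?d / real n)) \<le> ?L / (q * real n)" by (rule Phi_le)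
      then have "Phi_d \<Psi> (?c2 * (?d / real n)) * (q * real n) \<le> ?L" by (rule iffD1[OF pos_le_divide_eq[OF cn]])
      then have "ln (?v * ?k / ?C1) \<le> - (Phi_d \<Psi> (?c2 * (?d / real n)) * (q * real n))" by linarith
      also have "\<dots> = - q * real n * Phi_d \<Psi> (?c2 * (?d / real n))" by simp
      finally have "ln (?v * ?k / ?C1) \<le> - q * real n * Phi_d \<Psi> (?c2 * (?d / real n))" .
      then have "exp (ln (?v * ?k / ?C1)) \<le> exp (- q * real n * Phi_d \<Psi> (?c2 * (?d / real n)))" by (simp only: exp_le_cancel_iff)
      then have "?v * ?k / ?C1 \<le> exp (- q * real n * Phi_d \<Psi> (?c2 * (?d / real n)))" using q0 by (simp only: exp_ln)
      then show ?thesis using v1 C by (simp add: field_simps)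
    qed
  qed
  moreover have "0 < ?C1" "0 < q" "0 < ?c2" using C c1 l2 by auto
  ultimately show ?thesis by blast
qed

end

section \<open>Lower bounds along chains of blocks and at short times\<close>

context glued_blocks begin

text \<open>The first summand pays for mixing within a block. With \<open>q = d div 2 ^ l\<close>,
  the second pays for \<open>2 * (q + 10)\<close> units of \<open>t l\<close> and one step:
  \<open>q + 3\<close> labels to reach the target block, and seven more to gain
  \<open>2 ^ 7\<close>, which exceeds \<open>4 * 24\<close>.\<close>

definition near_const :: nat where "near_const = 2 * mix_const + 22"

lemma exp_neg_le_pow2: assumes "real k \<le> x" shows "exp (- x) \<le> 1 / 2 ^ k"
proof -
  have "(2::real) ^ k \<le> exp 1 ^ k" using exp_ge_add_one_self[of 1] by (intro power_mono) auto
  also have "\<dots> = exp (real k)" by (simp add: exp_of_nat_mult[symmetric])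
  also have "\<dots> \<le> exp x" using assms by simp
  finally have "1 / exp x \<le> 1 / 2 ^ k" by (intro divide_left_mono) auto
  then show ?thesis by (simp add: exp_minus inverse_eq_divide)
qed

lemma exp_le_pow2: "exp (real k) \<le> 2 ^ (2 * k)"
proof -
  have "exp (real k) = exp 1 ^ k" by (simp add: exp_of_nat_mult[symmetric])
  also have "\<dots> \<le> 4 ^ k" using exp_le by (intro power_mono) auto
  also have "\<dots> = 2 ^ (2 * k)" by (simp add: power_mult)
  finally show ?thesis .
qed

lemma kern_near': assumes lM: "l \<le> M" and X: "X < m M" and Y: "Y < m M"
    and d: "ds M X bx Y bx \<le> d" and n: "near_const * t l * (d div 2 ^ l + 1) \<le> n"
  shows "1 / (4 * real (D ^ (4 * (n div t l) + 20)) * m l) \<le> kern M (n + n) X bx Y bx"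
proof -
  \<comment> \<open>Since \<open>exp (real n / t l) \<le> 2 ^ (2 * (n div t l) + 2)\<close>, the
    constant 9 leaves seven binary digits, again more than \<open>4 * 24\<close>. The value
    \<open>?j0\<close> is the least one for which \<open>reach\<close> admits all distances up to
    \<open>d\<close>.\<close>
  let ?q = "d div 2 ^ l" and ?j0 = "d div 2 ^ l + 3" and ?j1 = "2 * (n div t l) + 9"
  have t0: "1 \<le> t l" using t_pos[of l] by simp
  have e: "near_const * t l * (?q + 1) = 2 * mix_const * (t l * (?q + 1)) + 22 * (t l * (?q + 1))"
    by (simp only: near_const_def add_mult_distrib mult.assoc)
  have tq: "t l \<le> t l * (?q + 1)" by simp
  have n1: "2 * mix_const * t l + 2 \<le> n"
  proof -
    have "2 * mix_const * t l \<le> 2 * mix_const * (t l * (?q + 1))" using tq by (rule mult_le_mono2)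
    then show ?thesis using n e tq t0 by linarith
  qed
  have n2: "2 * t l * (?j0 + 7) \<le> n - 1"
  proof -
    have "2 * t l * (?j0 + 7) + 1 \<le> 22 * (t l * (?q + 1))" using t0 by (simp add: algebra_simps)
    then show ?thesis using n e by linarith
  qed
  have rt: "0 < real (t l)" using t_pos by simp
  show ?thesis
  proof (rule order_trans[OF _ kern_near[OF lM X Y n1, of ?j0 ?j1]])
    show "1 / (4 * real (D ^ (4 * (n div t l) + 20)) * m l) \<le> 1 / (4 * real (D ^ (2 * ?j1 + 2)) * m l)"
      by (simp add: algebra_simps)
    have "real (2 * t l * (?j0 + 7)) \<le> real (n - 1)" using n2 by (rule of_nat_mono)
    then have "real (?j0 + 7) \<le> real (n - 1) / (2 * t l)" using rt by (simp add: field_simps)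
    then have "exp (- (real (n - 1) / (2 * t l))) \<le> 1 / 2 ^ (?j0 + 7)" by (rule exp_neg_le_pow2)
    then have "2 ^ ?j0 * (4 * exp (- real (n - 1) / (2 * t l))) \<le> 2 ^ ?j0 * (4 * (1 / 2 ^ (?j0 + 7)))"
      by (intro mult_left_mono) simp_all
    also have "\<dots> \<le> 1 / 24" by (simp add: power_add)
    finally show "2 ^ ?j0 * (4 * exp (- real (n - 1) / (2 * t l))) \<le> 1 / 24" .
    have "n < t l * (n div t l) + t l" using dividend_less_times_div[OF t_pos, of n l] by linarith
    then have "n \<le> (n div t l + 1) * t l" by (simp add: algebra_simps)
    then have "real n \<le> real ((n div t l + 1) * t l)" by (rule of_nat_mono)
    then have "real n / t l \<le> real (n div t l + 1)" using rt by (simp add: divide_le_eq algebra_simps)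
    then have "exp (real n / t l) \<le> exp (real (n div t l + 1))" by simp
    also have "\<dots> \<le> 2 ^ (2 * (n div t l + 1))" by (rule exp_le_pow2)
    finally have "4 * exp (real n / t l) / 2 ^ ?j1 \<le> 4 * 2 ^ (2 * (n div t l + 1)) / 2 ^ ?j1"
      by (intro divide_right_mono mult_left_mono) auto
    also have "\<dots> \<le> 1 / 24" by (simp add: power_add)
    finally show "4 * exp (real n / t l) / 2 ^ ?j1 \<le> 1 / 24" .
    show "1 / D ^ ?j0 \<le> weight M l (X div m l) ?j0 (Y div m l)"
    proof (rule reach[OF lM X Y ds_path[OF X Y, of bx bx]])
      have "d < 2 ^ l * ?q + 2 ^ l" using dividend_less_times_div[of "2 ^ l" d] by simp
      then have "ds M X bx Y bx < (?q + 1) * 2 ^ l" using d by (simp add: algebra_simps)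
      then have "real (ds M X bx Y bx) < real ((?q + 1) * 2 ^ l)" by (simp only: of_nat_less_iff)
      then show "real (ds M X bx Y bx) < (real ?j0 - 2) * 2 ^ l" by (simp add: algebra_simps)
    qed simp
  qed simp
qed

lemma av_ge_const: "finite S \<Longrightarrow> S \<noteq> {} \<Longrightarrow> (\<And>x. x \<in> S \<Longrightarrow> c \<le> g x) \<Longrightarrow> c \<le> av S g"
  using av_mono[of S "\<lambda>_. c" g] av_const[of S "\<lambda>_. c" c] by simp

text \<open>An odd time is an even time followed by a step from a neighbour of the target, so the
  even bound is needed up to distance plus one.\<close>

lemma kern_two_step:
  assumes par: "even n \<longleftrightarrow> bX = bY" and X: "X < m M" and Y: "Y < m M"
    and low: "\<And>e. e < m M \<Longrightarrow> ds M X bX e bX \<le> ds M X bX Y bY + 1 \<Longrightarrow> c \<le> kern M (n div 2 + n div 2) X bX e bX"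
  shows "c \<le> kern M n X bX Y bY"
proof (cases "even n")
  case True
  then have "n = n div 2 + n div 2" by presburger
  then show ?thesis using low[OF Y] True par by simp
next
  case False
  then have n: "n = Suc (n div 2 + n div 2)" by presburger
  have b: "bX = (\<not> bY)" using False par by auto
  have "c \<le> walk M (kern M (n div 2 + n div 2) X bX) Y bY"
    unfolding walk_def
  proof (rule av_ge_const)
    fix e assume e: "e \<in> Cl M Y bY"
    have el: "e < m M" by (rule Cl_lt[OF Y e])
    have v: "vert Y bY = vert e bY" using vert_eq_Cl[OF Y el, of bY bY] e by simp
    have "(vert Y bY, vert e (\<not> bY)) \<in> EE M ^^ 1"
      unfolding v EE_def ES_def relpow_1 using el by blast
    from ds_tri[OF X Y this, of bX]
    show "c \<le> kern M (n div 2 + n div 2) X bX e (\<not> bY)" using low[OF el] b by simp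
  qed auto
  also have "\<dots> = kern M n X bX Y bY" by (subst (3) n) (simp add: kern_Suc)
  finally show ?thesis .
qed

lemma kern_lower: assumes lM: "l \<le> M" and X: "X < m M" and Y: "Y < m M" and par: "even n \<longleftrightarrow> bX = bY"
    and n: "near_const * t l * ((ds M X bX Y bY + 1) div 2 ^ l + 1) \<le> n div 2"
  shows "1 / (4 * real (D ^ (4 * (n div 2 div t l) + 20)) * m l) \<le> kern M n X bX Y bY"
  by (rule kern_two_step[OF par X Y]) (rule kern_near'[OF lM X _ _ n])

lemma kern_lower_long: assumes X: "X < m M" and Y: "Y < m M" and par: "even n \<longleftrightarrow> bX = bY"
    and n: "mix_const * t M \<le> n div 2"
  shows "1 / (2 * m M) \<le> kern M n X bX Y bY"
proof (rule kern_two_step[OF par X Y])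
  fix e assume "e < m M"
  from abs_le_D2[OF kern_mix[OF X this n, of bX]]
  have "- (kern M (n div 2 + n div 2) X bX e bX - 1 / m M) \<le> 1 / (2 * m M)" .
  moreover have "1 / real (m M) = 1 / (2 * m M) + 1 / (2 * m M)" by simp
  ultimately show "1 / (2 * m M) \<le> kern M (n div 2 + n div 2) X bX e bX" by linarith
qed

lemma path_parity: "(vert X bX, vert Y bY) \<in> EE M ^^ n \<Longrightarrow> even n \<longleftrightarrow> bX = bY"
proof (induction n arbitrary: Y bY)
  case 0 then show ?case by (simp add: vert_eq)
next
  case (Suc n)
  then obtain w where w: "(vert X bX, w) \<in> EE M ^^ n" "(w, vert Y bY) \<in> EE M" by auto
  then obtain e b where e: "w = vert e b" "vert Y bY = vert e (\<not> b)" by (auto simp: EE_def ES_def)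
  have "even n \<longleftrightarrow> bX = b" using Suc.IH[of e b] w e by simp
  moreover have "bY = (\<not> b)" using e(2) by (simp add: vert_eq)
  ultimately show ?case by auto
qed

lemma path_extend: assumes "(x, y) \<in> EE M ^^ n" "y \<in> XX M" shows "(x, y) \<in> EE M ^^ (n + 2 * i)"
proof -
  obtain z where z: "(y, z) \<in> EE M" using nbrs_fin[OF assms(2)] by blast
  then have z': "(z, y) \<in> EE M" using sym_EE symD by metis
  show ?thesis
  proof (induction i)
    case (Suc i)
    have "(x, y) \<in> EE M ^^ Suc (Suc (n + 2 * i))"
      by (rule relpow_Suc_I[OF relpow_Suc_I[OF Suc z] z'])
    then show ?case by simp
  qed (use assms in simp)
qed

lemma kern_path: "X < m M \<Longrightarrow> Y < m M \<Longrightarrow> (vert X bX, vert Y bY) \<in> EE M ^^ n \<Longrightarrow> 1 / D ^ Suc n \<le> kern M n X bX Y bY"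
proof (induction n arbitrary: Y bY)
  case 0
  then have "bY = bX" "Y \<in> Cl M X bX" using vert_eq_Cl[OF "0.prems"(1,2), of bX bY] by auto
  moreover have "1 / real D \<le> 1 / card (Cl M X bX)"
    using card_Cl_pos[of M X bX] card_Cl_le[of M X bX] by (intro divide_left_mono) auto
  ultimately show ?case by (simp add: kern_0 delta_def)
next
  case (Suc n)
  obtain w where w: "(vert X bX, w) \<in> EE M ^^ n" "(w, vert Y bY) \<in> EE M" using Suc.prems(3) by auto
  then obtain e b where e: "e < m M" "w = vert e b" "vert Y bY = vert e (\<not> b)" by (auto simp: EE_def ES_def)
  have b: "bY = (\<not> b)" and eC: "e \<in> Cl M Y bY" using vert_eq_Cl[OF Suc.prems(2) e(1), of bY "\<not> b"] e(3) by auto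
  have "1 / D ^ Suc n \<le> kern M n X bX e b" using Suc.IH[OF Suc.prems(1) e(1)] w(1) e(2) by simp
  then have "1 / D ^ Suc n / D \<le> kern M n X bX e (\<not> bY) / D" using b by (intro divide_right_mono) auto
  also have "\<dots> \<le> walk M (kern M n X bX) Y bY"
    unfolding walk_def
    by (rule av_ge_member[of "Cl M Y bY" e]) (use eC card_Cl_le kern_nonneg Cl_lt[OF Suc.prems(2)] in auto)
  finally show ?case by (simp add: kern_Suc mult.commute)
qed

text \<open>Parity excludes the distance \<open>n + 1\<close>, and a shorter path is extended by
  moving back and forth along an edge.\<close>

lemma kern_short: assumes X: "X < m M" and Y: "Y < m M" and par: "even n \<longleftrightarrow> bX = bY" and d: "ds M X bX Y bY \<le> n + 1"
  shows "1 / D ^ Suc n \<le> kern M n X bX Y bY"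
proof (rule kern_path[OF X Y])
  let ?d = "ds M X bX Y bY"
  have p: "(vert X bX, vert Y bY) \<in> EE M ^^ ?d" by (rule ds_path[OF X Y])
  have e: "even n \<longleftrightarrow> even ?d" using path_parity[OF p] par by simp
  then have "?d \<noteq> n + 1" by auto
  then have "?d \<le> n" using d by simp
  then have "even (n - ?d)" "?d \<le> n" using e by auto
  then obtain i where "n = ?d + 2 * i" by (metis dvdE le_add_diff_inverse)
  then show "(vert X bX, vert Y bY) \<in> EE M ^^ n" using path_extend[OF p, of i] Y XX_iff by auto
qed

end

section \<open>The full lower estimate\<close>

context scaled_blocks begin

text \<open>Of the times \<open>n\<close> and \<open>n + 1\<close> the one of the right parity is
  used. There are three regimes: the whole block has mixed; or there is a largest level
  \<open>l\<close> at which a chain of blocks is crossed in half the time, and then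
  \<open>r = 2 ^ l\<close> is the right radius in \<open>Phi_d\<close>; or the time is at most
  comparable to the distance, where a single path suffices and \<open>r = 1\<close> is used.\<close>

lemma HKE_lower: "\<exists>c3>0. \<exists>C4>0. \<exists>C5>0. \<forall>M n X bX Y bY. 1 \<le> n \<longrightarrow> X < m M \<longrightarrow> Y < m M \<longrightarrow> ds M X bX Y bY \<le> n + 1 \<longrightarrow>
    c3 / Vol M X bX (rho n) * exp (- C4 * real n * Phi_d \<Psi> (C5 * (real (ds M X bX Y bY) / real n)))
      \<le> kern M n X bX Y bY + kern M (n + 1) X bX Y bY"
proof -
  obtain CR where CR: "0 < CR" "\<And>n k M X bX. t k \<le> n \<Longrightarrow> k \<le> M \<Longrightarrow> X < m M \<Longrightarrow> real (m k) \<le> CR * Vol M X bX (rho n)"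
    using Vol_rho by blast
  define L where "L = ln (real D)"
  define G where "G = real (2 * D * near_const)"
  define E where "E = 4 * G * L"
  \<comment> \<open>\<open>3 * cP * G\<close> outweighs \<open>n / \<Psi> (2 ^ l)\<close> in the
    chaining regime, and \<open>14 * near_const\<close> forces \<open>Phi_d\<close> to be at least
    one when the time is comparable to a positive distance.\<close>
  define C5 where "C5 = 3 * cP * G + 14 * near_const + 1"
  \<comment> \<open>The three terms serve the three regimes. The last one also covers distance 0 at
    bounded times, where \<open>Phi_d\<close> gives no gain.\<close>
  define c3 where "c3 = min (1 / (2 * CR)) (min (1 / (4 * real (D ^ 20) * CR) * exp (- 2 * E - 6 * cP * G * E)) (1 / real (D ^ (4 * near_const + 5))))"
  have D1: "1 < real D" "0 < real D" using D_ge2 by auto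
  have L0: "0 < L" using D1 by (simp add: L_def)
  have near_const: "22 \<le> near_const" by (simp add: near_const_def)
  have A2r: "22 \<le> real near_const" using near_const by simp
  have G1: "1 \<le> G"
  proof -
    have "1 \<le> 2 * D * near_const" using D_ge2 near_const by simp
    then have "real 1 \<le> G" unfolding G_def by (rule of_nat_mono)
    then show ?thesis by simp
  qed
  have E0: "0 < E" unfolding E_def using L0 G1 by simp
  have EL: "L \<le> E" unfolding E_def using L0 G1 mult_mono[of 1 "4 * G" L L] by simp
  have C50: "0 < C5" unfolding C5_def using cst G1 A2r by (intro add_pos_pos mult_pos_pos) auto
  have c30: "0 < c3" unfolding c3_def using CR D1 by simp
  have c3a: "c3 \<le> 1 / (2 * CR)" unfolding c3_def by (rule min.cobounded1)
  have c3b: "c3 \<le> 1 / (4 * real (D ^ 20) * CR) * exp (- 2 * E - 6 * cP * G * E)"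
    unfolding c3_def by (rule order_trans[OF min.cobounded2 min.cobounded1])
  have c3c: "c3 \<le> 1 / real D ^ (4 * near_const + 5)"
    unfolding c3_def of_nat_power by (rule order_trans[OF min.cobounded2 min.cobounded2])
  have Dexp: "real D ^ k = exp (real k * L)" for k
    unfolding L_def using D1 by (simp add: exp_of_nat_mult)
  have main: "c3 / Vol M X bX (rho n) * exp (- E * real n * Phi_d \<Psi> (C5 * (real (ds M X bX Y bY) / real n)))
      \<le> kern M n X bX Y bY + kern M (n + 1) X bX Y bY"
    if n: "1 \<le> n" and X: "X < m M" and Y: "Y < m M" and d: "ds M X bX Y bY \<le> n + 1" for M n X bX Y bY
  proof -
    let ?d = "ds M X bX Y bY" and ?v = "Vol M X bX (rho n)"
    let ?Phi = "Phi_d \<Psi> (C5 * (real ?d / real n))"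
    have s0: "0 \<le> C5 * (real ?d / real n)" using C50 by simp
    have v1: "1 \<le> ?v" using Vol_ge1[OF X, of "rho n" bX] rho(1)[OF n] by simp
    obtain n' where n': "n' = n \<or> n' = n + 1" "even n' \<longleftrightarrow> bX = bY"
    proof (cases "even n \<longleftrightarrow> bX = bY")
      case True then show ?thesis using that[of n] by blast
    next
      case False then show ?thesis using that[of "n + 1"] by auto
    qed
    have "kern M n' X bX Y bY \<le> kern M n X bX Y bY + kern M (n + 1) X bX Y bY"
      using n'(1) kern_nonneg[OF Y, of n X bX bY] kern_nonneg[OF Y, of "n + 1" X bX bY] by auto
    moreover have "c3 / ?v * exp (- E * real n * ?Phi) \<le> kern M n' X bX Y bY"
    proof -
      let ?h = "n' div 2"
      have hn: "n \<le> 2 * ?h + 1" "2 * ?h \<le> n + 1" using n'(1) by auto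
      have ex1: "exp (- E * real n * ?Phi) \<le> 1" using E0 Phi_nonneg[OF s0] by simp
      show ?thesis
      proof (cases "mix_const * t M \<le> ?h")
        case True
        have "1 \<le> mix_const" using D_ge2 by (simp add: mix_const_def)
        then have "1 * t M \<le> mix_const * t M" by (rule mult_le_mono1)
        then have "t M \<le> ?h" using True by linarith
        then have tn: "t M \<le> n" using hn t_pos[of M] by linarith
        have "c3 / ?v * exp (- E * real n * ?Phi) \<le> c3 / ?v * 1"
          using c30 v1 ex1 by (intro mult_left_mono) auto
        also have "\<dots> \<le> 1 / (2 * CR) / ?v" unfolding mult_1_right using v1 by (intro divide_right_mono c3a) auto
        also have "\<dots> = 1 / (2 * (CR * ?v))" by simp
        also have "\<dots> \<le> 1 / (2 * real (m M))"
          using CR(2)[OF tn order_refl X, of bX] m_pos[of M] CR(1) v1 by (intro divide_left_mono mult_left_mono mult_pos_pos) auto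
        also have "\<dots> \<le> kern M n' X bX Y bY" using kern_lower_long[OF X Y n'(2) True] by simp
        finally show ?thesis .
      next
        case nlong: False
        let ?Q = "\<lambda>l. l \<le> M \<and> near_const * t l * ((?d + 1) div 2 ^ l + 1) \<le> ?h"
        show ?thesis
        proof (cases "?Q 0")
          case True
          \<comment> \<open>Maximality bounds \<open>?h / t l\<close> by a multiple of
            \<open>de + 2\<close>, the number of blocks to be crossed, so the loss in powers of
            \<open>D\<close> is exponential in \<open>de\<close> only.\<close>
          let ?l = "GREATEST l. ?Q l"
          have lQ: "?Q ?l" by (rule GreatestI_nat[of ?Q 0 M]) (use True in auto)
          have gr: "?Q j \<Longrightarrow> j \<le> ?l" for j by (rule Greatest_le_nat[of ?Q j M]) auto
          define l where "l = ?l"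
          have l: "l \<le> M" "near_const * t l * ((?d + 1) div 2 ^ l + 1) \<le> ?h" using lQ unfolding l_def by auto
          have rt: "0 < real (t l)" using t_pos by simp
          define de where "de = real ?d / 2 ^ l"
          have de0: "0 \<le> de" by (simp add: de_def)
          have tl: "t l \<le> ?h"
          proof -
            have "1 * (t l * 1) \<le> near_const * (t l * ((?d + 1) div 2 ^ l + 1))" using near_const by (intro mult_le_mono) auto
            then have "t l \<le> near_const * t l * ((?d + 1) div 2 ^ l + 1)" by (simp only: mult.assoc mult_1 mult_1_right)
            then show ?thesis using l(2) by (rule le_trans)
          qed
          have tn: "t l \<le> n" using tl hn t_pos[of l] by linarith
          have hb: "real ?h \<le> G * (de + 2) * t l"
          proof (cases "l = M")
            case True
            have "?h \<le> mix_const * t l" using nlong True by simp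
            then have "real ?h \<le> real (mix_const * t l)" by (rule of_nat_mono)
            also have "\<dots> \<le> (G * (de + 2)) * t l"
            proof -
              have "mix_const * 1 \<le> near_const * (2 * D)" using D_ge2 by (intro mult_le_mono) (auto simp: near_const_def)
              then have "real (mix_const * 1) \<le> real (near_const * (2 * D))" by (rule of_nat_mono)
              then have "real mix_const \<le> G * 1" unfolding G_def by (simp add: mult.commute)
              also have "\<dots> \<le> G * (de + 2)" using G1 de0 by (intro mult_left_mono) auto
              finally show ?thesis by (simp add: mult_right_mono)
            qed
            finally show ?thesis .
          next
            case False
            then have "Suc l \<le> M" using l by simp
            then have "\<not> near_const * t (Suc l) * ((?d + 1) div 2 ^ Suc l + 1) \<le> ?h"
              using gr[of "Suc l"] unfolding l_def by auto
            then have "?h \<le> near_const * t (Suc l) * ((?d + 1) div 2 ^ Suc l + 1)" by linarith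
            also have "\<dots> \<le> near_const * (2 * D * t l) * ((?d + 1) div 2 ^ l + 1)"
            proof (intro mult_le_mono t_Suc_le add_le_mono)
              show "(?d + 1) div 2 ^ Suc l \<le> (?d + 1) div 2 ^ l" by (intro div_le_mono2 power_increasing) auto
            qed auto
            finally have "real ?h \<le> real (near_const * (2 * D * t l) * ((?d + 1) div 2 ^ l + 1))" by (rule of_nat_mono)
            also have "\<dots> = G * t l * (real ((?d + 1) div 2 ^ l) + 1)" by (simp add: G_def algebra_simps)
            also have "\<dots> \<le> G * t l * (de + 2)"
            proof (intro mult_left_mono)
              have "real ((?d + 1) div 2 ^ l) \<le> real (?d + 1) / real (2 ^ l)" by (rule of_nat_div_le_of_nat)
              also have "\<dots> = de + 1 / 2 ^ l" by (simp add: de_def add_divide_distrib)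
              also have "1 / 2 ^ l \<le> (1::real)" by simp
              finally show "real ((?d + 1) div 2 ^ l) + 1 \<le> de + 2" by simp
            qed (use G1 in auto)
            finally show ?thesis by (simp add: algebra_simps)
          qed
          have hq: "real ?h / t l \<le> G * (de + 2)" using hb rt by (simp add: divide_le_eq)
          have q: "real (?h div t l) \<le> G * (de + 2)"
            by (rule order_trans[OF of_nat_div_le_of_nat hq])
          have Dq: "real (D ^ (4 * (?h div t l) + 20)) \<le> exp (E * (de + 2)) * real (D ^ 20)"
          proof -
            have "real D ^ (4 * (?h div t l)) = exp (4 * real (?h div t l) * L)" by (simp add: Dexp)
            also have "\<dots> \<le> exp (E * (de + 2))"
            proof -
              have "4 * L * real (?h div t l) \<le> 4 * L * (G * (de + 2))" using q L0 by (intro mult_left_mono) auto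
              then show ?thesis by (simp add: E_def mult_ac)
            qed
            finally have "real D ^ (4 * (?h div t l)) * real D ^ 20 \<le> exp (E * (de + 2)) * real D ^ 20"
              by (rule mult_right_mono) simp
            then show ?thesis by (simp add: power_add)
          qed
          have nP: "real n / \<Psi> (2 ^ l) \<le> 3 * cP * G * (de + 2)"
          proof -
            have P0: "0 < \<Psi> (2 ^ l)" using P_ge1[of "2 ^ l"] by simp
            have "n \<le> 3 * ?h" using hn tl t_pos[of l] by linarith
            then have "real n \<le> 3 * real ?h" by linarith
            also have "\<dots> \<le> 3 * (G * (de + 2) * (cP * \<Psi> (2 ^ l)))"
            proof -
              have "G * (de + 2) * real (t l) \<le> G * (de + 2) * (cP * \<Psi> (2 ^ l))"
                using G1 de0 by (intro mult_left_mono t_le) auto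
              then show ?thesis using hb by linarith
            qed
            finally show ?thesis using P0 by (simp add: divide_le_eq algebra_simps)
          qed
          have Ph: "C5 * de - 3 * cP * G * (de + 2) \<le> real n * ?Phi"
          proof -
            have "C5 * (real ?d / real n) / 2 ^ l - 1 / \<Psi> (2 ^ l) \<le> ?Phi" by (rule Phi_ge[OF s0]) simp
            then have "real n * (C5 * (real ?d / real n) / 2 ^ l - 1 / \<Psi> (2 ^ l)) \<le> real n * ?Phi"
              by (rule mult_left_mono) simp
            moreover have "real n * (C5 * (real ?d / real n) / 2 ^ l - 1 / \<Psi> (2 ^ l)) = C5 * de - real n / \<Psi> (2 ^ l)"
              using n by (simp add: de_def right_diff_distrib)
            ultimately show ?thesis using nP by linarith
          qed
          have Ph2: "de - 6 * cP * G \<le> real n * ?Phi"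
          proof -
            have "1 * de \<le> (C5 - 3 * cP * G) * de" unfolding C5_def using de0 A2r by (intro mult_right_mono) auto
            then show ?thesis using Ph by (simp add: algebra_simps)
          qed
          have "exp (- E * real n * ?Phi) \<le> exp (- E * (de - 6 * cP * G))"
          proof -
            have "E * (de - 6 * cP * G) \<le> E * (real n * ?Phi)" using Ph2 E0 by (intro mult_left_mono) auto
            then show ?thesis by (simp add: mult.assoc)
          qed
          then have "c3 / ?v * exp (- E * real n * ?Phi) \<le> (1 / (4 * real (D ^ 20) * CR) * exp (- 2 * E - 6 * cP * G * E)) / ?v * exp (- E * (de - 6 * cP * G))"
            using v1 CR(1) by (intro mult_mono divide_right_mono c3b) auto
          also have "\<dots> = 1 / (4 * real (D ^ 20) * (CR * ?v)) * (exp (- 2 * E - 6 * cP * G * E) * exp (- E * (de - 6 * cP * G)))" by simp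
          also have "exp (- 2 * E - 6 * cP * G * E) * exp (- E * (de - 6 * cP * G)) = 1 / exp (E * (de + 2))"
            unfolding exp_add[symmetric] by (simp add: exp_minus[symmetric] inverse_eq_divide[symmetric] algebra_simps)
          also have "1 / (4 * real (D ^ 20) * (CR * ?v)) * (1 / exp (E * (de + 2))) = 1 / (4 * (exp (E * (de + 2)) * real (D ^ 20)) * (CR * ?v))"
            by simp
          also have "\<dots> \<le> 1 / (4 * real (D ^ (4 * (?h div t l) + 20)) * m l)"
            using CR(2)[OF tn l(1) X, of bX] Dq m_pos[of l] D1 CR(1) v1
            by (intro divide_left_mono mult_mono mult_left_mono mult_pos_pos) auto
          also have "\<dots> \<le> kern M n' X bX Y bY" by (rule kern_lower[OF l(1) X Y n'(2) l(2)])
          finally show ?thesis .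
        next
          case False
          then have hs: "?h < near_const * (?d + 2)" by simp
          have dn: "?d \<le> n' + 1" using d n'(1) by auto
          have "c3 / ?v * exp (- E * real n * ?Phi) \<le> 1 / real (D ^ (n + 2))"
          proof (cases "?d = 0")
            case True
            then have "n + 2 \<le> 4 * near_const + 5" using hs hn by simp
            then have "real D ^ (n + 2) \<le> real D ^ (4 * near_const + 5)" using D1 by (intro power_increasing) auto
            then have "1 / real D ^ (4 * near_const + 5) \<le> 1 / real D ^ (n + 2)" using D1 by (intro divide_left_mono) auto
            moreover have "c3 / ?v * exp (- E * real n * ?Phi) \<le> c3 / 1 * 1"
              using c30 v1 ex1 by (intro mult_mono divide_left_mono) auto
            ultimately show ?thesis using c3c by simp
          next
            case d0: False
            have "n \<le> 7 * near_const * ?d"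
            proof -
              have "near_const \<le> near_const * ?d" using d0 by simp
              moreover have "near_const * (?d + 2) = near_const * ?d + 2 * near_const" by simp
              moreover have "7 * near_const * ?d = 7 * (near_const * ?d)" by simp
              ultimately show ?thesis using hs hn near_const by linarith
            qed
            then have "real n \<le> real (7 * near_const * ?d)" by (rule of_nat_mono)
            then have "1 / real (7 * near_const) \<le> real ?d / real n" using n near_const by (simp add: field_simps)
            then have "real (14 * near_const) * (1 / real (7 * near_const)) \<le> C5 * (real ?d / real n)"
              unfolding C5_def using cst G1 by (intro mult_mono) auto
            then have "2 \<le> C5 * (real ?d / real n)" using near_const by simp
            moreover have "C5 * (real ?d / real n) / 1 - 1 / \<Psi> 1 \<le> ?Phi" by (rule Phi_ge[OF s0]) simp
            ultimately have Phi1: "1 \<le> ?Phi" by (simp add: P_1)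
            have "L * real n \<le> E * real n * ?Phi"
            proof -
              have "L * real n * 1 \<le> E * real n * ?Phi" using EL E0 L0 Phi1 by (intro mult_mono) auto
              then show ?thesis by simp
            qed
            then have "exp (- E * real n * ?Phi) \<le> exp (- (real n * L))" by (simp add: mult.commute)
            also have "\<dots> = 1 / real D ^ n" by (simp add: Dexp exp_minus inverse_eq_divide)
            finally have ex: "exp (- E * real n * ?Phi) \<le> 1 / real D ^ n" .
            have "real D ^ 2 \<le> real D ^ (4 * near_const + 5)" using D1 by (intro power_increasing) auto
            then have "1 / real D ^ (4 * near_const + 5) \<le> 1 / real D ^ 2" using D1 by (intro divide_left_mono) auto
            with c3c have "c3 \<le> 1 / real D ^ 2" by (rule order_trans)
            then have "c3 / ?v \<le> (1 / real D ^ 2) / 1" using c30 v1 by (intro frac_le) auto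
            then have "c3 / ?v * exp (- E * real n * ?Phi) \<le> (1 / real D ^ 2) / 1 * (1 / real D ^ n)"
              using ex c30 v1 by (intro mult_mono) auto
            also have "(1 / real D ^ 2) / 1 * (1 / real D ^ n) = 1 / real (D ^ (n + 2))"
              by (simp add: power_add mult.commute power2_eq_square)
            finally show ?thesis .
          qed
          also have "1 / real (D ^ (n + 2)) \<le> 1 / real (D ^ Suc n')"
          proof -
            have "real D ^ Suc n' \<le> real D ^ (n + 2)" using n'(1) D1 by (intro power_increasing) auto
            then show ?thesis using D1 by (intro divide_left_mono) auto
          qed
          also have "\<dots> \<le> kern M n' X bX Y bY" by (rule kern_short[OF X Y n'(2) dn])
          finally show ?thesis .
        qed
      qed
    qed
    ultimately show ?thesis by linarith
  qed
  show ?thesis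
    by (rule exI[of _ c3], rule conjI[OF c30], rule exI[of _ E], rule conjI[OF E0], rule exI[of _ C5], rule conjI[OF C50])
       (use main in blast)
qed

end

section \<open>Choice of the parameters\<close>

text \<open>A continuous injection of an interval is monotone. A decreasing one would be bounded by
  its value at 1, against surjectivity; so the map increases, and its least value 1 is taken at
  1.\<close>

lemma homeo_ge1_facts: assumes "homeo_ge1 f"
  shows homeo_ge1_strict_mono: "\<And>r R. 1 \<le> r \<Longrightarrow> r < R \<Longrightarrow> f r < f R"
    and homeo_ge1_one: "f 1 = 1" and homeo_ge1_surj: "\<And>y. 1 \<le> y \<Longrightarrow> \<exists>x\<ge>1. f x = y"
proof -
  obtain g where g: "homeomorphism {1..} {1..} f g" using assms by (auto simp: homeo_ge1_def)
  have cont: "continuous_on {1..} f" and im: "f ` {1..} = {1..}" and gf: "\<And>x. x \<in> {1..} \<Longrightarrow> g (f x) = x"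
    using g unfolding homeomorphism_def by blast+
  have inj: "inj_on f {1..}" by (rule inj_on_inverseI[of _ g]) (rule gf)
  have mono3: "(f 1 < f x \<and> f x < f b) \<or> (f b < f x \<and> f x < f 1)" if "1 < x" "x < b" for x b
  proof (rule continuous_inj_imp_mono[OF that])
    show "continuous_on {1..b} f" by (rule continuous_on_subset[OF cont]) auto
    show "inj_on f {1..b}" by (rule inj_on_subset[OF inj]) auto
  qed
  show surj: "\<exists>x\<ge>1. f x = y" if "1 \<le> y" for y
  proof -
    have "y \<in> f ` {1..}" using im that by simp
    then show ?thesis by auto
  qed
  have up: "f 1 < f b" if b: "1 < b" for b
  proof (rule ccontr)
    assume "\<not> f 1 < f b"
    moreover have "f b \<noteq> f 1" using inj_onD[OF inj, of b 1] b by auto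
    ultimately have lt: "f b < f 1" by linarith
    have "f x \<le> f 1" if x: "1 \<le> x" for x
    proof -
      consider "x = 1" | "1 < x" "x < b" | "x = b" | "b < x" using x by linarith
      then show ?thesis
      proof cases
        case 2 then show ?thesis using mono3[of x b] lt by linarith
      next
        case 4 then show ?thesis using mono3[of b x] b lt by linarith
      qed (use lt in auto)
    qed
    moreover obtain x where "1 \<le> x" "f x = f 1 + 1"
    proof -
      have "1 \<le> f 1" using im by auto
      then show ?thesis using surj[of "f 1 + 1"] that by auto
    qed
    ultimately show False by fastforce
  qed
  show "f r < f R" if "1 \<le> r" "r < R" for r R
    using mono3[of r R] up[of R] up[of r] that by (cases "r = 1") auto
  obtain x where x: "1 \<le> x" "f x = 1" using surj[of 1] by auto
  have "1 \<le> f 1" using im by auto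
  then show "f 1 = 1" using x up[of x] by (cases "x = 1") auto
qed

text \<open>Replace \<open>z\<close> by the least larger sequence that grows at least by the factor \<open>\<rho>\<close> at each step, then choose
  the factors greedily, keeping the product within a factor two below.\<close>

lemma integer_product_approx:
  fixes z :: "nat \<Rightarrow> real" and \<rho> :: nat and c C :: real
  assumes zpos: "\<And>k. 0 < z k" and \<rho>: "1 \<le> \<rho>" and c: "0 < c"
    and low: "\<And>j k. k \<le> j \<Longrightarrow> c * real \<rho> ^ (j - k) * z k \<le> z j"
    and up: "\<And>k. z (Suc k) \<le> C * z k"
  obtains n :: "nat \<Rightarrow> nat" and B :: nat and Q :: real
  where "\<And>k. \<rho> \<le> n k" "\<And>k. n k \<le> B" "1 \<le> Q"
    "\<And>k. real (\<Prod>i<k. n i) \<le> Q * z k" "\<And>k. z k \<le> Q * real (\<Prod>i<k. n i)"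
proof -
  define y where "y = rec_nat (z 0) (\<lambda>k yk. max (\<rho> * yk) (z (Suc k)))"
  have y0: "y 0 = z 0" and yS: "y (Suc k) = max (\<rho> * y k) (z (Suc k))" for k by (simp_all add: y_def)
  have zy: "z k \<le> y k" for k by (cases k) (simp_all add: y0 yS)
  have ypos: "0 < y k" for k using zpos[of k] zy[of k] by linarith
  \<comment> \<open>After the last index \<open>j\<close> at which the maximum picks
    \<open>z\<close>, the sequence grows by exactly \<rho> per step. The lower growth of
    \<open>z\<close> from \<open>j\<close> on therefore bounds \<open>c * y k\<close> by
    \<open>z k\<close>.\<close>
  have yform: "\<exists>j\<le>k. y k = \<rho> ^ (k - j) * z j" for k
  proof (induction k)
    case (Suc k)
    then obtain j where j: "j \<le> k" "y k = \<rho> ^ (k - j) * z j" by blast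
    show ?case
    proof (cases "\<rho> * y k \<le> z (Suc k)")
      case True then show ?thesis by (intro exI[of _ "Suc k"]) (simp add: yS)
    next
      case False then show ?thesis using j by (intro exI[of _ j]) (simp add: yS Suc_diff_le)
    qed
  qed (simp add: y0)
  have cy: "c * y k \<le> z k" for k
  proof -
    obtain j where "j \<le> k" "y k = \<rho> ^ (k - j) * z j" using yform by blast
    then show ?thesis using low[of j k] by (simp add: mult.assoc)
  qed
  define E where "E = max (real \<rho>) C"
  have yup: "y (Suc k) \<le> E * y k" for k
  proof -
    have "\<rho> * y k \<le> E * y k" using ypos[of k] by (intro mult_right_mono) (auto simp: E_def)
    moreover have "z (Suc k) \<le> E * y k"
    proof -
      have "0 \<le> E" using \<rho> by (simp add: E_def)
      have "z (Suc k) \<le> C * z k" by (rule up)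
      also have "\<dots> \<le> E * z k" using zpos[of k] by (intro mult_right_mono) (auto simp: E_def)
      also have "\<dots> \<le> E * y k" using zy \<open>0 \<le> E\<close> by (intro mult_left_mono) auto
      finally show ?thesis .
    qed
    ultimately show ?thesis by (simp add: yS)
  qed
  define w where "w k = y k / y 0" for k
  have w0: "w 0 = 1" using ypos[of 0] by (simp add: w_def)
  have wS: "\<rho> * w k \<le> w (Suc k)" "w (Suc k) \<le> E * w k" for k
  proof -
    have "\<rho> * y k \<le> y (Suc k)" by (simp add: yS)
    then show "\<rho> * w k \<le> w (Suc k)" using divide_right_mono[of "\<rho> * y k" "y (Suc k)" "y 0"] ypos[of 0] by (simp add: w_def)
    show "w (Suc k) \<le> E * w k" using divide_right_mono[OF yup[of k], of "y 0"] ypos[of 0] by (simp add: w_def)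
  qed
  \<comment> \<open>The quotient is taken against the product already chosen, not against the
    previous target, so rounding errors do not accumulate.\<close>
  define P where "P = rec_nat (1::nat) (\<lambda>k Pk. Pk * nat \<lfloor>w (Suc k) / real Pk\<rfloor>)"
  define n where "n k = nat \<lfloor>w (Suc k) / real (P k)\<rfloor>" for k
  have P0: "P 0 = 1" and PS: "P (Suc k) = P k * n k" for k by (simp_all add: P_def n_def)
  have prod: "(\<Prod>i<k. n i) = P k" for k by (induction k) (simp_all add: P0 PS)
  have step: "\<rho> \<le> n k \<and> real (n k) \<le> w (Suc k) / P k \<and> w (Suc k) / P k < 2 * real (n k)"
    if "0 < P k" "real (P k) \<le> w k" for k
  proof -
    have Pk: "0 < real (P k)" using that by simp
    have "\<rho> * real (P k) \<le> \<rho> * w k" using that by (intro mult_left_mono) auto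
    then have "\<rho> * real (P k) \<le> w (Suc k)" using wS(1)[of k] by linarith
    then have x: "real \<rho> \<le> w (Suc k) / P k" using Pk by (simp add: pos_le_divide_eq)
    then have f0: "int \<rho> \<le> \<lfloor>w (Suc k) / P k\<rfloor>" by (simp add: le_floor_iff)
    then have "\<rho> \<le> n k" unfolding n_def by linarith
    moreover have rn: "real (n k) = of_int \<lfloor>w (Suc k) / P k\<rfloor>" unfolding n_def using f0 by simp
    moreover have "w (Suc k) / P k < of_int \<lfloor>w (Suc k) / P k\<rfloor> + 1" by linarith
    moreover have "1 \<le> real (n k)" using \<open>\<rho> \<le> n k\<close> \<rho> by simp
    ultimately show ?thesis using of_int_floor_le[of "w (Suc k) / P k"] by linarith
  qed
  have inv: "0 < P k \<and> real (P k) \<le> w k \<and> w k < 2 * real (P k)" for k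
  proof (induction k)
    case 0 then show ?case by (simp add: P0 w0)
  next
    case (Suc k)
    then have s: "\<rho> \<le> n k" "real (n k) \<le> w (Suc k) / P k" "w (Suc k) / P k < 2 * real (n k)" using step[of k] by auto
    have Pk: "0 < real (P k)" using Suc by simp
    show ?case using s \<rho> Suc Pk by (auto simp: PS pos_le_divide_eq pos_divide_less_eq mult_ac)
  qed
  have nk: "\<rho> \<le> n k" for k using step inv by blast
  have "real (n k) \<le> 2 * E" for k
  proof -
    have "real (n k) \<le> w (Suc k) / P k" using step inv by blast
    also have "\<dots> \<le> E * w k / P k" by (rule divide_right_mono[OF wS(2)]) simp
    also have "\<dots> \<le> E * (2 * real (P k)) / P k"
      using inv[of k] \<rho> by (intro divide_right_mono mult_left_mono) (auto simp: E_def)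
    also have "\<dots> = 2 * E" using inv[of k] by simp
    finally show ?thesis .
  qed
  then have "real (n k) \<le> real (nat \<lceil>2 * E\<rceil>)" for k by (rule order_trans) (rule real_nat_ceiling_ge)
  then have nB: "n k \<le> nat \<lceil>2 * E\<rceil>" for k by simp
  define Q where "Q = max 1 (max (2 * y 0) (1 / (c * y 0)))"
  have "real (P k) \<le> Q * z k" for k
  proof -
    have "real (P k) \<le> w k" using inv by blast
    also have "\<dots> = 1 / (c * y 0) * (c * y k)" using c ypos[of 0] by (simp add: w_def)
    also have "\<dots> \<le> 1 / (c * y 0) * z k" using c ypos[of 0] by (intro mult_left_mono cy) auto
    also have "\<dots> \<le> Q * z k" using zpos[of k] by (intro mult_right_mono) (auto simp: Q_def)
    finally show ?thesis .
  qed
  moreover have "z k \<le> Q * real (P k)" for k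
  proof -
    have "z k \<le> y k" by (rule zy)
    also have "\<dots> = y 0 * w k" using ypos[of 0] by (simp add: w_def)
    also have "\<dots> \<le> y 0 * (2 * real (P k))" using inv[of k] ypos[of 0] by (intro mult_left_mono) auto
    also have "\<dots> = 2 * y 0 * real (P k)" by simp
    also have "\<dots> \<le> Q * real (P k)" by (intro mult_right_mono) (auto simp: Q_def)
    finally show ?thesis .
  qed
  moreover have "1 \<le> Q" by (simp add: Q_def)
  ultimately show ?thesis using that[of n "nat \<lceil>2 * E\<rceil>" Q] nk nB by (simp add: prod)
qed

section \<open>Assembly over all blocks\<close>

context scaled_blocks begin

text \<open>Both bounds hold for all radii, so the condition is the same for every graph whatever
  its diameter. The upper exponent is the binary logarithm of the doubling constant, enlarged to at
  least 4 so that the exponent exceeds one.\<close>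

lemma scale_function: assumes "homeo_ge1 \<Psi>"
  shows "\<exists>C>1. \<exists>\<beta>2>1. \<forall>X E. scale_function_with C 2 \<beta>2 \<Psi> (X :: 'a set) E"
proof -
  define q where "q = max CP 4"
  define \<beta> where "\<beta> = log 2 q"
  define C where "C = max q (1 / c0)"
  have q4: "4 \<le> q" by (simp add: q_def)
  have qb: "2 powr \<beta> = q" using q4 by (simp add: \<beta>_def)
  have b1: "1 < \<beta>" using q4 by (simp add: \<beta>_def less_log_iff)
  have C1: "1 < C" "q \<le> C" "1 / c0 \<le> C" using q4 by (auto simp: C_def)
  have dbl: "\<Psi> (2 ^ j * r) \<le> q ^ j * \<Psi> r" if "1 \<le> r" for j r
  proof (induction j)
    case (Suc j)
    have r1: "1 \<le> 2 ^ j * r" using mult_mono[of 1 "2 ^ j" 1 r] that by simp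
    then have "\<Psi> (2 * (2 ^ j * r)) \<le> CP * \<Psi> (2 ^ j * r)" by (rule P_dbl)
    also have "\<dots> \<le> q * \<Psi> (2 ^ j * r)" using P_ge1[OF r1] by (intro mult_right_mono) (auto simp: q_def)
    also have "\<dots> \<le> q * (q ^ j * \<Psi> r)" using Suc q4 by (intro mult_left_mono) auto
    finally show ?case by (simp add: mult.assoc)
  qed simp
  have "inverse C * (R / r) powr 2 \<le> \<Psi> R / \<Psi> r \<and> \<Psi> R / \<Psi> r \<le> C * (R / r) powr \<beta>"
    if r: "1 \<le> r" "r < R" for r R
  proof
    have P0: "0 < \<Psi> r" using P_ge1[OF r(1)] by simp
    have Rr: "1 \<le> R / r" using r by simp
    have "inverse C * (R / r)\<^sup>2 \<le> c0 * (R / r)\<^sup>2"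
    proof (rule mult_right_mono)
      show "inverse C \<le> c0" using C1 cst(5) by (simp add: field_simps)
    qed simp
    also have "\<dots> \<le> \<Psi> R / \<Psi> r" using P_low[OF r(1), of R] r P0 by (simp add: pos_le_divide_eq)
    finally show "inverse C * (R / r) powr 2 \<le> \<Psi> R / \<Psi> r" using Rr by (simp add: powr_numeral)
    obtain l where l: "2 ^ l \<le> R / r" "R / r < 2 ^ Suc l" using dyadic[OF Rr] by blast
    have "R \<le> 2 ^ Suc l * r" using l(2) r by (simp add: divide_less_eq less_imp_le)
    then have "\<Psi> R \<le> \<Psi> (2 ^ Suc l * r)" using r by (intro P_mono_le) auto
    also have "\<dots> \<le> q ^ Suc l * \<Psi> r" by (rule dbl[OF r(1)])
    finally have "\<Psi> R / \<Psi> r \<le> q ^ Suc l" using P0 by (simp add: divide_le_eq)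
    also have "\<dots> = q * (2 powr \<beta>) powr real l" using q4 by (simp add: qb powr_realpow)
    also have "(2 powr \<beta>) powr real l = (2 ^ l) powr \<beta>"
      by (simp add: powr_powr mult.commute powr_realpow[symmetric])
    also have "q * (2 ^ l) powr \<beta> \<le> C * (R / r) powr \<beta>"
      using l(1) C1 b1 q4 by (intro mult_mono powr_mono2) auto
    finally show "\<Psi> R / \<Psi> r \<le> C * (R / r) powr \<beta>" .
  qed
  then have "\<forall>X E. scale_function_with C 2 \<beta> \<Psi> (X :: 'a set) E"
    unfolding scale_function_with_def using assms by blast
  then show ?thesis using C1(1) b1 by blast
qed

lemma HKE_all: "\<exists>C1>0. \<exists>c1>0. \<exists>c2>0. \<exists>c3>0. \<exists>C4>0. \<exists>C5>0. \<forall>M. HKE_bounds_with C1 c1 c2 c3 C4 C5 \<Psi> (XX M) (EE M)"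
proof -
  obtain C1 c1 c2 where u: "C1 > 0" "c1 > 0" "c2 > 0"
    "\<And>M n X bX Y bY. 1 \<le> n \<Longrightarrow> X < m M \<Longrightarrow> Y < m M \<Longrightarrow>
    kern M n X bX Y bY \<le> C1 / Vol M X bX (rho n) * exp (- c1 * real n * Phi_d \<Psi> (c2 * (real (ds M X bX Y bY) / real n)))"
    using HKE_upper by blast
  obtain c3 C4 C5 where l: "c3 > 0" "C4 > 0" "C5 > 0"
    "\<And>M n X bX Y bY. 1 \<le> n \<Longrightarrow> X < m M \<Longrightarrow> Y < m M \<Longrightarrow> ds M X bX Y bY \<le> n + 1 \<Longrightarrow>
    c3 / Vol M X bX (rho n) * exp (- C4 * real n * Phi_d \<Psi> (C5 * (real (ds M X bX Y bY) / real n)))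
      \<le> kern M n X bX Y bY + kern M (n + 1) X bX Y bY"
    using HKE_lower by blast
  have "HKE_bounds_with C1 c1 c2 c3 C4 C5 \<Psi> (XX M) (EE M)" for M
    unfolding HKE_bounds_with_def
  proof (intro conjI allI ballI impI)
    fix n :: nat and x y assume n: "1 \<le> n" and "x \<in> XX M" "y \<in> XX M"
    then obtain X bX Y bY where X: "X < m M" "x = vert X bX" and Y: "Y < m M" "y = vert Y bY" unfolding XX_iff by blast
    have e: "heat_kernel (XX M) (EE M) i x y = kern M i X bX Y bY" for i
      unfolding X(2) Y(2) by (rule heat_kernel_M[OF X(1) Y(1)])
    have v: "measure (graph_measure (XX M) (EE M)) (graph_ball (XX M) (EE M) x (inv_into {1..} \<Psi> (real n))) = Vol M X bX (rho n)"
      unfolding X(2) rho_def by (rule measure_ball_M)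
    have dd: "graph_dist (EE M) x y = ds M X bX Y bY" by (simp add: ds_def X Y)
    show "heat_kernel (XX M) (EE M) n x y \<le> C1 / measure (graph_measure (XX M) (EE M)) (graph_ball (XX M) (EE M) x (inv_into {1..} \<Psi> (real n)))
             * exp (- c1 * real n * Phi_d \<Psi> (c2 * (real (graph_dist (EE M) x y) / real n)))"
      unfolding e v dd by (rule u(4)[OF n X(1) Y(1)])
    assume "graph_dist (EE M) x y \<le> n + 1"
    then show "c3 / measure (graph_measure (XX M) (EE M)) (graph_ball (XX M) (EE M) x (inv_into {1..} \<Psi> (real n)))
             * exp (- C4 * real n * Phi_d \<Psi> (C5 * (real (graph_dist (EE M) x y) / real n)))
        \<le> heat_kernel (XX M) (EE M) n x y + heat_kernel (XX M) (EE M) (n + 1) x y"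
      unfolding e v dd by (intro l(4)[OF n X(1) Y(1)])
  qed
  note b = this
  show ?thesis
    by (rule exI[of _ C1], rule conjI, rule u(1), rule exI[of _ c1], rule conjI, rule u(2), rule exI[of _ c2], rule conjI, rule u(3), rule exI[of _ c3], rule conjI, rule l(1), rule exI[of _ C4], rule conjI, rule l(2), rule exI[of _ C5], rule conjI, rule l(3), rule allI, rule b)
qed

lemma volume_bounds: "\<exists>C>1. (\<forall>M X bX r. X < m M \<longrightarrow> 1 \<le> r \<longrightarrow> Vol M X bX r \<le> C * V r) \<and>
   (\<forall>M X bX r. X < m M \<longrightarrow> 1 \<le> r \<longrightarrow> r \<le> 2 * 2 ^ M \<longrightarrow> inverse C * V r \<le> Vol M X bX r)"
proof -
  define C where "C = max 2 (max (2 * real (D ^ 3) * cV * CV) (cV * CV ^ 2))"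
  have C2: "2 \<le> C" "2 * real (D ^ 3) * cV * CV \<le> C" "cV * CV ^ 2 \<le> C" by (auto simp: C_def)
  have "Vol M X bX r \<le> C * V r" if "X < m M" "1 \<le> r" for M X bX r
    using Vol_le_V[OF that, of bX] mult_right_mono[OF C2(2), of "V r"] V_ge1[OF that(2)] by linarith
  moreover have "inverse C * V r \<le> Vol M X bX r" if "X < m M" "1 \<le> r" "r \<le> 2 * 2 ^ M" for M X bX r
  proof -
    have "V r \<le> cV * CV ^ 2 * Vol M X bX r" by (rule V_le_Vol[OF that])
    also have "\<dots> \<le> C * Vol M X bX r" using Vol_ge1[OF that(1), of r bX] that C2(3) by (intro mult_right_mono) auto
    finally show ?thesis using C2(1) by (simp add: field_simps)
  qed
  ultimately show ?thesis using C2(1) by (intro exI[of _ C]) auto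
qed

lemma glued_graph_realises: assumes "homeo_ge1 \<Psi>"
  shows "\<exists>(X :: nat set) E p.
    infinite X \<and> connected_graph X E \<and> p \<in> X \<and>
    HKE_df \<Psi> X E \<and>
    (\<exists>C1>1. \<forall>x\<in>X. \<forall>r\<ge>1.
       inverse C1 * V r \<le> measure (graph_measure X E) (graph_ball X E x r) \<and>
       measure (graph_measure X E) (graph_ball X E x r) \<le> C1 * V r) \<and>
    HKE_df_uniform \<Psi> {1::nat..} (sub_verts X E p) (sub_edges X E p) \<and>
    (\<exists>C2>1. \<forall>n\<ge>1. \<forall>x\<in>sub_verts X E p n. \<forall>r\<ge>1.
       ereal r \<le> graph_diam (sub_verts X E p n) (sub_edges X E p n) \<longrightarrow>
       inverse C2 * V r
         \<le> measure (graph_measure (sub_verts X E p n) (sub_edges X E p n))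
              (graph_ball (sub_verts X E p n) (sub_edges X E p n) x r) \<and>
       measure (graph_measure (sub_verts X E p n) (sub_edges X E p n))
              (graph_ball (sub_verts X E p n) (sub_edges X E p n) x r)
         \<le> C2 * V r)"
proof -
  obtain C \<beta>2 where sc: "C > 1" "\<beta>2 > 1" "\<And>(X :: nat set) E. scale_function_with C 2 \<beta>2 \<Psi> X E"
    using scale_function[OF assms, where 'a = nat] by blast
  obtain C1 c1 c2 c3 C4 C5 where hk: "C1 > 0" "c1 > 0" "c2 > 0" "c3 > 0" "C4 > 0" "C5 > 0"
    "\<And>M. HKE_bounds_with C1 c1 c2 c3 C4 C5 \<Psi> (XX M) (EE M)" using HKE_all by blast
  obtain CC where CC: "CC > 1" "\<And>M X bX r. X < m M \<Longrightarrow> 1 \<le> r \<Longrightarrow> Vol M X bX r \<le> CC * V r"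
    "\<And>M X bX r. X < m M \<Longrightarrow> 1 \<le> r \<Longrightarrow> r \<le> 2 * 2 ^ M \<Longrightarrow> inverse CC * V r \<le> Vol M X bX r"
    using volume_bounds by blast
  have two: "(1::real) < 2" by simp
  have 1: "HKE_df \<Psi> Xinf Einf"
    unfolding HKE_df_def
  proof
    show "\<exists>C>1. \<exists>\<beta>1>1. \<exists>\<beta>2>1. scale_function_with C \<beta>1 \<beta>2 \<Psi> Xinf Einf"
      by (rule exI[of _ C], rule conjI, rule sc(1), rule exI[of _ 2], rule conjI, rule two, rule exI[of _ \<beta>2], rule conjI, rule sc(2), rule sc(3))
    show "\<exists>C1>0. \<exists>c1>0. \<exists>c2>0. \<exists>c3>0. \<exists>C4>0. \<exists>C5>0. HKE_bounds_with C1 c1 c2 c3 C4 C5 \<Psi> Xinf Einf"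
      by (rule exI[of _ C1], rule conjI, rule hk(1), rule exI[of _ c1], rule conjI, rule hk(2), rule exI[of _ c2], rule conjI, rule hk(3), rule exI[of _ c3], rule conjI, rule hk(4), rule exI[of _ C4], rule conjI, rule hk(5), rule exI[of _ C5], rule conjI, rule hk(6), rule HKE_inf[OF hk(7)])
  qed
  have 2: "inverse CC * V r \<le> measure (graph_measure Xinf Einf) (graph_ball Xinf Einf x r) \<and>
       measure (graph_measure Xinf Einf) (graph_ball Xinf Einf x r) \<le> CC * V r" if x: "x \<in> Xinf" and r: "1 \<le> r" for x r
  proof -
    obtain M0 M X bX where M: "X < m M" "measure (graph_measure Xinf Einf) (graph_ball Xinf Einf x r) = Vol M X bX r" "2 ^ M0 + r < 2 ^ M"
      using Vol_inf[OF x, of r] by blast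
    have "0 \<le> (2::real) ^ M0" "0 \<le> (2::real) ^ M" by simp_all
    then have "r \<le> 2 * 2 ^ M" using M(3) by linarith
    then show ?thesis unfolding M(2) using CC(2,3)[OF M(1) r] by blast
  qed
  have 3: "HKE_df_uniform \<Psi> {1::nat..} (sub_verts Xinf Einf root) (sub_edges Xinf Einf root)"
  proof -
    have "HKE_bounds_with C1 c1 c2 c3 C4 C5 \<Psi> (sub_verts Xinf Einf root i) (sub_edges Xinf Einf root i)" if "i \<in> {1..}" for i
      using hk(7)[of i] that by (simp add: sub_verts_eq sub_edges_eq)
    note b = this
    show ?thesis unfolding HKE_df_uniform_def
    proof
      show "\<exists>C>1. \<exists>\<beta>1>1. \<exists>\<beta>2>1. \<forall>i\<in>{1::nat..}. scale_function_with C \<beta>1 \<beta>2 \<Psi> (sub_verts Xinf Einf root i) (sub_edges Xinf Einf root i)"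
        by (rule exI[of _ C], rule conjI, rule sc(1), rule exI[of _ 2], rule conjI, rule two, rule exI[of _ \<beta>2], rule conjI, rule sc(2), rule ballI, rule sc(3))
      show "\<exists>C1>0. \<exists>c1>0. \<exists>c2>0. \<exists>c3>0. \<exists>C4>0. \<exists>C5>0. \<forall>i\<in>{1::nat..}.
          HKE_bounds_with C1 c1 c2 c3 C4 C5 \<Psi> (sub_verts Xinf Einf root i) (sub_edges Xinf Einf root i)"
        by (rule exI[of _ C1], rule conjI, rule hk(1), rule exI[of _ c1], rule conjI, rule hk(2), rule exI[of _ c2], rule conjI, rule hk(3), rule exI[of _ c3], rule conjI, rule hk(4), rule exI[of _ C4], rule conjI, rule hk(5), rule exI[of _ C5], rule conjI, rule hk(6), rule ballI, rule b)
    qed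
  qed
  have 4: "inverse CC * V r \<le> measure (graph_measure (sub_verts Xinf Einf root n) (sub_edges Xinf Einf root n))
              (graph_ball (sub_verts Xinf Einf root n) (sub_edges Xinf Einf root n) x r) \<and>
       measure (graph_measure (sub_verts Xinf Einf root n) (sub_edges Xinf Einf root n))
              (graph_ball (sub_verts Xinf Einf root n) (sub_edges Xinf Einf root n) x r) \<le> CC * V r"
    if n: "1 \<le> n" and x: "x \<in> sub_verts Xinf Einf root n" and r: "1 \<le> r"
      and d: "ereal r \<le> graph_diam (sub_verts Xinf Einf root n) (sub_edges Xinf Einf root n)" for n x r
  proof -
    obtain X bX where X: "X < m n" "x = vert X bX" using x unfolding sub_verts_eq XX_iff by blast
    have "ereal r \<le> ereal (2 * 2 ^ n)" using d EE_diam[of n] unfolding sub_verts_eq sub_edges_eq[OF n] by (rule order_trans)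
    then have "r \<le> 2 * 2 ^ n" by simp
    then show ?thesis unfolding sub_verts_eq sub_edges_eq[OF n] X(2) measure_ball_M using CC(2,3)[OF X(1) r] by blast
  qed
  have root: "root \<in> Xinf" unfolding root_def using Xinf_iff by blast
  show ?thesis
  proof (rule exI[of _ Xinf], rule exI[of _ Einf], rule exI[of _ root], intro conjI)
    show "\<exists>C1>1. \<forall>x\<in>Xinf. \<forall>r\<ge>1. inverse C1 * V r \<le> measure (graph_measure Xinf Einf) (graph_ball Xinf Einf x r) \<and>
       measure (graph_measure Xinf Einf) (graph_ball Xinf Einf x r) \<le> C1 * V r"
      by (rule exI[of _ CC], rule conjI, rule CC(1), intro ballI allI impI, rule 2)
    show "\<exists>C2>1. \<forall>n\<ge>1. \<forall>x\<in>sub_verts Xinf Einf root n. \<forall>r\<ge>1.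
       ereal r \<le> graph_diam (sub_verts Xinf Einf root n) (sub_edges Xinf Einf root n) \<longrightarrow>
       inverse C2 * V r
         \<le> measure (graph_measure (sub_verts Xinf Einf root n) (sub_edges Xinf Einf root n))
              (graph_ball (sub_verts Xinf Einf root n) (sub_edges Xinf Einf root n) x r) \<and>
       measure (graph_measure (sub_verts Xinf Einf root n) (sub_edges Xinf Einf root n))
              (graph_ball (sub_verts Xinf Einf root n) (sub_edges Xinf Einf root n) x r)
         \<le> C2 * V r"
      by (rule exI[of _ CC], rule conjI, rule CC(1), intro ballI allI impI, rule 4)
  qed (rule infinite_Xinf connected_graph_inf root 1 3)+
qed

end

theorem theorem5p13:
  fixes V \<Psi> :: "real \<Rightarrow> real" and C0 :: real
  assumes "homeo_ge1 V" and "doubling V"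
    and "homeo_ge1 \<Psi>" and "doubling \<Psi>"
    and "C0 > 1"
    and "\<And>r R. 1 < r \<Longrightarrow> r \<le> R \<Longrightarrow>
           inverse C0 * (R\<^sup>2 / r\<^sup>2) \<le> \<Psi> R / \<Psi> r \<and>
           \<Psi> R / \<Psi> r \<le> C0 * ((R * V R) / (r * V r))"
  shows "\<exists>(X :: nat set) E p.
    infinite X \<and> connected_graph X E \<and> p \<in> X \<and>
    HKE_df \<Psi> X E \<and>
    (\<exists>C1>1. \<forall>x\<in>X. \<forall>r\<ge>1.
       inverse C1 * V r \<le> measure (graph_measure X E) (graph_ball X E x r) \<and>
       measure (graph_measure X E) (graph_ball X E x r) \<le> C1 * V r) \<and>
    HKE_df_uniform \<Psi> {1::nat..} (sub_verts X E p) (sub_edges X E p) \<and>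
    (\<exists>C2>1. \<forall>n\<ge>1. \<forall>x\<in>sub_verts X E p n. \<forall>r\<ge>1.
       ereal r \<le> graph_diam (sub_verts X E p n) (sub_edges X E p n) \<longrightarrow>
       inverse C2 * V r
         \<le> measure (graph_measure (sub_verts X E p n) (sub_edges X E p n))
              (graph_ball (sub_verts X E p n) (sub_edges X E p n) x r) \<and>
       measure (graph_measure (sub_verts X E p n) (sub_edges X E p n))
              (graph_ball (sub_verts X E p n) (sub_edges X E p n) x r)
         \<le> C2 * V r)"
proof -
  note Vm = homeo_ge1_strict_mono[OF assms(1)] and V1 = homeo_ge1_one[OF assms(1)]
  note Pm = homeo_ge1_strict_mono[OF assms(3)] and P1 = homeo_ge1_one[OF assms(3)]
  have Vle: "V r \<le> V R" if "1 \<le> r" "r \<le> R" for r R using Vm[of r R] that by (cases "r = R") auto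
  have Ple: "\<Psi> r \<le> \<Psi> R" if "1 \<le> r" "r \<le> R" for r R using Pm[of r R] that by (cases "r = R") auto
  have V0: "1 \<le> V r" if "1 \<le> r" for r using Vle[of 1 r] V1 that by simp
  have P0: "1 \<le> \<Psi> r" if "1 \<le> r" for r using Ple[of 1 r] P1 that by simp
  obtain CV where CV: "1 < CV" "\<And>r. 1 \<le> r \<Longrightarrow> V (2 * r) \<le> CV * V r" using assms(2) by (auto simp: doubling_def)
  obtain CP where CP: "1 < CP" "\<And>r. 1 \<le> r \<Longrightarrow> \<Psi> (2 * r) \<le> CP * \<Psi> r" using assms(4) by (auto simp: doubling_def)
  define c0 where "c0 = 1 / (4 * C0)"
  have c0: "0 < c0" using assms(5) by (simp add: c0_def)
  have low1: "R\<^sup>2 / r\<^sup>2 * \<Psi> r \<le> C0 * \<Psi> R" if "1 < r" "r \<le> R" for r R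
    using assms(6)[OF that] P0[of r] that assms(5) by (simp add: field_simps)
  \<comment> \<open>The hypothesis concerns radii above 1 only. Radius 1 is handled by comparison
    with radius 2, which is the origin of the factor 4 in \<open>c0\<close>.\<close>
  have Plow: "c0 * (R / r)\<^sup>2 * \<Psi> r \<le> \<Psi> R" if r: "1 \<le> r" "r \<le> R" for r R
  proof (cases "1 < r")
    case True
    have "(R / r)\<^sup>2 * \<Psi> r \<le> C0 * \<Psi> R" using low1[OF True r(2)] by (simp add: power_divide)
    also have "\<dots> \<le> 4 * C0 * \<Psi> R" using assms(5) P0[of R] r by simp
    finally have "(R / r)\<^sup>2 * \<Psi> r / (4 * C0) \<le> \<Psi> R" using assms(5) by (simp add: pos_divide_le_eq mult.commute)
    then show ?thesis by (simp add: c0_def)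
  next
    case False
    then have r1: "r = 1" using r by simp
    show ?thesis
    proof (cases "R \<le> 2")
      case True
      then have "R\<^sup>2 \<le> 2\<^sup>2" using r by (intro power_mono) auto
      also have "(2::real)\<^sup>2 \<le> 4 * C0" using assms(5) by simp
      finally have "c0 * R\<^sup>2 \<le> 1" using assms(5) by (simp add: c0_def divide_le_eq)
      then show ?thesis using r1 P1 P0[of R] r by simp
    next
      case R2: False
      then have "R\<^sup>2 / 2\<^sup>2 * \<Psi> 2 \<le> C0 * \<Psi> R" by (intro low1) auto
      moreover have "R\<^sup>2 / 2\<^sup>2 * 1 \<le> R\<^sup>2 / 2\<^sup>2 * \<Psi> 2" using P0[of 2] by (intro mult_left_mono) auto
      ultimately have "R\<^sup>2 \<le> 4 * C0 * \<Psi> R" by simp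
      then show ?thesis using r1 P1 assms(5) by (simp add: c0_def divide_le_eq mult.commute)
    qed
  qed
  \<comment> \<open>The hypothesis is applied to \<open>2 * r\<close>, which exceeds 1, and doubling
    of \<Psi> returns to \<open>r\<close>. Powers of two fall under one of the two
    alternatives.\<close>
  have Pup: "\<Psi> R * (r * V r) \<le> C0 * CP * (R * V R) * \<Psi> r" if r: "1 \<le> r" "2 * r \<le> R \<or> r = R" for r R
  proof (cases "r = R")
    case True
    have "1 * 1 \<le> C0 * CP" using assms(5) CP(1) by (intro mult_mono) auto
    moreover have "0 \<le> \<Psi> R * (R * V R)" using P0[of R] V0[of R] r True by simp
    ultimately have "1 * (\<Psi> R * (R * V R)) \<le> C0 * CP * (\<Psi> R * (R * V R))" by (intro mult_right_mono) auto
    then show ?thesis using True by (simp add: mult_ac)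
  next
    case False
    let ?s = "2 * r"
    have s: "1 < ?s" "?s \<le> R" using r False by auto
    have ps: "0 < \<Psi> ?s" "0 < V ?s" "0 < \<Psi> r" using P0[of ?s] V0[of ?s] P0[of r] r by auto
    have "\<Psi> R \<le> C0 * ((R * V R) / (?s * V ?s)) * \<Psi> ?s"
      using assms(6)[OF s] ps by (simp add: divide_le_eq)
    then have "\<Psi> R * (?s * V ?s) \<le> C0 * (R * V R) * \<Psi> ?s" using ps s by (simp add: field_simps)
    also have "\<dots> \<le> C0 * (R * V R) * (CP * \<Psi> r)"
      using assms(5) CP(2)[OF r(1)] V0[of R] s by (intro mult_left_mono) auto
    finally have A: "\<Psi> R * (?s * V ?s) \<le> C0 * CP * (R * V R) * \<Psi> r" by (simp add: mult_ac)
    have "\<Psi> R * (r * V r) \<le> \<Psi> R * (?s * V ?s)"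
      using r s P0[of R] Vle[of r ?s] V0[of r] by (intro mult_left_mono mult_mono) auto
    then show ?thesis using A by linarith
  qed
  have pw: "(1::real) \<le> 2 ^ k" for k by simp
  have P0': "0 < \<Psi> (2 ^ k)" and V0': "0 < V (2 ^ k)" for k using P0[OF pw, of k] V0[OF pw, of k] by auto
  \<comment> \<open>Targets for the products of \<open>a\<close> and of \<open>f\<close>: from
    \<open>t k = 2 ^ k * A k\<close> and \<open>m k = A k * W k\<close> one reads off \<Psi>(2^k) /
    2^k for \<open>A k\<close> and V(2^k) 2^k / \<Psi>(2^k) for \<open>W k\<close>.\<close>
  define zA where "zA k = \<Psi> (2 ^ k) / 2 ^ k" for k
  define zW where "zW k = V (2 ^ k) * 2 ^ k / \<Psi> (2 ^ k)" for k
  have zAp: "0 < zA k" and zWp: "0 < zW k" for k using P0' V0' by (simp_all add: zA_def zW_def)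
  have zAl: "c0 * real 2 ^ (j - k) * zA k \<le> zA j" if kj: "k \<le> j" for j k
  proof -
    have e: "(2::real) ^ j = 2 ^ (j - k) * 2 ^ k" using kj by (simp add: power_add[symmetric])
    have "c0 * (2 ^ j / 2 ^ k)\<^sup>2 * \<Psi> (2 ^ k) \<le> \<Psi> (2 ^ j)" by (rule Plow) (use kj in auto)
    then have "c0 * (2 ^ (j - k) * 2 ^ (j - k)) * \<Psi> (2 ^ k) \<le> \<Psi> (2 ^ j)" unfolding e by (simp add: power2_eq_square)
    then have "c0 * (2 ^ (j - k) * 2 ^ (j - k)) * \<Psi> (2 ^ k) / 2 ^ j \<le> zA j" unfolding zA_def by (rule divide_right_mono) simp
    then show ?thesis unfolding zA_def e by simp
  qed
  have zAu: "zA (Suc k) \<le> CP * zA k" for k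
  proof -
    have "\<Psi> (2 ^ Suc k) \<le> CP * \<Psi> (2 ^ k)" using CP(2)[OF pw] by simp
    then have "\<Psi> (2 ^ Suc k) / 2 ^ Suc k \<le> CP * \<Psi> (2 ^ k) / 2 ^ Suc k" by (rule divide_right_mono) simp
    also have "\<dots> \<le> CP * \<Psi> (2 ^ k) / 2 ^ k" using CP(1) P0'[of k] by (intro divide_left_mono) auto
    finally show ?thesis by (simp add: zA_def)
  qed
  have zWl: "1 / (C0 * CP) * real 1 ^ (j - k) * zW k \<le> zW j" if kj: "k \<le> j" for j k
  proof -
    have "2 * 2 ^ k \<le> (2::real) ^ j \<or> (2::real) ^ k = 2 ^ j"
    proof (cases "k = j")
      case False
      then have "Suc k \<le> j" using kj by simp
      then have "(2::real) ^ Suc k \<le> 2 ^ j" by (intro power_increasing) auto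
      then show ?thesis by simp
    qed simp
    then have "\<Psi> (2 ^ j) * (2 ^ k * V (2 ^ k)) \<le> C0 * CP * (2 ^ j * V (2 ^ j)) * \<Psi> (2 ^ k)" by (intro Pup pw)
    then show ?thesis using P0'[of j] P0'[of k] assms(5) CP(1) by (simp add: zW_def field_simps)
  qed
  have zWu: "zW (Suc k) \<le> 2 * CV * zW k" for k
  proof -
    have "V (2 ^ Suc k) \<le> CV * V (2 ^ k)" using CV(2)[OF pw] by simp
    then have "V (2 ^ Suc k) * 2 ^ Suc k / \<Psi> (2 ^ Suc k) \<le> (CV * V (2 ^ k)) * 2 ^ Suc k / \<Psi> (2 ^ Suc k)"
      using P0'[of "Suc k"] by (intro divide_right_mono mult_right_mono) auto
    also have "\<dots> \<le> (CV * V (2 ^ k)) * 2 ^ Suc k / \<Psi> (2 ^ k)"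
      using P0'[of k] P0'[of "Suc k"] V0'[of k] CV(1) by (intro divide_left_mono Ple mult_pos_pos) auto
    also have "\<dots> = 2 * CV * zW k" by (simp add: zW_def)
    finally show ?thesis by (simp only: zW_def)
  qed
  obtain a BA QA where a: "\<And>k. 2 \<le> a k" "\<And>k. a k \<le> BA" "1 \<le> QA"
    "\<And>k. real (\<Prod>i<k. a i) \<le> QA * zA k" "\<And>k. zA k \<le> QA * real (\<Prod>i<k. a i)"
    by (rule integer_product_approx[OF zAp one_le_numeral c0 zAl zAu]) (assumption | rule that)+
  have cW: "0 < 1 / (C0 * CP)" using assms(5) CP(1) by simp
  obtain f BF QF where f: "\<And>k. 1 \<le> f k" "\<And>k. f k \<le> BF" "1 \<le> QF"
    "\<And>k. real (\<Prod>i<k. f i) \<le> QF * zW k" "\<And>k. zW k \<le> QF * real (\<Prod>i<k. f i)"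
    by (rule integer_product_approx[OF zWp order_refl cW zWl zWu]) (assumption | rule that)+
  interpret g: glued_blocks a f "BA * BF"
    by unfold_locales (use a f in \<open>auto intro: mult_le_mono\<close>)
  have VV: "zA k * zW k = V (2 ^ k)" for k using P0'[of k] by (simp add: zA_def zW_def)
  have PP: "2 ^ k * zA k = \<Psi> (2 ^ k)" for k by (simp add: zA_def)
  have mk: "real (g.m k) = real (\<Prod>i<k. a i) * real (\<Prod>i<k. f i)" for k by (simp add: g.m_eq g.A_def g.W_def)
  have tk: "real (g.t k) = 2 ^ k * real (\<Prod>i<k. a i)" for k by (simp add: g.t_def g.A_def)
  interpret s: scaled_blocks a f "BA * BF" V \<Psi> "QA * QF" QA CV CP c0
  proof unfold_locales
    show "1 \<le> QA * QF" using mult_mono[OF a(3) f(3)] a(3) by simp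
    show "real (g.m k) \<le> QA * QF * V (2 ^ k)" for k
    proof -
      have "real (g.m k) \<le> (QA * zA k) * (QF * zW k)"
        unfolding mk using a(3) zAp[of k] by (intro mult_mono a f) (auto intro!: prod_nonneg)
      then show ?thesis by (simp add: VV[symmetric] mult_ac)
    qed
    show "V (2 ^ k) \<le> QA * QF * real (g.m k)" for k
    proof -
      have "zA k * zW k \<le> (QA * real (\<Prod>i<k. a i)) * (QF * real (\<Prod>i<k. f i))"
        using zWp[of k] a(3) by (intro mult_mono a f) (auto simp: less_imp_le intro!: prod_nonneg mult_nonneg_nonneg)
      then show ?thesis by (simp add: VV mk mult_ac)
    qed
    show "real (g.t k) \<le> QA * \<Psi> (2 ^ k)" for k
    proof -
      have "2 ^ k * real (\<Prod>i<k. a i) \<le> 2 ^ k * (QA * zA k)" by (intro mult_left_mono a) simp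
      then show ?thesis by (simp add: PP[symmetric] tk mult_ac)
    qed
    show "\<Psi> (2 ^ k) \<le> QA * real (g.t k)" for k
    proof -
      have "2 ^ k * zA k \<le> 2 ^ k * (QA * real (\<Prod>i<k. a i))" by (intro mult_left_mono a) simp
      then show ?thesis unfolding PP by (simp add: tk mult_ac)
    qed
  qed (use Vle V1 Pm P1 homeo_ge1_surj[OF assms(3)] CV CP Plow c0 a(3) in auto)
  show ?thesis by (rule s.glued_graph_realises[OF assms(3)])
qed

end
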